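(* Assume Hypothesis (H1) on $X_n$ and Assumption (A1) on $\nu$, in either the i.i.d. or the orthonormalised model (notation in the context). Fix, independently of $n$, an integer $i\ge1$ and a neighbourhood $V$ of $\rho_{\theta_i}$ if $i\le r_0$, or of $a$ if $i>r_0$. Then $\widetilde\lambda_i^n\in V$ with overwhelming probability. Similarly, for any fixed integer $i\ge0$ and any neighbourhood $V$ of $\rho_{\theta_{r-i}}$ if $i<r-r_0$, or of $b$ if $i\ge r-r_0$, $\widetilde\lambda^n_{n-i}\in V$ with overwhelming probability.
   Context: For each $n\ge1$, $X_n$ is a deterministic $n\times n$ Hermitian (or real symmetric) matrix with eigenvalues $\lambda_1^n\le\cdots\le\lambda_n^n$ and spectral measure $\mu_n=\frac1n\sum_{l=1}^n\delta_{\lambda_l^n}$. Hypothesis (H1): $\mu_n$ converges weakly to a deterministic compactly supported probability measure $\mu_X$, and $\lambda_1^n\to a$, $\lambda_n^n\to b$, where $a,b$ are the lower and upper bounds of the support of $\mu_X$. Assumption (A1): $\nu$ is a probability measure on $\mathbb R$ or $\mathbb C$ satisfying a logarithmic Sobolev inequality, centred, with variance one; if $\nu$ is not supported on $\mathbb R$, its real and imaginary parts are independent and identically distributed. Fix $r\ge1$ and nonzero reals $\theta_1\le\cdots\le\theta_r$ independent of $n$; $r_0\in\{0,\ldots,r\}$ is such that $\theta_1\le\cdots\le\theta_{r_0}<0<\theta_{r_0+1}\le\cdots\le\theta_r$. Let $v^n=\frac1{\sqrt n}(x_1,\ldots,x_n)^T$, $x_i$ i.i.d. with law $\nu$. i.i.d.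 model: $u_1^n,\ldots,u_r^n$ independent copies of $v^n$; orthonormalised model: Gram–Schmidt orthonormalisation of $r$ independent copies of $v^n$ (restricted to the event where it is well defined). $\widetilde X_n=X_n+\sum_{i=1}^r\theta_iu_i^nu_i^{n*}$ has eigenvalues $\widetilde\lambda_1^n\le\cdots\le\widetilde\lambda_n^n$. $G_{\mu_X}(z)=\int\frac{d\mu_X(x)}{z-x}$ for $z\notin[a,b]$; $\overline\theta=1/\lim_{z\downarrow b}G_{\mu_X}(z)\ge0$, $\underline\theta=1/\lim_{z\uparrow a}G_{\mu_X}(z)\le0$ (with $1/\pm\infty=0$); $\rho_\theta=G_{\mu_X}^{-1}(1/\theta)$ if $\theta\in(-\infty,\underline\theta)\cup(\overline\theta,\infty)$, $\rho_\theta=a$ if $\theta\in[\underline\theta,0)$, $\rho_\theta=b$ if $\theta\in(0,\overline\theta]$. A sequence of events $(E_n)$ occurs with overwhelming probability if there exist constants $C,\eta>0$ independent of $n$ with $\mathbb P(E_n)\ge1-Ce^{-n^\eta}$. *)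

theory Defs
  imports "Jordan_Normal_Form.Char_Poly" "HOL-Probability.Probability"
begin

definition hermitian_mat :: "nat \<Rightarrow> complex mat \<Rightarrow> bool" where
  "hermitian_mat n A \<longleftrightarrow> A \<in> carrier_mat n n \<and>
     (\<forall>i<n. \<forall>j<n. A $$ (i,j) = cnj (A $$ (j,i)))"

text \<open>Eigenvalues of a Hermitian matrix, counted with multiplicity, in nondecreasing
  order: the sorted list of the (real) roots of the characteristic polynomial.
  Index 0 of the list is the paper's lambda_1.\<close>
definition eigs :: "complex mat \<Rightarrow> real list" where
  "eigs A = (THE l. length l = dim_row A \<and> sorted l \<and>
       char_poly A = (\<Prod>x\<leftarrow>l. [: - complex_of_real x, 1 :]))"

definition meas_support :: "real measure \<Rightarrow> real set" where
  "meas_support \<mu> = {x. \<forall>e>0. measure \<mu> {x - e <..< x + e} > 0}"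

definition supp_lo :: "real measure \<Rightarrow> real" where
  "supp_lo \<mu> = Inf (meas_support \<mu>)"

definition supp_hi :: "real measure \<Rightarrow> real" where
  "supp_hi \<mu> = Sup (meas_support \<mu>)"

definition cauchy_transform :: "real measure \<Rightarrow> real \<Rightarrow> real" where
  "cauchy_transform \<mu> z = (\<integral>x. 1 / (z - x) \<partial>\<mu>)"

definition theta_bar :: "real measure \<Rightarrow> real" where
  "theta_bar \<mu> = (if filterlim (cauchy_transform \<mu>) at_top (at_right (supp_hi \<mu>)) then 0
                  else 1 / Lim (at_right (supp_hi \<mu>)) (cauchy_transform \<mu>))"

definition theta_under :: "real measure \<Rightarrow> real" where
  "theta_under \<mu> = (if filterlim (cauchy_transform \<mu>) at_bot (at_left (supp_lo \<mu>)) then 0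
                    else 1 / Lim (at_left (supp_lo \<mu>)) (cauchy_transform \<mu>))"

definition rho :: "real measure \<Rightarrow> real \<Rightarrow> real" where
  "rho \<mu> \<theta> =
     (if \<theta> > theta_bar \<mu> then
        (THE z. z > supp_hi \<mu> \<and> cauchy_transform \<mu> z = 1 / \<theta>)
      else if \<theta> < theta_under \<mu> then
        (THE z. z < supp_lo \<mu> \<and> cauchy_transform \<mu> z = 1 / \<theta>)
      else if \<theta> < 0 then supp_lo \<mu> else supp_hi \<mu>)"

text \<open>nu satisfies a log-Sobolev inequality with some constant c > 0: for every
  real C^1 function f on \<complex> (viewed as \<real>^2) which is bounded with bounded gradient,
  Ent_nu(f^2) \<le> 2 c \<integral> |\<nabla>f|^2 d nu, where |\<nabla>f(z)|^2 = (Df z 1)^2 + (Df z i)^2.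
  (For nu supported on \<real> this is equivalent to the LSI on \<real>.)\<close>
definition log_sobolev :: "complex measure \<Rightarrow> bool" where
  "log_sobolev \<nu> \<longleftrightarrow> (\<exists>c>0. \<forall>(f :: complex \<Rightarrow> real) Df.
      (\<forall>z. (f has_derivative Df z) (at z)) \<and>
      continuous_on UNIV (\<lambda>z. Df z 1) \<and> continuous_on UNIV (\<lambda>z. Df z \<i>) \<and>
      bounded (range f) \<and> bounded (range (\<lambda>z. Df z 1)) \<and> bounded (range (\<lambda>z. Df z \<i>))
      \<longrightarrow>
      (\<integral>z. (f z)\<^sup>2 * ln ((f z)\<^sup>2) \<partial>\<nu>) - (\<integral>z. (f z)\<^sup>2 \<partial>\<nu>) * ln (\<integral>z. (f z)\<^sup>2 \<partial>\<nu>)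
        \<le> 2 * c * (\<integral>z. (Df z 1)\<^sup>2 + (Df z \<i>)\<^sup>2 \<partial>\<nu>))"

definition assumption_A1 :: "complex measure \<Rightarrow> bool" where
  "assumption_A1 \<nu> \<longleftrightarrow> prob_space \<nu> \<and> sets \<nu> = sets borel \<and> log_sobolev \<nu> \<and>
     integrable \<nu> (\<lambda>z. z) \<and> (\<integral>z. z \<partial>\<nu>) = 0 \<and>
     integrable \<nu> (\<lambda>z. (cmod z)\<^sup>2) \<and> (\<integral>z. (cmod z)\<^sup>2 \<partial>\<nu>) = 1 \<and>
     ((AE z in \<nu>. Im z = 0) \<or>
      distr \<nu> (borel \<Otimes>\<^sub>M borel) (\<lambda>z. (Re z, Im z))
        = distr \<nu> borel Re \<Otimes>\<^sub>M distr \<nu> borel Re \<and>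
      distr \<nu> borel Im = distr \<nu> borel Re)"

definition cinner :: "complex Matrix.vec \<Rightarrow> complex Matrix.vec \<Rightarrow> complex" where
  "cinner a b = (\<Sum>i<dim_vec a. cnj (vec_index a i) * vec_index b i)"

definition vnorm :: "complex Matrix.vec \<Rightarrow> real" where
  "vnorm a = sqrt (\<Sum>i<dim_vec a. (cmod (vec_index a i))\<^sup>2)"

definition gs_res :: "complex Matrix.vec list \<Rightarrow> complex Matrix.vec \<Rightarrow> complex Matrix.vec" where
  "gs_res es x = Matrix.vec (dim_vec x) (\<lambda>i. vec_index x i - (\<Sum>e\<leftarrow>es. cinner e x * vec_index e i))"

primrec gsl :: "(nat \<Rightarrow> complex Matrix.vec) \<Rightarrow> nat \<Rightarrow> complex Matrix.vec list" where
  "gsl v 0 = []"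
| "gsl v (Suc k) = (let w = gs_res (gsl v k) (v (Suc k))
                    in gsl v k @ [Matrix.vec (dim_vec w) (\<lambda>i. vec_index w i / complex_of_real (vnorm w))])"

definition gs_defined :: "(nat \<Rightarrow> complex Matrix.vec) \<Rightarrow> nat \<Rightarrow> bool" where
  "gs_defined v r \<longleftrightarrow> (\<forall>k<r. vnorm (gs_res (gsl v k) (v (Suc k))) \<noteq> 0)"

definition sample_space :: "complex measure \<Rightarrow> nat \<Rightarrow> nat \<Rightarrow> (nat \<times> nat \<Rightarrow> complex) measure" where
  "sample_space \<nu> r n = PiM ({1..r} \<times> {..<n}) (\<lambda>_. \<nu>)"

definition vvec :: "nat \<Rightarrow> (nat \<times> nat \<Rightarrow> complex) \<Rightarrow> nat \<Rightarrow> complex Matrix.vec" where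
  "vvec n \<omega> k = Matrix.vec n (\<lambda>i. \<omega> (k, i) / complex_of_real (sqrt (real n)))"

definition uvec :: "bool \<Rightarrow> nat \<Rightarrow> nat \<Rightarrow> (nat \<times> nat \<Rightarrow> complex) \<Rightarrow> nat \<Rightarrow> complex Matrix.vec" where
  "uvec orth r n \<omega> k = (if orth then gsl (vvec n \<omega>) r ! (k - 1) else vvec n \<omega> k)"

definition model_ok :: "bool \<Rightarrow> nat \<Rightarrow> nat \<Rightarrow> (nat \<times> nat \<Rightarrow> complex) \<Rightarrow> bool" where
  "model_ok orth r n \<omega> \<longleftrightarrow> (orth \<longrightarrow> gs_defined (vvec n \<omega>) r)"

definition perturbed :: "bool \<Rightarrow> nat \<Rightarrow> (nat \<Rightarrow> real) \<Rightarrow> complex mat \<Rightarrow> nat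
    \<Rightarrow> (nat \<times> nat \<Rightarrow> complex) \<Rightarrow> complex mat" where
  "perturbed orth r \<theta> X n \<omega> = Matrix.mat n n (\<lambda>(i,j). X $$ (i,j) +
      (\<Sum>k\<in>{1..r}. complex_of_real (\<theta> k) * vec_index (uvec orth r n \<omega> k) i * cnj (vec_index (uvec orth r n \<omega> k) j)))"

definition hypothesis_H1 :: "(nat \<Rightarrow> complex mat) \<Rightarrow> real measure \<Rightarrow> bool" where
  "hypothesis_H1 X \<mu> \<longleftrightarrow>
     (\<forall>n\<ge>1. hermitian_mat n (X n)) \<and>
     prob_space \<mu> \<and> sets \<mu> = sets borel \<and> compact (meas_support \<mu>) \<and>
     (\<forall>f :: real \<Rightarrow> real. continuous_on UNIV f \<and> bounded (range f) \<longrightarrow>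
        (\<lambda>n. (1 / real n) * (\<Sum>l<n. f (eigs (X n) ! l))) \<longlonglongrightarrow> (\<integral>x. f x \<partial>\<mu>)) \<and>
     (\<lambda>n. eigs (X n) ! 0) \<longlonglongrightarrow> supp_lo \<mu> \<and>
     (\<lambda>n. eigs (X n) ! (n - 1)) \<longlonglongrightarrow> supp_hi \<mu>"

definition overwhelming :: "(nat \<Rightarrow> real) \<Rightarrow> bool" where
  "overwhelming P \<longleftrightarrow> (\<exists>C \<eta>. C > 0 \<and> \<eta> > 0 \<and>
      (\<forall>n. P n \<ge> 1 - C * exp (- (real n powr \<eta>))))"

end

(* Above the edge b, the number of eigenvalues of X + U Theta U^* beyond z is governed by the
   r x r matrix U^* R(z) U with R(z) = (z - X)^-1: testing the quadratic form of z - X - U Theta U^*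
   on suitable spaces shows that if U^* R(z) U is close to G(z) I, then the i-th largest eigenvalue
   lies below or above z according to the sign of theta G(z) - 1 for the i-th largest theta. This
   sign is what characterises rho. The closeness holds off an exponentially small event: by Herbst's
   argument the logarithmic Sobolev inequality makes nu sub-Gaussian, decoupling and conditioning give
   a Hanson-Wright bound for the entries of U^* R(z) U in the i.i.d. model, and the same bound for
   U^* U shows that Gram-Schmidt hardly moves the vectors. Interlacing handles the case rho = b, and
   the lower edge is the upper edge of - X. *)
theory Submission
  imports Defs
begin

section \<open>Hermitian matrices\<close>

text \<open>Since \<open>r\<close> does not grow with \<open>n\<close>, only finitely many scalar
  forms have to concentrate, and since every comparison of \<theta> G(z) with 1 is strict, a fixed
  accuracy suffices: no rate of convergence in (H1) enters. The reflection of X to - X reverses the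
  order of the spikes and of the vectors, and a reversed family is no longer a Gram-Schmidt output.
  The edge argument therefore lives in the locale \<open>spiked_model\<close>, where the vectors are
  arbitrary and only the concentration of their spectral forms is assumed; both models and their
  reflections are instances of it. Eigenvalues are handled through orthonormal eigenbases of vectors
  represented as functions, where every dimension count is the nontrivial solvability of a
  homogeneous system with more unknowns than equations. Events are estimated from inside by
  measurable sets, so the measurability of eigenvalues matters only when the final probabilities are
  formed.\<close>

lemma homogeneous_system_nontrivial:
  fixes a :: "nat \<Rightarrow> nat \<Rightarrow> 'a::field"
  assumes "m < p"
  shows "\<exists>c. (\<exists>j<p. c j \<noteq> 0) \<and> (\<forall>i<m. (\<Sum>j<p. a i j * c j) = 0)"
  using assms
proof (induction m arbitrary: a p)
  case 0
  then show ?case by (intro exI[of _ "\<lambda>_. 1"]) auto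
next
  case (Suc m)
  then obtain q where q: "p = Suc q" "m < q" by (metis Suc_lessE)
  show ?case
  proof (cases "\<forall>j<p. a m j = 0")
    case True
    obtain c where "\<exists>j<p. c j \<noteq> 0" "\<forall>i<m. (\<Sum>j<p. a i j * c j) = 0"
      using Suc.IH[of p a] Suc.prems by auto
    then show ?thesis using True by (intro exI[of _ c]) (auto simp: less_Suc_eq)
  next
    case False
    then obtain s where s: "s < p" "a m s \<noteq> 0" by auto
    \<comment> \<open>Gaussian elimination: the pivot column is moved to the last position
      \<open>q\<close>, so that eliminating it from the other equations leaves a system in the
      unknowns below \<open>q\<close>.\<close>
    define \<sigma> where "\<sigma> = Transposition.transpose s q"
    have \<sigma>: "bij_betw \<sigma> {..<p} {..<p}"
      unfolding \<sigma>_def using s q by (intro permutes_imp_bij permutes_swap_id) auto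
    have \<sigma>\<sigma>: "\<sigma> (\<sigma> j) = j" for j by (simp add: \<sigma>_def)
    define b where "b i j = a i (\<sigma> j)" for i j
    have bq: "b m q \<noteq> 0" using s by (simp add: b_def \<sigma>_def)
    define a' where "a' i j = b i j - b i q / b m q * b m j" for i j
    obtain c where c: "\<exists>j<q. c j \<noteq> 0" "\<forall>i<m. (\<Sum>j<q. a' i j * c j) = 0"
      using Suc.IH[of q a'] q by auto
    define d where "d j = (if j < q then c j else - (\<Sum>j<q. b m j * c j) / b m q)" for j
    have split: "(\<Sum>j<p. b i j * d j) = (\<Sum>j<q. b i j * c j) + b i q * (- (\<Sum>j<q. b m j * c j) / b m q)" for i
      unfolding q(1) by (simp add: d_def)
    have "(\<Sum>j<p. b i j * d j) = 0" if "i < Suc m" for i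
    proof (cases "i = m")
      case True
      then show ?thesis using bq by (simp add: split)
    next
      case False
      then have "(\<Sum>j<q. a' i j * c j) = 0" using c that by auto
      moreover have "(\<Sum>j<q. a' i j * c j) = (\<Sum>j<q. b i j * c j) - b i q / b m q * (\<Sum>j<q. b m j * c j)"
        unfolding a'_def left_diff_distrib sum_subtractf sum_distrib_left by (simp add: mult.assoc)
      ultimately show ?thesis unfolding split by simp
    qed
    moreover have "(\<Sum>j<p. a i j * d (\<sigma> j)) = (\<Sum>j<p. b i j * d j)" for i
      unfolding b_def by (subst sum.reindex_bij_betw[OF \<sigma>, symmetric]) (simp add: \<sigma>\<sigma>)
    moreover have "\<exists>j<p. d (\<sigma> j) \<noteq> 0"
    proof -
      obtain j where j: "j < q" "c j \<noteq> 0" using c by auto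
      then have "\<sigma> j < p" using \<sigma> q by (auto simp: bij_betw_def)
      then show ?thesis using j by (intro exI[of _ "\<sigma> j"]) (auto simp: \<sigma>\<sigma> d_def)
    qed
    ultimately show ?thesis by (intro exI[of _ "\<lambda>j. d (\<sigma> j)"]) auto
  qed
qed

text \<open>Vectors of length \<open>n\<close> are functions whose values from \<open>n\<close> on
  are arbitrary; equality of vectors means agreement below \<open>n\<close>.\<close>

definition ip :: "nat \<Rightarrow> (nat \<Rightarrow> complex) \<Rightarrow> (nat \<Rightarrow> complex) \<Rightarrow> complex" where
  "ip n x y = (\<Sum>i<n. cnj (x i) * y i)"

definition nrm2 :: "nat \<Rightarrow> (nat \<Rightarrow> complex) \<Rightarrow> real" where
  "nrm2 n x = (\<Sum>i<n. (cmod (x i))\<^sup>2)"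

definition mv :: "nat \<Rightarrow> (nat \<Rightarrow> nat \<Rightarrow> complex) \<Rightarrow> (nat \<Rightarrow> complex) \<Rightarrow> nat \<Rightarrow> complex" where
  "mv n A w i = (\<Sum>j<n. A i j * w j)"

lemma ip_self: "ip n x x = of_real (nrm2 n x)"
  unfolding ip_def nrm2_def of_real_sum
  by (rule sum.cong) (auto simp: complex_norm_square mult.commute simp del: of_real_power)

lemma nrm2_nonneg [simp]: "nrm2 n x \<ge> 0"
  by (simp add: nrm2_def sum_nonneg)

lemma nrm2_eq_0_iff: "nrm2 n x = 0 \<longleftrightarrow> (\<forall>i<n. x i = 0)"
  by (auto simp: nrm2_def sum_nonneg_eq_0_iff)

lemma nrm2_pos_iff: "nrm2 n x > 0 \<longleftrightarrow> (\<exists>i<n. x i \<noteq> 0)"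
  using nrm2_eq_0_iff[of n x] nrm2_nonneg[of n x] by (metis less_eq_real_def less_irrefl)

lemma ip_cnj: "cnj (ip n x y) = ip n y x"
  by (simp add: ip_def mult.commute)

lemma ip_add_right: "ip n x (\<lambda>i. y i + z i) = ip n x y + ip n x z"
  by (simp add: ip_def distrib_left sum.distrib)

lemma ip_scale_right: "ip n x (\<lambda>i. c * y i) = c * ip n x y"
  by (simp add: ip_def sum_distrib_left mult.left_commute)

lemma ip_sum_right: "ip n x (\<lambda>i. \<Sum>k\<in>K. c k * y k i) = (\<Sum>k\<in>K. c k * ip n x (y k))"
  unfolding ip_def sum_distrib_left by (subst sum.swap) (simp add: mult.left_commute)

lemma ip_sum_left: "ip n (\<lambda>i. \<Sum>k\<in>K. c k * y k i) x = (\<Sum>k\<in>K. cnj (c k) * ip n (y k) x)"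
  unfolding ip_def cnj_sum sum_distrib_left sum_distrib_right
  by (subst sum.swap) (simp add: mult.left_commute mult.assoc)

lemma ip_cong: "(\<And>i. i < n \<Longrightarrow> x i = x' i) \<Longrightarrow> (\<And>i. i < n \<Longrightarrow> y i = y' i) \<Longrightarrow> ip n x y = ip n x' y'"
  by (simp add: ip_def)

definition hermitian_fun :: "nat \<Rightarrow> (nat \<Rightarrow> nat \<Rightarrow> complex) \<Rightarrow> bool" where
  "hermitian_fun n A \<longleftrightarrow> (\<forall>i<n. \<forall>j<n. A i j = cnj (A j i))"

lemma ip_mv_hermitian:
  assumes "hermitian_fun n A"
  shows "ip n x (mv n A y) = ip n (mv n A x) y"
proof -
  have "ip n x (mv n A y) = (\<Sum>i<n. \<Sum>j<n. cnj (x i) * A i j * y j)"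
    by (simp add: ip_def mv_def sum_distrib_left mult.assoc)
  also have "\<dots> = (\<Sum>i<n. \<Sum>j<n. cnj (x i) * cnj (A j i) * y j)"
  proof (intro sum.cong refl)
    fix i j assume "i \<in> {..<n}" "j \<in> {..<n}"
    then have "A i j = cnj (A j i)" using assms unfolding hermitian_fun_def by blast
    then show "cnj (x i) * A i j * y j = cnj (x i) * cnj (A j i) * y j" by metis
  qed
  also have "\<dots> = ip n (mv n A x) y"
    by (subst sum.swap) (simp add: ip_def mv_def sum_distrib_left sum_distrib_right mult.commute mult.left_commute)
  finally show ?thesis .
qed

lemma mv_sum: "mv n A (\<lambda>i. \<Sum>k\<in>K. c k * y k i) = (\<lambda>i. \<Sum>k\<in>K. c k * mv n A (y k) i)"
  unfolding mv_def sum_distrib_left by (subst sum.swap) (simp add: mult.left_commute)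

lemma mv_cong: "(\<And>i. i < n \<Longrightarrow> x i = x' i) \<Longrightarrow> mv n A x = mv n A x'"
  by (auto simp: mv_def fun_eq_iff)

text \<open>A polynomial annihilating a vector of a subspace splits into linear factors, and the
  factors are peeled off one at a time.\<close>
lemma eigenvector_of_annihilating_poly:
  fixes A :: "nat \<Rightarrow> nat \<Rightarrow> complex" and p :: "complex poly"
  assumes W_mv: "\<And>x. W x \<Longrightarrow> W (mv n A x)"
    and W_lin: "\<And>x y c. W x \<Longrightarrow> W y \<Longrightarrow> W (\<lambda>i. x i + c * y i)"
    and W0: "W (\<lambda>_. 0)"
    and "W w" "\<exists>i<n. w i \<noteq> 0" "p \<noteq> 0" "degree p \<le> N"
    and "\<forall>i<n. (\<Sum>k\<le>N. Polynomial.coeff p k * (mv n A ^^ k) w i) = 0"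
  shows "\<exists>x \<alpha>. W x \<and> (\<exists>i<n. x i \<noteq> 0) \<and> (\<forall>i<n. mv n A x i = \<alpha> * x i)"
  using assms(6-8)
proof (induction N arbitrary: p)
  case 0
  then have "Polynomial.coeff p 0 \<noteq> 0"
    by (metis le_0_eq leading_coeff_0_iff)
  then show ?case using 0 assms(5) by auto
next
  case (Suc N)
  show ?case
  proof (cases "degree p \<le> N")
    case True
    then have "Polynomial.coeff p (Suc N) = 0" by (simp add: coeff_eq_0)
    then show ?thesis using Suc.IH[OF Suc.prems(1) True] Suc.prems by simp
  next
    case False
    then have "degree p = Suc N" using Suc.prems by simp
    then have "\<not> constant (poly p)" by (simp add: constant_degree)
    then obtain \<alpha> where "poly p \<alpha> = 0" using fundamental_theorem_of_algebra by blast
    then obtain q where q: "p = [:-\<alpha>,1:] * q" by (auto simp: poly_eq_0_iff_dvd dvd_def)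
    have q0: "q \<noteq> 0" using q Suc.prems by auto
    have dq: "degree q \<le> N"
      using Suc.prems q0 by (simp add: q degree_mult_eq del: mult_pCons_left)
    define y where "y i = (\<Sum>k\<le>N. Polynomial.coeff q k * (mv n A ^^ k) w i)" for i
    have Wk: "W ((mv n A ^^ k) w)" for k by (induction k) (auto simp: assms(4) W_mv)
    have "W (\<lambda>i. \<Sum>k\<le>M. Polynomial.coeff q k * (mv n A ^^ k) w i)" for M
    proof (induction M)
      case 0
      then show ?case using W_lin[OF W0 Wk, of "Polynomial.coeff q 0" 0] by simp
    next
      case (Suc M)
      then show ?case using W_lin[OF Suc Wk[of "Suc M"]] by simp
    qed
    then have Wy: "W y" unfolding y_def[abs_def] .
    have my: "mv n A y = (\<lambda>i. \<Sum>k\<le>N. Polynomial.coeff q k * (mv n A ^^ Suc k) w i)"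
      unfolding y_def[abs_def] mv_sum by simp
    have "(\<Sum>k\<le>Suc N. Polynomial.coeff p k * (mv n A ^^ k) w i) = mv n A y i - \<alpha> * y i" for i
    proof -
      have c: "Polynomial.coeff p k = (case k of 0 \<Rightarrow> 0 | Suc k \<Rightarrow> Polynomial.coeff q k) - \<alpha> * Polynomial.coeff q k" for k
        unfolding q by (simp add: coeff_pCons split: nat.split)
      have "(\<Sum>k\<le>Suc N. Polynomial.coeff p k * (mv n A ^^ k) w i)
        = (\<Sum>k\<le>Suc N. (case k of 0 \<Rightarrow> 0 | Suc k \<Rightarrow> Polynomial.coeff q k) * (mv n A ^^ k) w i)
          - \<alpha> * (\<Sum>k\<le>Suc N. Polynomial.coeff q k * (mv n A ^^ k) w i)"
        unfolding c left_diff_distrib sum_subtractf sum_distrib_left by (simp add: mult.assoc)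
      also have "(\<Sum>k\<le>Suc N. (case k of 0 \<Rightarrow> 0 | Suc k \<Rightarrow> Polynomial.coeff q k) * (mv n A ^^ k) w i) = mv n A y i"
        unfolding my by (subst sum.atMost_Suc_shift) simp
      also have "(\<Sum>k\<le>Suc N. Polynomial.coeff q k * (mv n A ^^ k) w i) = y i"
        using dq by (simp add: y_def coeff_eq_0)
      finally show ?thesis .
    qed
    then have ev: "\<forall>i<n. mv n A y i = \<alpha> * y i" using Suc.prems(3) by simp
    \<comment> \<open>Either \<open>y\<close>, which is q(A) w, is an eigenvector for \<alpha>, or
      it vanishes and the polynomial \<open>q\<close> of smaller degree annihilates
      \<open>w\<close>.\<close>
    show ?thesis
    proof (cases "\<exists>i<n. y i \<noteq> 0")
      case True
      then show ?thesis using ev Wy by blast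
    next
      case False
      then show ?thesis using Suc.IH[OF q0 dq] by (simp add: y_def)
    qed
  qed
qed

definition orthonormal :: "nat \<Rightarrow> nat \<Rightarrow> (nat \<Rightarrow> nat \<Rightarrow> complex) \<Rightarrow> bool" where
  "orthonormal n m e \<longleftrightarrow> (\<forall>j<m. \<forall>k<m. ip n (e j) (e k) = (if j = k then 1 else 0))"

text \<open>The orthogonal complement \<open>W\<close> of the first \<open>m\<close> eigenvectors is
  nonzero because \<open>m < n\<close>, and invariant because \<open>A\<close> is Hermitian. The
  Krylov vectors w, A w, ..., A^n w of some nonzero \<open>w\<close> in \<open>W\<close> are
  dependent, which gives a polynomial annihilating \<open>w\<close> and hence an eigenvector inside
  \<open>W\<close>.\<close>

lemma orthonormal_eigenvectors:
  assumes A: "hermitian_fun n A" and "m \<le> n"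
  shows "\<exists>e l. orthonormal n m e \<and> (\<forall>k<m. \<forall>i<n. mv n A (e k) i = complex_of_real (l k) * e k i)"
  using assms(2)
proof (induction m)
  case 0
  then show ?case by (auto simp: orthonormal_def)
next
  case (Suc m)
  then obtain e l where e: "orthonormal n m e"
    and l: "\<forall>k<m. \<forall>i<n. mv n A (e k) i = complex_of_real (l k) * e k i" by auto
  define W where "W x \<longleftrightarrow> (\<forall>k<m. ip n (e k) x = 0)" for x
  obtain w where w: "\<exists>j<n. w j \<noteq> 0" "W w"
    using homogeneous_system_nontrivial[of m n "\<lambda>k i. cnj (e k i)"] Suc.prems
    by (auto simp: W_def ip_def)
  obtain c where c: "\<exists>j<Suc n. c j \<noteq> 0" "\<forall>i<n. (\<Sum>j<Suc n. (mv n A ^^ j) w i * c j) = 0"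
    using homogeneous_system_nontrivial[of n "Suc n" "\<lambda>i j. (mv n A ^^ j) w i"] by auto
  define p where "p = Poly (map c [0..<Suc n])"
  have cp: "Polynomial.coeff p k = (if k < Suc n then c k else 0)" for k
    unfolding p_def by (simp add: nth_default_def del: upt_Suc)
  have "p \<noteq> 0" using c(1) cp by (metis coeff_0)
  moreover have "degree p \<le> n" using cp by (auto intro!: degree_le)
  moreover have "\<forall>i<n. (\<Sum>k\<le>n. Polynomial.coeff p k * (mv n A ^^ k) w i) = 0"
    using c(2) by (simp add: cp lessThan_Suc_atMost mult.commute)
  moreover have "W (mv n A x)" if "W x" for x
  proof -
    have "ip n (e k) (mv n A x) = cnj (complex_of_real (l k)) * ip n (e k) x" if "k < m" for k
    proof -
      have "ip n (e k) (mv n A x) = ip n (mv n A (e k)) x" by (rule ip_mv_hermitian[OF A])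
      also have "\<dots> = (\<Sum>i<n. cnj (complex_of_real (l k) * e k i) * x i)"
        using l that by (simp add: ip_def)
      finally show ?thesis by (simp add: ip_def sum_distrib_left mult.assoc)
    qed
    then show ?thesis using that by (simp add: W_def)
  qed
  moreover have "W (\<lambda>i. x i + a * y i)" if "W x" "W y" for x y a
    using that by (simp add: W_def ip_add_right ip_scale_right)
  moreover have "W (\<lambda>_. 0)" by (simp add: W_def ip_def)
  ultimately obtain x \<alpha> where x: "W x" "\<exists>i<n. x i \<noteq> 0" "\<forall>i<n. mv n A x i = \<alpha> * x i"
    using eigenvector_of_annihilating_poly[of W n A w p n] w by blast
  have pos: "nrm2 n x > 0" using x by (simp add: nrm2_pos_iff)
  have E1: "ip n x (mv n A x) = \<alpha> * ip n x x"
    using x(3) by (simp add: ip_def sum_distrib_left mult.left_commute)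
  have E2: "ip n (mv n A x) x = cnj \<alpha> * ip n x x"
    using x(3) by (simp add: ip_def sum_distrib_left mult.assoc)
  have "\<alpha> * ip n x x = cnj \<alpha> * ip n x x"
    by (rule trans[OF E1[symmetric] trans[OF ip_mv_hermitian[OF A, of x x] E2]])
  then have "\<alpha> = cnj \<alpha>" using pos unfolding ip_self mult_cancel_right by auto
  then have \<alpha>: "\<alpha> = complex_of_real (Re \<alpha>)" by (metis Reals_cnj_iff complex_is_Real_iff of_real_Re)
  define s where "s = 1 / complex_of_real (sqrt (nrm2 n x))"
  define x' where "x' i = s * x i" for i
  have xx: "ip n x' x' = 1"
  proof -
    have "ip n x' x' = cnj s * s * ip n x x"
      unfolding x'_def[abs_def] by (simp add: ip_def sum_distrib_left algebra_simps)
    also have "\<dots> = of_real (1 / sqrt (nrm2 n x) * (1 / sqrt (nrm2 n x)) * nrm2 n x)"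
      by (simp only: s_def ip_self complex_cnj_divide complex_cnj_complex_of_real complex_cnj_one of_real_mult of_real_divide of_real_1)
    also have "1 / sqrt (nrm2 n x) * (1 / sqrt (nrm2 n x)) * nrm2 n x = 1"
      using pos by (simp add: field_simps)
    finally show ?thesis by simp
  qed
  have xe: "ip n (e k) x' = 0" if "k < m" for k
    using x(1) that unfolding x'_def[abs_def] ip_scale_right by (simp add: W_def)
  have ex: "ip n x' (e k) = 0" if "k < m" for k
    using xe[OF that] ip_cnj[of n "e k" x'] by simp
  have mx: "mv n A x' i = \<alpha> * x' i" if "i < n" for i
  proof -
    have "mv n A x' i = s * mv n A x i"
      by (simp add: mv_def x'_def sum_distrib_left mult.left_commute)
    then show ?thesis using x(3) that by (simp add: x'_def)
  qed
  show ?case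
  proof (intro exI[of _ "e(m := x')"] exI[of _ "l(m := Re \<alpha>)"] conjI)
    show "orthonormal n (Suc m) (e(m := x'))"
      using e xx xe ex by (auto simp: orthonormal_def less_Suc_eq)
    show "\<forall>k<Suc m. \<forall>i<n. mv n A ((e(m := x')) k) i = complex_of_real ((l(m := Re \<alpha>)) k) * (e(m := x')) k i"
      using l mx \<alpha>[symmetric] by (auto simp: less_Suc_eq)
  qed
qed

text \<open>The \<open>n\<close> basis vectors together with \<open>x\<close> are linearly
  dependent. Pairing a relation with \<open>e k\<close> determines its coefficients; the one at
  \<open>x\<close> cannot vanish, since then all the others would.\<close>

lemma orthonormal_expansion:
  assumes e: "orthonormal n n e" and "i < n"
  shows "x i = (\<Sum>k<n. ip n (e k) x * e k i)"
proof -
  obtain c where c: "\<exists>j<Suc n. c j \<noteq> 0"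
     "\<forall>i<n. (\<Sum>j<Suc n. (if j < n then e j i else x i) * c j) = 0"
    using homogeneous_system_nontrivial[of n "Suc n" "\<lambda>i j. if j < n then e j i else x i"] by auto
  have c2: "(\<Sum>j<n. c j * e j i) + c n * x i = 0" if "i < n" for i
    using c(2) that by (simp add: mult.commute)
  have c3: "c k + c n * ip n (e k) x = 0" if "k < n" for k
  proof -
    have "ip n (e k) (\<lambda>i. (\<Sum>j<n. c j * e j i) + c n * x i) = 0"
      using c2 by (simp add: ip_def)
    moreover have "(\<Sum>j<n. c j * ip n (e k) (e j)) = (\<Sum>j<n. if j = k then c j else 0)"
      using e that by (intro sum.cong) (auto simp: orthonormal_def)
    ultimately show ?thesis using that by (simp add: ip_add_right ip_sum_right ip_scale_right)
  qed
  have "c n \<noteq> 0"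
  proof
    assume "c n = 0"
    then have "\<forall>k<Suc n. c k = 0" using c3 by (auto simp: less_Suc_eq)
    then show False using c(1) by auto
  qed
  moreover have "c n * x i = c n * (\<Sum>k<n. ip n (e k) x * e k i)"
  proof -
    have "c n * x i = - (\<Sum>k<n. c k * e k i)" using c2[OF assms(2)] by (simp add: add_eq_0_iff)
    also have "\<dots> = (\<Sum>k<n. (c n * ip n (e k) x) * e k i)"
      unfolding sum_negf[symmetric]
    proof (rule sum.cong[OF refl])
      fix k assume "k \<in> {..<n}"
      then have "c k = - (c n * ip n (e k) x)" using c3[of k] by (simp add: add_eq_0_iff2)
      then show "- (c k * e k i) = c n * ip n (e k) x * e k i" by simp
    qed
    finally show ?thesis by (simp add: sum_distrib_left mult.assoc)
  qed
  ultimately show ?thesis by simp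
qed

lemma parseval_ip:
  assumes e: "orthonormal n n e"
  shows "ip n x y = (\<Sum>k<n. cnj (ip n (e k) x) * ip n (e k) y)"
proof -
  have "ip n x y = ip n (\<lambda>i. \<Sum>k<n. ip n (e k) x * e k i) y"
    by (rule ip_cong) (auto simp: orthonormal_expansion[OF e, of _ x])
  then show ?thesis by (simp add: ip_sum_left)
qed

lemma parseval_nrm2:
  assumes e: "orthonormal n n e"
  shows "nrm2 n x = (\<Sum>k<n. (cmod (ip n (e k) x))\<^sup>2)"
proof -
  have "complex_of_real (nrm2 n x) = of_real (\<Sum>k<n. (cmod (ip n (e k) x))\<^sup>2)"
    unfolding ip_self[symmetric] parseval_ip[OF e, of x x] of_real_sum
    by (rule sum.cong) (auto simp: complex_norm_square mult.commute simp del: of_real_power)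
  then show ?thesis using of_real_eq_iff by blast
qed

text \<open>The form in which eigenvalues are used throughout: a sorted spectral decomposition. The
  values of \<open>l\<close> and \<open>e\<close> are constrained only below
  \<open>n\<close>.\<close>

definition spec :: "nat \<Rightarrow> (nat \<Rightarrow> nat \<Rightarrow> complex) \<Rightarrow> (nat \<Rightarrow> nat \<Rightarrow> complex) \<Rightarrow> (nat \<Rightarrow> real) \<Rightarrow> bool" where
  "spec n A e l \<longleftrightarrow> orthonormal n n e \<and>
     (\<forall>k<n. \<forall>i<n. mv n A (e k) i = complex_of_real (l k) * e k i) \<and>
     (\<forall>j k. j \<le> k \<and> k < n \<longrightarrow> l j \<le> l k)"

lemma spec_exists:
  assumes A: "hermitian_fun n A"
  shows "\<exists>e l. spec n A e l"
proof -
  obtain e l where e: "orthonormal n n e" and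
    l: "\<forall>k<n. \<forall>i<n. mv n A (e k) i = complex_of_real (l k) * e k i"
    using orthonormal_eigenvectors[OF A order_refl] by auto
  define p where "p = sort_key l [0..<n]"
  have p: "length p = n" "distinct p" "set p = {..<n}" by (auto simp: p_def)
  have srt: "sorted (map l p)" unfolding p_def by simp
  have pk: "p ! k < n" if "k < n" for k using p that nth_mem by fastforce
  have "spec n A (\<lambda>k. e (p ! k)) (\<lambda>k. l (p ! k))"
    unfolding spec_def
  proof (intro conjI allI impI)
    show "orthonormal n n (\<lambda>k. e (p ! k))"
      using e p pk by (auto simp: orthonormal_def nth_eq_iff_index_eq)
    show "mv n A (e (p ! k)) i = complex_of_real (l (p ! k)) * e (p ! k) i" if "k < n" "i < n" for k i
      using l pk that by auto
    show "l (p ! j) \<le> l (p ! k)" if "j \<le> k \<and> k < n" for j k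
      using srt that p(1) by (auto dest!: sorted_nth_mono)
  qed
  then show ?thesis by blast
qed

section \<open>Spectral decompositions and the roots of the characteristic polynomial\<close>

lemma sorted_roots_unique:
  fixes l l' :: "real list"
  assumes "(\<Prod>x\<leftarrow>l. [: - complex_of_real x, 1 :]) = (\<Prod>x\<leftarrow>l'. [: - complex_of_real x, 1 :])"
    and "sorted l" "sorted l'"
  shows "l = l'"
proof -
  have *: "proots (\<Prod>x\<leftarrow>l. [: - complex_of_real x, 1 :]) = image_mset complex_of_real (mset l)" for l
  proof (induction l)
    case (Cons a l)
    have "(\<Prod>x\<leftarrow>l. [: - complex_of_real x, 1 :]) \<noteq> 0"
      by (induction l) (auto simp del: mult_pCons_left)
    then show ?case using Cons by (simp add: proots_mult del: mult_pCons_left)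
  qed simp
  have "image_mset complex_of_real (mset l) = image_mset complex_of_real (mset l')"
    using *[of l] *[of l'] assms(1) by simp
  then have "image_mset Re (image_mset complex_of_real (mset l)) = image_mset Re (image_mset complex_of_real (mset l'))"
    by simp
  then have "mset l = mset l'" by (simp add: multiset.map_comp comp_def)
  then show ?thesis using assms(2,3) by (metis properties_for_sort)
qed

lemma eigs_eqI:
  assumes len: "length l = dim_row M" and srt: "sorted l"
    and cp: "char_poly M = (\<Prod>x\<leftarrow>l. [: - complex_of_real x, 1 :])"
  shows "eigs M = l"
proof -
  have "l' = l" if l': "length l' = dim_row M \<and> sorted l' \<and>
      char_poly M = (\<Prod>x\<leftarrow>l'. [: - complex_of_real x, 1 :])" for l'
    by (rule sorted_roots_unique[OF trans[OF sym[OF conjunct2[OF conjunct2[OF l']]] cp]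
            conjunct1[OF conjunct2[OF l']] srt])
  then show ?thesis
    unfolding eigs_def by (intro the_equality conjI len srt cp)
qed

text \<open>The matrix with columns \<open>e k\<close> is unitary and conjugates \<open>M\<close> to
  a diagonal matrix, so the characteristic polynomial splits with roots \<open>l k\<close>. A sorted
  list is determined by its roots with multiplicity, hence the description in \<open>eigs\<close>
  picks out exactly this list.\<close>

lemma spec_eigs:
  assumes M: "M \<in> carrier_mat n n" and s: "spec n (\<lambda>i j. M $$ (i,j)) e l"
  shows "eigs M = map l [0..<n]"
proof -
  have e: "orthonormal n n e" using s by (simp add: spec_def)
  define P where "P = Matrix.mat n n (\<lambda>(i,k). e k i)"
  define Q where "Q = Matrix.mat n n (\<lambda>(k,i). cnj (e k i))"
  define D where "D = Matrix.mat n n (\<lambda>(i,j). if i = j then complex_of_real (l i) else 0)"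
  have carr: "P \<in> carrier_mat n n" "Q \<in> carrier_mat n n" "D \<in> carrier_mat n n"
    by (auto simp: P_def Q_def D_def)
  have QP: "Q * P = 1\<^sub>m n"
    using e by (intro eq_matI) (auto simp: P_def Q_def scalar_prod_def orthonormal_def ip_def atLeast0LessThan)
  have PQ: "P * Q = 1\<^sub>m n" using mat_mult_left_right_inverse[OF carr(2,1) QP] .
  have MP: "M * P = P * D"
  proof (rule eq_matI)
    fix i k assume "i < dim_row (P * D)" "k < dim_col (P * D)"
    then have ik: "i < n" "k < n" using carr by auto
    have "(M * P) $$ (i,k) = mv n (\<lambda>i j. M $$ (i,j)) (e k) i"
      using M ik by (simp add: P_def scalar_prod_def mv_def atLeast0LessThan)
    also have "\<dots> = e k i * complex_of_real (l k)" using s ik by (simp add: spec_def mult.commute)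
    also have "\<dots> = (\<Sum>j<n. e j i * (if j = k then complex_of_real (l j) else 0))"
      using ik by (subst sum.remove[of _ k]) auto
    also have "\<dots> = (P * D) $$ (i,k)"
      using ik by (simp add: P_def D_def scalar_prod_def atLeast0LessThan)
    finally show "(M * P) $$ (i,k) = (P * D) $$ (i,k)" .
  qed (use M carr in auto)
  have "P * D * Q = M * P * Q" by (simp add: MP)
  also have "\<dots> = M * (P * Q)" using M carr by (simp add: assoc_mult_mat[of _ n n _ n _ n])
  also have "\<dots> = M" using M by (simp add: PQ)
  finally have "M = P * D * Q" by simp
  then have "similar_mat M D"
    unfolding similar_mat_def using similar_mat_witI[OF PQ QP _ M carr(3,1,2)] by blast
  then have "char_poly M = char_poly D" by (rule char_poly_similar)
  also have "\<dots> = (\<Prod>a\<leftarrow>diag_mat D. [:- a, 1:])"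
    by (rule char_poly_upper_triangular[OF carr(3)]) (auto simp: D_def)
  also have "diag_mat D = map (\<lambda>k. complex_of_real (l k)) [0..<n]"
    by (auto simp: D_def diag_mat_def)
  finally have cp: "char_poly M = (\<Prod>x\<leftarrow>map l [0..<n]. [: - complex_of_real x, 1 :])"
    by (simp add: comp_def)
  have srt: "sorted (map l [0..<n])"
    using s unfolding spec_def sorted_iff_nth_mono by simp
  show ?thesis using M by (intro eigs_eqI srt cp) simp
qed

lemma spec_eigs_exists:
  assumes "hermitian_mat n M"
  shows "\<exists>e. spec n (\<lambda>i j. M $$ (i,j)) e (\<lambda>k. eigs M ! k)"
proof -
  have "hermitian_fun n (\<lambda>i j. M $$ (i,j))" using assms unfolding hermitian_mat_def hermitian_fun_def by blast
  then obtain e l where s: "spec n (\<lambda>i j. M $$ (i,j)) e l" using spec_exists by blast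
  then have "eigs M = map l [0..<n]" using assms by (intro spec_eigs) (auto simp: hermitian_mat_def)
  then have "spec n (\<lambda>i j. M $$ (i,j)) e (\<lambda>k. eigs M ! k)"
    using s by (auto simp: spec_def)
  then show ?thesis by blast
qed

section \<open>Finite-rank perturbations\<close>

(* keeps the index set {1..r} of the statement syntactically intact *)
declare One_nat_def [simp del]

definition qf :: "nat \<Rightarrow> (nat \<Rightarrow> nat \<Rightarrow> complex) \<Rightarrow> (nat \<Rightarrow> complex) \<Rightarrow> real" where
  "qf n A w = Re (ip n w (mv n A w))"

lemma spec_ip_mv:
  assumes s: "spec n A e l" and "k < n"
  shows "ip n (e k) (mv n A w) = complex_of_real (l k) * ip n (e k) w"
proof -
  have e: "orthonormal n n e" using s by (simp add: spec_def)
  have "mv n A w = mv n A (\<lambda>i. \<Sum>j<n. ip n (e j) w * e j i)"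
    by (rule mv_cong) (rule orthonormal_expansion[OF e])
  then have "ip n (e k) (mv n A w) = (\<Sum>j<n. ip n (e j) w * ip n (e k) (mv n A (e j)))"
    by (simp add: mv_sum ip_sum_right)
  also have "\<dots> = (\<Sum>j<n. ip n (e j) w * (if j = k then complex_of_real (l k) else 0))"
  proof (intro sum.cong refl arg_cong2[where f = "(*)"])
    fix j assume "j \<in> {..<n}"
    then have "ip n (e k) (mv n A (e j)) = ip n (e k) (\<lambda>i. complex_of_real (l j) * e j i)"
      using s by (intro ip_cong) (auto simp: spec_def)
    then show "ip n (e k) (mv n A (e j)) = (if j = k then complex_of_real (l k) else 0)"
      using e assms(2) \<open>j \<in> {..<n}\<close> by (simp add: ip_scale_right orthonormal_def)
  qed
  also have "\<dots> = complex_of_real (l k) * ip n (e k) w"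
    using assms(2) by (subst sum.remove[of _ k]) auto
  finally show ?thesis .
qed

lemma spec_qf:
  assumes s: "spec n A e l"
  shows "qf n A w = (\<Sum>k<n. l k * (cmod (ip n (e k) w))\<^sup>2)"
proof -
  have e: "orthonormal n n e" using s by (simp add: spec_def)
  have "ip n w (mv n A w) = (\<Sum>k<n. cnj (ip n (e k) w) * ip n (e k) (mv n A w))"
    by (rule parseval_ip[OF e])
  also have "\<dots> = (\<Sum>k<n. complex_of_real (l k * (cmod (ip n (e k) w))\<^sup>2))"
  proof (intro sum.cong refl)
    fix k assume "k \<in> {..<n}"
    then show "cnj (ip n (e k) w) * ip n (e k) (mv n A w) = complex_of_real (l k * (cmod (ip n (e k) w))\<^sup>2)"
      unfolding of_real_mult complex_norm_square by (simp add: spec_ip_mv[OF s])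
  qed
  finally show ?thesis by (simp add: qf_def)
qed

text \<open>Negation reverses the order of the eigenvalues; with it, lower bounds on eigenvalues
  become upper bounds and the upper edge becomes the lower one.\<close>

lemma spec_uminus:
  assumes "spec n A e l"
  shows "spec n (\<lambda>i j. - A i j) (\<lambda>k. e (n - 1 - k)) (\<lambda>k. - l (n - 1 - k))"
  unfolding spec_def
proof (intro conjI allI impI)
  show "orthonormal n n (\<lambda>k. e (n - 1 - k))"
    using assms unfolding spec_def orthonormal_def by auto
  show "mv n (\<lambda>i j. - A i j) (e (n - 1 - k)) i = complex_of_real (- l (n - 1 - k)) * e (n - 1 - k) i"
    if "k < n" "i < n" for k i
    using assms that by (simp add: spec_def mv_def sum_negf)
  show "- l (n - 1 - j) \<le> - l (n - 1 - k)" if "j \<le> k \<and> k < n" for j k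
  proof -
    have "n - 1 - k \<le> n - 1 - j \<and> n - 1 - j < n" using that by auto
    then show ?thesis using assms by (simp add: spec_def)
  qed
qed

text \<open>The Courant--Fischer principle in the form of a test space: the span of \<open>g\<close> subject to the
  constraints \<open>f\<close> is intersected with the span of the eigenvectors up to \<open>idx\<close>.\<close>
lemma spec_ge:
  assumes s: "spec n A e l" and idx: "idx < n" and p: "m + (n - 1 - idx) < p"
    and test: "\<And>d. \<exists>j<p. d j \<noteq> 0 \<Longrightarrow> \<forall>q<m. ip n (f q) (\<lambda>i. \<Sum>j<p. d j * g j i) = 0 \<Longrightarrow>
      nrm2 n (\<lambda>i. \<Sum>j<p. d j * g j i) > 0 \<and>
      z * nrm2 n (\<lambda>i. \<Sum>j<p. d j * g j i) \<le> qf n A (\<lambda>i. \<Sum>j<p. d j * g j i)"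
  shows "z \<le> l idx"
proof -
  have e: "orthonormal n n e" using s by (simp add: spec_def)
  \<comment> \<open>The \<open>m\<close> constraints \<open>f\<close> and the
    \<open>n - 1 - idx\<close> eigenvectors above \<open>idx\<close> are together fewer than the
    \<open>p\<close> coefficients, so some nonzero combination of the \<open>g j\<close> satisfies
    all of them.\<close>
  define a where "a q j = (if q < m then ip n (f q) (g j) else ip n (e (Suc idx + (q - m))) (g j))" for q j
  obtain d where d: "\<exists>j<p. d j \<noteq> 0" "\<forall>q<m + (n - 1 - idx). (\<Sum>j<p. a q j * d j) = 0"
    using homogeneous_system_nontrivial[OF p, of a] by blast
  define w where "w = (\<lambda>i. \<Sum>j<p. d j * g j i)"
  have f0: "\<forall>q<m. ip n (f q) w = 0"
  proof (intro allI impI)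
    fix q assume "q < m"
    then have "(\<Sum>j<p. a q j * d j) = 0" using d(2) by simp
    then show "ip n (f q) w = 0" using \<open>q < m\<close> by (simp add: w_def ip_sum_right a_def mult.commute)
  qed
  have e0: "ip n (e k) w = 0" if "idx < k" "k < n" for k
  proof -
    have "(\<Sum>j<p. a (m + (k - Suc idx)) j * d j) = 0" using d(2) that by auto
    moreover have "a (m + (k - Suc idx)) j = ip n (e k) (g j)" for j
    proof -
      have "\<not> m + (k - Suc idx) < m" "Suc idx + (m + (k - Suc idx) - m) = k" using that by auto
      then show ?thesis unfolding a_def by metis
    qed
    ultimately show ?thesis by (simp add: w_def ip_sum_right mult.commute)
  qed
  have w: "nrm2 n w > 0" "z * nrm2 n w \<le> qf n A w"
    using test[OF d(1)] f0 unfolding w_def by auto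
  have "qf n A w \<le> (\<Sum>k<n. l idx * (cmod (ip n (e k) w))\<^sup>2)"
    unfolding spec_qf[OF s]
  proof (rule sum_mono)
    fix k assume k: "k \<in> {..<n}"
    show "l k * (cmod (ip n (e k) w))\<^sup>2 \<le> l idx * (cmod (ip n (e k) w))\<^sup>2"
    proof (cases "k \<le> idx")
      case True
      then have "l k \<le> l idx" using s idx by (simp add: spec_def)
      then show ?thesis by (rule mult_right_mono) simp
    next
      case False
      then show ?thesis using e0 k by simp
    qed
  qed
  also have "\<dots> = l idx * nrm2 n w" by (simp add: parseval_nrm2[OF e] sum_distrib_left)
  finally have "z * nrm2 n w \<le> l idx * nrm2 n w" using w by linarith
  then show ?thesis using w(1) by (simp add: mult_le_cancel_right)
qed

definition low_rank_pert ::
  "nat \<Rightarrow> (nat \<Rightarrow> real) \<Rightarrow> (nat \<Rightarrow> nat \<Rightarrow> complex) \<Rightarrow> (nat \<Rightarrow> nat \<Rightarrow> complex) \<Rightarrow> nat \<Rightarrow> nat \<Rightarrow> complex" where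
  "low_rank_pert r \<theta> u A i j = A i j + (\<Sum>k\<in>{1..r}. complex_of_real (\<theta> k) * u k i * cnj (u k j))"

lemma qf_low_rank_pert:
  "qf n (low_rank_pert r \<theta> u A) w = qf n A w + (\<Sum>k\<in>{1..r}. \<theta> k * (cmod (ip n (u k) w))\<^sup>2)"
proof -
  have "mv n (low_rank_pert r \<theta> u A) w i
      = mv n A w i + (\<Sum>k\<in>{1..r}. (complex_of_real (\<theta> k) * ip n (u k) w) * u k i)" for i
  proof -
    have "(\<Sum>j<n. (\<Sum>k\<in>{1..r}. complex_of_real (\<theta> k) * u k i * cnj (u k j)) * w j)
       = (\<Sum>k\<in>{1..r}. (complex_of_real (\<theta> k) * ip n (u k) w) * u k i)"
      unfolding sum_distrib_right ip_def sum_distrib_left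
      by (subst sum.swap) (simp add: sum_distrib_left mult_ac)
    then show ?thesis by (simp add: mv_def low_rank_pert_def distrib_right sum.distrib)
  qed
  then have "ip n w (mv n (low_rank_pert r \<theta> u A) w) =
     ip n w (mv n A w) + (\<Sum>k\<in>{1..r}. complex_of_real (\<theta> k) * ip n (u k) w * ip n w (u k))"
    by (simp add: ip_add_right ip_sum_right cong: ip_cong)
  also have "(\<Sum>k\<in>{1..r}. complex_of_real (\<theta> k) * ip n (u k) w * ip n w (u k)) =
      (\<Sum>k\<in>{1..r}. complex_of_real (\<theta> k * (cmod (ip n (u k) w))\<^sup>2))"
    unfolding of_real_mult complex_norm_square ip_cnj by (simp add: mult.assoc)
  finally show ?thesis by (simp add: qf_def)
qed

text \<open>\<open>sf n e h\<close> is the sesquilinear form of the matrix with eigenvectors \<open>e\<close> and eigenvalues \<open>h\<close>.\<close>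
definition sf :: "nat \<Rightarrow> (nat \<Rightarrow> nat \<Rightarrow> complex) \<Rightarrow> (nat \<Rightarrow> real) \<Rightarrow> (nat \<Rightarrow> complex) \<Rightarrow> (nat \<Rightarrow> complex) \<Rightarrow> complex" where
  "sf n e h x y = (\<Sum>k<n. complex_of_real (h k) * cnj (ip n (e k) x) * ip n (e k) y)"

lemma sf_sum_right: "sf n e h x (\<lambda>i. \<Sum>k\<in>K. c k * y k i) = (\<Sum>k\<in>K. c k * sf n e h x (y k))"
  unfolding sf_def ip_sum_right sum_distrib_left by (subst sum.swap) (simp add: mult_ac)

lemma sf_sum_left: "sf n e h (\<lambda>i. \<Sum>k\<in>K. c k * y k i) x = (\<Sum>k\<in>K. cnj (c k) * sf n e h (y k) x)"
  unfolding sf_def ip_sum_right cnj_sum sum_distrib_left sum_distrib_right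
  by (subst sum.swap) (simp add: mult_ac)

lemma sf_self: "sf n e h x x = complex_of_real (\<Sum>k<n. h k * (cmod (ip n (e k) x))\<^sup>2)"
  unfolding sf_def of_real_sum of_real_mult complex_norm_square by (simp add: mult_ac)

lemma sum_norm_squared_le:
  fixes r :: nat
  shows "(\<Sum>k\<in>{1..r}. cmod (c k))\<^sup>2 \<le> r * (\<Sum>k\<in>{1..r}. (cmod (c k))\<^sup>2)"
  using sum_squared_le_sum_of_squares[of "\<lambda>k. cmod (c k)" "{1..r}"] by (simp add: mult.commute)

text \<open>Entrywise closeness to \<open>g\<close> times the identity. It is weaker than closeness
  in operator norm only by a factor \<open>r\<close>, as \<open>near_scalar_form\<close> shows, and
  it is what concentration of single forms delivers.\<close>

definition near_scalar :: "nat \<Rightarrow> (nat \<Rightarrow> nat \<Rightarrow> complex) \<Rightarrow> real \<Rightarrow> real \<Rightarrow> bool" where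
  "near_scalar r M g \<epsilon> \<longleftrightarrow>
     (\<forall>j\<in>{1..r}. \<forall>k\<in>{1..r}. cmod (M j k - (if j = k then of_real g else 0)) \<le> \<epsilon>)"

lemma near_scalar_reverse:
  assumes "near_scalar r M g \<epsilon>"
  shows "near_scalar r (\<lambda>j k. M (r + 1 - j) (r + 1 - k)) g \<epsilon>"
  unfolding near_scalar_def
proof (intro ballI)
  fix j k assume "j \<in> {1..r}" "k \<in> {1..r}"
  then have jk: "r + 1 - j \<in> {1..r}" "r + 1 - k \<in> {1..r}" "(r + 1 - j = r + 1 - k) = (j = k)" by auto
  then have "cmod (M (r + 1 - j) (r + 1 - k) - (if r + 1 - j = r + 1 - k then of_real g else 0)) \<le> \<epsilon>"
    using assms unfolding near_scalar_def by blast
  then show "cmod (M (r + 1 - j) (r + 1 - k) - (if j = k then of_real g else 0)) \<le> \<epsilon>"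
    unfolding jk(3) .
qed

lemma near_scalar_mv:
  assumes M: "near_scalar r M g \<epsilon>"
    and j: "j \<in> {1..r}"
  shows "cmod ((\<Sum>k\<in>{1..r}. c k * M j k) - complex_of_real g * c j) \<le> \<epsilon> * (\<Sum>k\<in>{1..r}. cmod (c k))"
proof -
  have "complex_of_real g * c j = (\<Sum>k\<in>{1..r}. c k * (if j = k then complex_of_real g else 0))"
    using j by (subst sum.remove[of _ j]) auto
  then have "(\<Sum>k\<in>{1..r}. c k * M j k) - complex_of_real g * c j
      = (\<Sum>k\<in>{1..r}. c k * (M j k - (if j = k then complex_of_real g else 0)))"
    by (simp add: right_diff_distrib sum_subtractf)
  also have "cmod \<dots> \<le> (\<Sum>k\<in>{1..r}. cmod (c k) * \<epsilon>)"
    using M j unfolding near_scalar_def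
    by (intro sum_norm_le) (simp only: norm_mult mult_left_mono norm_ge_zero)
  finally show ?thesis by (simp add: sum_distrib_left mult.commute)
qed

lemma near_scalar_form:
  assumes M: "near_scalar r M g \<epsilon>"
    and \<epsilon>: "0 \<le> \<epsilon>"
  shows "cmod ((\<Sum>j\<in>{1..r}. cnj (c j) * (\<Sum>k\<in>{1..r}. c k * M j k)) - complex_of_real (g * (\<Sum>k\<in>{1..r}. (cmod (c k))\<^sup>2)))
    \<le> r * \<epsilon> * (\<Sum>k\<in>{1..r}. (cmod (c k))\<^sup>2)"
proof -
  let ?S = "\<Sum>k\<in>{1..r}. cmod (c k)"
  have "complex_of_real (g * (\<Sum>k\<in>{1..r}. (cmod (c k))\<^sup>2)) = (\<Sum>j\<in>{1..r}. cnj (c j) * (complex_of_real g * c j))"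
    unfolding of_real_mult of_real_sum complex_norm_square sum_distrib_left by (simp add: mult_ac)
  then have "(\<Sum>j\<in>{1..r}. cnj (c j) * (\<Sum>k\<in>{1..r}. c k * M j k)) - complex_of_real (g * (\<Sum>k\<in>{1..r}. (cmod (c k))\<^sup>2))
     = (\<Sum>j\<in>{1..r}. cnj (c j) * ((\<Sum>k\<in>{1..r}. c k * M j k) - complex_of_real g * c j))"
    by (simp add: right_diff_distrib sum_subtractf)
  also have "cmod \<dots> \<le> (\<Sum>j\<in>{1..r}. cmod (c j) * (\<epsilon> * ?S))"
    by (rule sum_norm_le) (simp only: norm_mult complex_mod_cnj mult_left_mono norm_ge_zero near_scalar_mv[where M = M, OF M])
  also have "\<dots> = \<epsilon> * ?S\<^sup>2" by (simp add: sum_distrib_right[symmetric] power2_eq_square)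
  also have "\<dots> \<le> \<epsilon> * (r * (\<Sum>k\<in>{1..r}. (cmod (c k))\<^sup>2))"
    by (intro mult_left_mono sum_norm_squared_le \<epsilon>)
  finally show ?thesis by (simp add: mult_ac)
qed

text \<open>On the orthogonal complement of the last \<open>i\<close> vectors \<open>u k\<close>, the Cauchy--Schwarz inequality for
  the form \<open>z - A\<close> and its inverse absorbs the other rank-one terms.\<close>
lemma low_rank_eig_upper:
  fixes r :: nat and g \<epsilon> t :: real
  assumes s: "spec n A e l" and s': "spec n (low_rank_pert r \<theta> u A) e' l'"
    and lz: "\<And>k. k < n \<Longrightarrow> l k < z" and i: "i < n" and t: "0 < t"
    and \<theta>: "\<And>k. 1 \<le> k \<Longrightarrow> k + i \<le> r \<Longrightarrow> \<theta> k \<le> t"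
    and M: "near_scalar r (\<lambda>j k. sf n e (\<lambda>k. 1 / (z - l k)) (u j) (u k)) g \<epsilon>"
    and \<epsilon>: "0 \<le> \<epsilon>" and tg: "t * (g + r * \<epsilon>) \<le> 1"
  shows "l' (n - i - 1) \<le> z"
proof -
  let ?B = "low_rank_pert r \<theta> u A"
  have e: "orthonormal n n e" using s by (simp add: spec_def)
  \<comment> \<open>\<open>spec_ge\<close> gives lower bounds only, so it is applied to the negated
    matrix, whose eigenvalue of index \<open>i\<close> is \<open>- l' (n - 1 - i)\<close>. The test
    space is the whole space, subject to orthogonality to the \<open>min i r\<close> vectors u_r,
    u_(r-1), ...\<close>
  have "- z \<le> - l' (n - 1 - i)"
  proof (rule spec_ge[OF spec_uminus[OF s'] i, where m = "min i r" and f = "\<lambda>q. u (r - q)"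
        and p = n and g = "\<lambda>j i. if i = j then 1 else 0"])
    show "min i r + (n - 1 - i) < n" using i by linarith
    fix d :: "nat \<Rightarrow> complex"
    let ?w = "\<lambda>i. \<Sum>j<n. d j * (if i = j then 1 else 0)"
    assume d: "\<exists>j<n. d j \<noteq> 0" and u0: "\<forall>q<min i r. ip n (u (r - q)) ?w = 0"
    define w where "w = ?w"
    have "w j = d j" if "j < n" for j
    proof -
      have "w j = (\<Sum>k<n. if k = j then d k else 0)" unfolding w_def by (intro sum.cong) auto
      then show ?thesis using that by simp
    qed
    then have pos: "nrm2 n w > 0" using d by (auto simp: nrm2_pos_iff)
    define c where "c k = ip n (u k) w" for k
    have c0: "c k = 0" if "k \<in> {1..r}" "\<not> k + i \<le> r" for k
    proof -
      have "r - k < min i r" "r - (r - k) = k" using that by auto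
      then show ?thesis using u0[rule_format, of "r - k"] unfolding c_def w_def by simp
    qed
    define S where "S = (\<Sum>k\<in>{1..r}. (cmod (c k))\<^sup>2)"
    define D where "D = (\<Sum>k<n. (z - l k) * (cmod (ip n (e k) w))\<^sup>2)"
    have S0: "0 \<le> S" by (simp add: S_def sum_nonneg)
    have D0: "0 \<le> D" unfolding D_def using lz by (intro sum_nonneg mult_nonneg_nonneg) (auto simp: less_imp_le)
    \<comment> \<open>The projection-like vector U U^* w, chosen so that its inner product with
      \<open>w\<close> is \<open>S\<close>. Cauchy--Schwarz with the weights \<open>z - l k\<close>
      then bounds S^2 by the resolvent form at \<open>x\<close>, which is at most (g + r \<epsilon>)
      S, times \<open>D\<close>.\<close>
    define x where "x = (\<lambda>i. \<Sum>k\<in>{1..r}. c k * u k i)"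
    have "ip n x w = complex_of_real S"
      unfolding x_def ip_sum_left S_def of_real_sum complex_norm_square by (simp add: c_def mult.commute)
    then have "S = cmod (\<Sum>k<n. cnj (ip n (e k) x) * ip n (e k) w)"
      using S0 by (simp add: parseval_ip[OF e, of x w, symmetric])
    also have "\<dots> \<le> (\<Sum>k<n. (cmod (ip n (e k) x) / sqrt (z - l k)) * (sqrt (z - l k) * cmod (ip n (e k) w)))"
    proof (rule sum_norm_le)
      fix k assume "k \<in> {..<n}"
      then have "sqrt (z - l k) > 0" using lz by simp
      then show "cmod (cnj (ip n (e k) x) * ip n (e k) w) \<le> (cmod (ip n (e k) x) / sqrt (z - l k)) * (sqrt (z - l k) * cmod (ip n (e k) w))"
        by (simp add: norm_mult)
    qed
    finally have "S\<^sup>2 \<le> (\<Sum>k<n. (cmod (ip n (e k) x) / sqrt (z - l k)) * (sqrt (z - l k) * cmod (ip n (e k) w)))\<^sup>2"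
      using S0 by (rule power_mono)
    also have "\<dots> \<le> (\<Sum>k<n. (cmod (ip n (e k) x) / sqrt (z - l k))\<^sup>2) * (\<Sum>k<n. (sqrt (z - l k) * cmod (ip n (e k) w))\<^sup>2)"
      by (rule Cauchy_Schwarz_ineq_sum)
    also have "(\<Sum>k<n. (sqrt (z - l k) * cmod (ip n (e k) w))\<^sup>2) = D"
      unfolding D_def using lz by (intro sum.cong) (auto simp: power_mult_distrib less_imp_le)
    also have "(\<Sum>k<n. (cmod (ip n (e k) x) / sqrt (z - l k))\<^sup>2) = Re (sf n e (\<lambda>k. 1 / (z - l k)) x x)"
      unfolding sf_self Re_complex_of_real using lz
      by (intro sum.cong) (auto simp: power_divide less_imp_le)
    also have "\<dots> \<le> (g + r * \<epsilon>) * S"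
    proof -
      have "sf n e (\<lambda>k. 1 / (z - l k)) x x
         = (\<Sum>j\<in>{1..r}. cnj (c j) * (\<Sum>k\<in>{1..r}. c k * sf n e (\<lambda>k. 1 / (z - l k)) (u j) (u k)))"
        unfolding x_def by (simp add: sf_sum_left sf_sum_right)
      then have "cmod (sf n e (\<lambda>k. 1 / (z - l k)) x x - complex_of_real (g * S)) \<le> r * \<epsilon> * S"
        using near_scalar_form[where c = c, OF M \<epsilon>] by (simp add: S_def)
      then have "Re (sf n e (\<lambda>k. 1 / (z - l k)) x x - complex_of_real (g * S)) \<le> r * \<epsilon> * S"
        using complex_Re_le_cmod order_trans by blast
      then show ?thesis by (simp add: distrib_right)
    qed
    finally have S2: "S\<^sup>2 \<le> (g + r * \<epsilon>) * S * D" using D0 by (simp add: mult_right_mono)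
    have tS: "t * S \<le> D"
    proof (cases "S = 0")
      case True
      then show ?thesis using D0 by simp
    next
      case False
      then have S1: "S > 0" using S0 by simp
      have "S * S \<le> S * ((g + r * \<epsilon>) * D)" using S2 by (simp add: power2_eq_square mult_ac)
      then have "S \<le> (g + r * \<epsilon>) * D" using S1 by simp
      then have "t * S \<le> t * ((g + r * \<epsilon>) * D)" using t by simp
      also have "\<dots> = (t * (g + r * \<epsilon>)) * D" by simp
      also have "\<dots> \<le> 1 * D" by (rule mult_right_mono[OF tg D0])
      finally show ?thesis by simp
    qed
    have "(\<Sum>k\<in>{1..r}. \<theta> k * (cmod (c k))\<^sup>2) \<le> (\<Sum>k\<in>{1..r}. t * (cmod (c k))\<^sup>2)"
    proof (rule sum_mono)
      fix k assume "k \<in> {1..r}"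
      then show "\<theta> k * (cmod (c k))\<^sup>2 \<le> t * (cmod (c k))\<^sup>2"
        using \<theta> c0 by (cases "k + i \<le> r") (auto intro!: mult_right_mono)
    qed
    also have "\<dots> = t * S" by (simp add: S_def sum_distrib_left)
    also have "\<dots> \<le> D" by (rule tS)
    also have "D = z * nrm2 n w - qf n A w"
      unfolding D_def spec_qf[OF s] parseval_nrm2[OF e]
      by (simp add: left_diff_distrib sum_subtractf sum_distrib_left)
    finally have "qf n ?B w \<le> z * nrm2 n w" by (simp add: qf_low_rank_pert c_def)
    moreover have "qf n (\<lambda>i j. - ?B i j) w = - qf n ?B w"
      by (simp add: qf_def ip_def mv_def sum_negf)
    ultimately show "nrm2 n ?w > 0 \<and> - z * nrm2 n ?w \<le> qf n (\<lambda>i j. - ?B i j) ?w"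
      using pos unfolding w_def by simp
  qed
  then show ?thesis by (simp add: add.commute)
qed

text \<open>The test space is spanned by the images under the resolvent of the last \<open>i + 1\<close> vectors \<open>u k\<close>.\<close>
lemma low_rank_eig_lower:
  fixes r :: nat and g \<epsilon> \<tau> \<Theta> :: real
  assumes s: "spec n A e l" and s': "spec n (low_rank_pert r \<theta> u A) e' l'"
    and lz: "\<And>k. k < n \<Longrightarrow> l k < z" and i: "i < n" "i < r" and \<tau>: "0 \<le> \<tau>"
    and \<theta>: "\<And>k. r - i \<le> k \<Longrightarrow> k \<le> r \<Longrightarrow> \<tau> \<le> \<theta> k"
    and \<Theta>: "\<And>k. k \<in> {1..r} \<Longrightarrow> \<bar>\<theta> k\<bar> \<le> \<Theta>"
    and M: "near_scalar r (\<lambda>j k. sf n e (\<lambda>k. 1 / (z - l k)) (u j) (u k)) g \<epsilon>"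
    and \<epsilon>: "0 \<le> \<epsilon>" "r * \<epsilon> < g"
    and \<tau>g: "g + r * \<epsilon> + 2 * \<tau> * g * \<epsilon> * r + \<Theta> * \<epsilon>\<^sup>2 * r\<^sup>2 \<le> \<tau> * g\<^sup>2"
  shows "z \<le> l' (n - i - 1)"
proof -
  let ?B = "low_rank_pert r \<theta> u A"
  let ?h = "\<lambda>k. 1 / (z - l k)"
  have e: "orthonormal n n e" using s by (simp add: spec_def)
  have "0 \<le> r * \<epsilon>" using \<epsilon>(1) by simp
  then have g0: "0 \<le> g" using \<epsilon>(2) by linarith
  have \<Theta>0: "0 \<le> \<Theta>" using \<Theta>[of r] i by force
  \<comment> \<open>The resolvent of \<open>A\<close> at \<open>z\<close>, written in the
    eigenbasis.\<close>
  define R where "R x = (\<lambda>i. \<Sum>k<n. (complex_of_real (?h k) * ip n (e k) x) * e k i)" for x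
  have eR: "ip n (e k) (R x) = complex_of_real (?h k) * ip n (e k) x" if "k < n" for k x
  proof -
    have "ip n (e k) (R x) = (\<Sum>j<n. (complex_of_real (?h j) * ip n (e j) x) * (if j = k then 1 else 0))"
      unfolding R_def ip_sum_right using e that by (intro sum.cong) (auto simp: orthonormal_def)
    then show ?thesis using that by (subst (asm) sum.remove[of _ k]) auto
  qed
  have yR: "ip n y (R x) = sf n e ?h y x" for x y
    unfolding parseval_ip[OF e, of y "R x"] sf_def by (intro sum.cong) (auto simp: eR)
  have "z \<le> l' (n - 1 - i)"
  proof (rule spec_ge[OF s', where m = 0 and p = "Suc i" and g = "\<lambda>j. R (u (r - j))"])
    show "n - 1 - i < n" using i by simp
    show "0 + (n - 1 - (n - 1 - i)) < Suc i" by simp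
    fix d :: "nat \<Rightarrow> complex"
    let ?w = "\<lambda>a. \<Sum>j<Suc i. d j * R (u (r - j)) a"
    assume d: "\<exists>j<Suc i. d j \<noteq> 0"
    define w where "w = ?w"
    \<comment> \<open>The coefficients of the test vector renumbered by the spike they belong to and
      extended by 0, so that all sums run over the full index set of
      \<open>near_scalar\<close>.\<close>
    define D where "D k = (if r - i \<le> k then d (r - k) else 0)" for k
    have w: "w = (\<lambda>a. \<Sum>k\<in>{1..r}. D k * R (u k) a)"
    proof
      fix a
      have "(\<Sum>k\<in>{1..r}. D k * R (u k) a) = (\<Sum>k\<in>{r-i..r}. D k * R (u k) a)"
        using i by (intro sum.mono_neutral_right) (auto simp: D_def)
      also have "\<dots> = (\<Sum>j<Suc i. D (r - j) * R (u (r - j)) a)"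
        using i by (intro sum.reindex_bij_witness[of _ "\<lambda>j. r - j" "\<lambda>j. r - j"]) auto
      also have "\<dots> = w a" unfolding w_def using i by (intro sum.cong) (auto simp: D_def)
      finally show "w a = (\<Sum>k\<in>{1..r}. D k * R (u k) a)" by simp
    qed
    define N where "N = (\<Sum>k\<in>{1..r}. (cmod (D k))\<^sup>2)"
    have Npos: "N > 0"
    proof -
      obtain j where "j < Suc i" "d j \<noteq> 0" using d by auto
      then have "r - j \<in> {1..r}" "D (r - j) \<noteq> 0" using i by (auto simp: D_def)
      then show ?thesis unfolding N_def by (intro sum_pos2[of _ "r - j"]) auto
    qed
    define Mm where "Mm m = (\<Sum>k\<in>{1..r}. D k * sf n e ?h (u m) (u k))" for m
    have uw: "ip n (u m) w = Mm m" for m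
      unfolding w ip_sum_right Mm_def yR ..
    define x where "x = (\<lambda>i. \<Sum>k\<in>{1..r}. D k * u k i)"
    have form: "cmod ((\<Sum>m\<in>{1..r}. cnj (D m) * Mm m) - complex_of_real (g * N)) \<le> r * \<epsilon> * N"
      unfolding Mm_def N_def by (rule near_scalar_form[OF M \<epsilon>(1)])
    have xx: "sf n e ?h x x = (\<Sum>m\<in>{1..r}. cnj (D m) * Mm m)"
      unfolding x_def Mm_def by (simp add: sf_sum_left sf_sum_right)
    have wx: "ip n (e k) w = complex_of_real (?h k) * ip n (e k) x" if "k < n" for k
      unfolding w x_def ip_sum_right sum_distrib_left using that by (simp add: eR mult_ac)
    have pos: "nrm2 n w > 0"
    proof (rule ccontr)
      assume "\<not> ?thesis"
      then have "\<forall>i<n. w i = 0" by (auto simp: nrm2_pos_iff)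
      then have "Mm m = 0" for m unfolding uw[symmetric] by (simp add: ip_def)
      then have "cmod (complex_of_real (g * N)) \<le> r * \<epsilon> * N" using form by simp
      then have "\<bar>g * N\<bar> \<le> r * \<epsilon> * N" unfolding norm_of_real .
      then have "g * N \<le> r * \<epsilon> * N" by linarith
      then show False using Npos \<epsilon> by simp
    qed
    have "z * nrm2 n w - qf n A w = (\<Sum>k<n. (z - l k) * (cmod (ip n (e k) w))\<^sup>2)"
      unfolding spec_qf[OF s] parseval_nrm2[OF e]
      by (simp add: left_diff_distrib sum_subtractf sum_distrib_left)
    also have "\<dots> = (\<Sum>k<n. ?h k * (cmod (ip n (e k) x))\<^sup>2)"
    proof (rule sum.cong)
      fix k assume k: "k \<in> {..<n}"
      then have "z - l k > 0" using lz by simp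
      then have "(z - l k) * (?h k)\<^sup>2 = ?h k" by (simp add: power2_eq_square)
      moreover have "(cmod (ip n (e k) w))\<^sup>2 = (?h k)\<^sup>2 * (cmod (ip n (e k) x))\<^sup>2"
        using k by (simp only: wx lessThan_iff norm_mult power_mult_distrib norm_of_real power2_abs)
      ultimately show "(z - l k) * (cmod (ip n (e k) w))\<^sup>2 = ?h k * (cmod (ip n (e k) x))\<^sup>2"
        by (metis mult.assoc)
    qed simp
    also have "\<dots> = Re (sf n e ?h x x)" by (simp add: sf_self)
    also have "\<dots> \<le> (g + r * \<epsilon>) * N"
    proof -
      have "Re (sf n e ?h x x - complex_of_real (g * N)) \<le> r * \<epsilon> * N"
        using form complex_Re_le_cmod order_trans unfolding xx by blast
      then show ?thesis by (simp add: distrib_right)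
    qed
    finally have qA: "z * nrm2 n w - qf n A w \<le> (g + r * \<epsilon>) * N" .
    define SD where "SD = (\<Sum>k\<in>{1..r}. cmod (D k))"
    have SD: "SD\<^sup>2 \<le> r * N" unfolding SD_def N_def by (rule sum_norm_squared_le)
    have SD0: "0 \<le> SD" by (simp add: SD_def sum_nonneg)
    \<comment> \<open>\<open>Mm m\<close> equals g times \<open>D m\<close> up to an error
      \<epsilon> \<open>SD\<close>. For a top spike this error costs the middle term; for the other
      spikes \<open>D m\<close> is 0, so only the error remains and is paid for with \<Theta>.
      Summed over \<open>m\<close>, the top spikes contribute \<tau> g^2 \<open>N\<close>, which has
      to beat the form of \<open>z - A\<close>, at most (g + r \<epsilon>) \<open>N\<close>.\<close>
    have tm: "\<tau> * g\<^sup>2 * (cmod (D m))\<^sup>2 - 2 * \<tau> * g * \<epsilon> * SD * cmod (D m) - \<Theta> * \<epsilon>\<^sup>2 * (r * N)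
        \<le> \<theta> m * (cmod (Mm m))\<^sup>2" if m: "m \<in> {1..r}" for m
    proof -
      have E: "cmod (Mm m - complex_of_real g * D m) \<le> \<epsilon> * SD"
        unfolding Mm_def SD_def by (rule near_scalar_mv[OF M m])
      have last: "0 \<le> \<Theta> * \<epsilon>\<^sup>2 * (r * N)" using \<Theta>0 Npos by simp
      show ?thesis
      proof (cases "r - i \<le> m")
        case True
        have "g * cmod (D m) - \<epsilon> * SD \<le> cmod (Mm m)"
          using norm_triangle_ineq2[of "complex_of_real g * D m" "complex_of_real g * D m - Mm m"] E g0
          by (simp add: norm_mult norm_minus_commute)
        \<comment> \<open>A lower bound a - b for \<open>Mm m\<close> may be squared if it is
          nonnegative; if a \<le> b, then a^2 - 2 a b is nonpositive anyway.\<close>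
        then have "(g * cmod (D m))\<^sup>2 - 2 * (g * cmod (D m)) * (\<epsilon> * SD) \<le> (cmod (Mm m))\<^sup>2"
        proof (cases "g * cmod (D m) \<le> \<epsilon> * SD")
          case True
          have "0 \<le> g * cmod (D m)" using g0 by simp
          then have "(g * cmod (D m)) * (g * cmod (D m)) \<le> (g * cmod (D m)) * (2 * (\<epsilon> * SD))"
            using True by (intro mult_left_mono) linarith+
          then have "(g * cmod (D m))\<^sup>2 - 2 * (g * cmod (D m)) * (\<epsilon> * SD) \<le> 0"
            by (simp add: power2_eq_square mult_ac)
          then show ?thesis using zero_le_power2[of "cmod (Mm m)"] by linarith
        next
          case False
          assume "g * cmod (D m) - \<epsilon> * SD \<le> cmod (Mm m)"
          then have "(g * cmod (D m) - \<epsilon> * SD)\<^sup>2 \<le> (cmod (Mm m))\<^sup>2" using False by (intro power_mono) auto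
          moreover have "(g * cmod (D m) - \<epsilon> * SD)\<^sup>2 = (g * cmod (D m))\<^sup>2 - 2 * (g * cmod (D m)) * (\<epsilon> * SD) + (\<epsilon> * SD)\<^sup>2"
            by (simp add: power2_diff)
          ultimately show ?thesis by (smt (verit) zero_le_power2)
        qed
        then have "\<tau> * ((g * cmod (D m))\<^sup>2 - 2 * (g * cmod (D m)) * (\<epsilon> * SD)) \<le> \<tau> * (cmod (Mm m))\<^sup>2"
          using \<tau> by (rule mult_left_mono)
        also have "\<dots> \<le> \<theta> m * (cmod (Mm m))\<^sup>2"
          using \<theta>[OF True] m by (intro mult_right_mono) auto
        finally show ?thesis using last by (simp add: power_mult_distrib algebra_simps)
      next
        case False
        then have D0: "D m = 0" by (simp add: D_def)
        then have "(cmod (Mm m))\<^sup>2 \<le> (\<epsilon> * SD)\<^sup>2" using E by (intro power_mono) auto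
        also have "\<dots> \<le> \<epsilon>\<^sup>2 * (r * N)" unfolding power_mult_distrib by (intro mult_left_mono SD) simp
        finally have "\<Theta> * (cmod (Mm m))\<^sup>2 \<le> \<Theta> * (\<epsilon>\<^sup>2 * (r * N))" using \<Theta>0 by (rule mult_left_mono)
        moreover have "- \<Theta> * (cmod (Mm m))\<^sup>2 \<le> \<theta> m * (cmod (Mm m))\<^sup>2"
          using \<Theta>[OF m] by (intro mult_right_mono) auto
        ultimately show ?thesis using D0 by simp
      qed
    qed
    have "(\<tau> * g\<^sup>2 - 2 * \<tau> * g * \<epsilon> * r - \<Theta> * \<epsilon>\<^sup>2 * r\<^sup>2) * N
       \<le> \<tau> * g\<^sup>2 * N - 2 * \<tau> * g * \<epsilon> * SD\<^sup>2 - r * (\<Theta> * \<epsilon>\<^sup>2 * (r * N))"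
    proof -
      have "(2 * \<tau> * g * \<epsilon>) * SD\<^sup>2 \<le> (2 * \<tau> * g * \<epsilon>) * (r * N)"
        using \<tau> g0 \<epsilon> by (intro mult_left_mono SD) auto
      then show ?thesis by (simp add: algebra_simps power2_eq_square)
    qed
    also have "\<dots> = (\<Sum>m\<in>{1..r}. \<tau> * g\<^sup>2 * (cmod (D m))\<^sup>2 - 2 * \<tau> * g * \<epsilon> * SD * cmod (D m) - \<Theta> * \<epsilon>\<^sup>2 * (r * N))"
      by (simp add: sum_subtractf sum_distrib_left[symmetric] N_def[symmetric] SD_def[symmetric] power2_eq_square[of SD] mult.assoc)
    also have "\<dots> \<le> (\<Sum>m\<in>{1..r}. \<theta> m * (cmod (Mm m))\<^sup>2)" by (rule sum_mono) (rule tm)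
    also have "\<dots> = qf n ?B w - qf n A w" by (simp add: qf_low_rank_pert uw)
    finally have "(\<tau> * g\<^sup>2 - 2 * \<tau> * g * \<epsilon> * r - \<Theta> * \<epsilon>\<^sup>2 * r\<^sup>2) * N \<le> qf n ?B w - qf n A w" .
    moreover have "(g + r * \<epsilon>) * N \<le> (\<tau> * g\<^sup>2 - 2 * \<tau> * g * \<epsilon> * r - \<Theta> * \<epsilon>\<^sup>2 * r\<^sup>2) * N"
      using \<tau>g Npos by (intro mult_right_mono) auto
    ultimately show "nrm2 n ?w > 0 \<and> z * nrm2 n ?w \<le> qf n ?B ?w"
      using qA pos unfolding w_def by linarith
  qed
  then show ?thesis by (simp add: add.commute)
qed

text \<open>One half of Weyl's interlacing. The top \<open>i + r + 1\<close> eigenvectors of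
  \<open>A\<close> span a space on which the form of \<open>A\<close> is at least \<open>z\<close>;
  orthogonality to the \<open>r\<close> perturbing vectors cuts it down to dimension at least
  \<open>i + 1\<close>, and there the perturbation vanishes, whatever the signs of \<theta>.\<close>

lemma low_rank_interlacing:
  assumes s: "spec n A e l" and s': "spec n (low_rank_pert r \<theta> u A) e' l'"
    and i: "i + r < n" and z: "z \<le> l (n - 1 - i - r)"
  shows "z \<le> l' (n - i - 1)"
proof -
  have e: "orthonormal n n e" using s by (simp add: spec_def)
  have "z \<le> l' (n - 1 - i)"
  proof (rule spec_ge[OF s', where m = r and f = "\<lambda>q. u (Suc q)" and p = "Suc (i + r)" and g = "\<lambda>j. e (n - 1 - j)"])
    show "n - 1 - i < n" "r + (n - 1 - (n - 1 - i)) < Suc (i + r)" using i by auto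
    fix d :: "nat \<Rightarrow> complex"
    let ?w = "\<lambda>a. \<Sum>j<Suc (i + r). d j * e (n - 1 - j) a"
    assume d: "\<exists>j<Suc (i + r). d j \<noteq> 0" and u0: "\<forall>q<r. ip n (u (Suc q)) ?w = 0"
    define w where "w = ?w"
    have ew: "ip n (e k) w = (if n - 1 - i - r \<le> k then d (n - 1 - k) else 0)" if "k < n" for k
    proof -
      have "ip n (e k) w = (\<Sum>j<Suc (i + r). d j * (if j = n - 1 - k then 1 else 0))"
        unfolding w_def ip_sum_right using e that i
        by (intro sum.cong arg_cong2[where f = "(*)"]) (auto simp: orthonormal_def)
      also have "\<dots> = (\<Sum>j<Suc (i + r). if j = n - 1 - k then d j else 0)"
        by (intro sum.cong) auto
      also have "\<dots> = (if n - 1 - k \<in> {..<Suc (i + r)} then d (n - 1 - k) else 0)"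
        by (rule sum.delta) simp
      also have "\<dots> = (if n - 1 - i - r \<le> k then d (n - 1 - k) else 0)"
        using that i by auto
      finally show ?thesis .
    qed
    have uk: "ip n (u k) w = 0" if "k \<in> {1..r}" for k
    proof -
      have "k - 1 < r" "Suc (k - 1) = k" using that by auto
      then show ?thesis using u0 unfolding w_def by metis
    qed
    obtain j where "j < Suc (i + r)" "d j \<noteq> 0" using d by auto
    then have "ip n (e (n - 1 - j)) w \<noteq> 0" using i by (subst ew) auto
    then have pos: "nrm2 n w > 0"
      unfolding parseval_nrm2[OF e] using i by (intro sum_pos2[of _ "n - 1 - j"]) auto
    have "z * nrm2 n w = (\<Sum>k<n. z * (cmod (ip n (e k) w))\<^sup>2)"
      by (simp add: parseval_nrm2[OF e] sum_distrib_left)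
    also have "\<dots> \<le> (\<Sum>k<n. l k * (cmod (ip n (e k) w))\<^sup>2)"
    proof (rule sum_mono)
      fix k assume k: "k \<in> {..<n}"
      show "z * (cmod (ip n (e k) w))\<^sup>2 \<le> l k * (cmod (ip n (e k) w))\<^sup>2"
      proof (cases "n - 1 - i - r \<le> k")
        case True
        then have "l (n - 1 - i - r) \<le> l k" using s k by (simp add: spec_def)
        then show ?thesis using z by (intro mult_right_mono) auto
      next
        case False
        then show ?thesis using ew k by simp
      qed
    qed
    also have "\<dots> = qf n (low_rank_pert r \<theta> u A) w"
      by (simp add: qf_low_rank_pert spec_qf[OF s] uk)
    finally show "nrm2 n ?w > 0 \<and> z * nrm2 n ?w \<le> qf n (low_rank_pert r \<theta> u A) ?w"
      using pos unfolding w_def by simp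
  qed
  then show ?thesis by (simp add: add.commute)
qed

text \<open>Negation turns the spikes into \<open>- \<theta> k\<close>, which decrease in
  \<open>k\<close>; renumbering by \<open>r + 1 - k\<close> restores the nondecreasing
  order.\<close>

lemma spec_low_rank_uminus:
  assumes "spec n (low_rank_pert r \<theta> u A) e' l'"
  shows "spec n (low_rank_pert r (\<lambda>k. - \<theta> (r + 1 - k)) (\<lambda>k. u (r + 1 - k)) (\<lambda>i j. - A i j))
    (\<lambda>k. e' (n - 1 - k)) (\<lambda>k. - l' (n - 1 - k))"
proof -
  have "low_rank_pert r (\<lambda>k. - \<theta> (r + 1 - k)) (\<lambda>k. u (r + 1 - k)) (\<lambda>i j. - A i j)
    = (\<lambda>i j. - low_rank_pert r \<theta> u A i j)" (is "?L = ?R")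
  proof (intro ext)
    fix i j
    have "(\<Sum>k\<in>{1..r}. complex_of_real (- \<theta> (r + 1 - k)) * u (r + 1 - k) i * cnj (u (r + 1 - k) j))
      = (\<Sum>k\<in>{1..r}. complex_of_real (- \<theta> k) * u k i * cnj (u k j))"
      by (rule sum.reindex_bij_witness[of _ "\<lambda>k. r + 1 - k" "\<lambda>k. r + 1 - k"]) auto
    then show "?L i j = ?R i j" by (simp add: low_rank_pert_def sum_negf)
  qed
  then show ?thesis using spec_uminus[OF assms] by simp
qed

section \<open>The Cauchy transform above the support\<close>

text \<open>A point outside the support has a null neighbourhood with rational endpoints, and there
  are only countably many of these.\<close>

lemma AE_meas_support:
  assumes \<mu>: "prob_space \<mu>" "sets \<mu> = sets borel"
  shows "AE x in \<mu>. x \<in> meas_support \<mu>"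
proof -
  interpret prob_space \<mu> by fact
  define N where "N = {(p::rat, q::rat). measure \<mu> {of_rat p<..<of_rat q::real} = 0}"
  define U where "U = (\<Union>(p,q)\<in>N. {of_rat p<..<of_rat q::real})"
  have "U \<in> null_sets \<mu>"
    unfolding U_def
  proof (intro null_sets_UN')
    show "countable N" by simp
    show "(case i of (p, q) \<Rightarrow> {of_rat p<..<of_rat q::real}) \<in> null_sets \<mu>" if "i \<in> N" for i
    proof (cases i)
      case (Pair p q)
      have "{of_rat p<..<of_rat q::real} \<in> sets \<mu>" unfolding \<mu>(2) by simp
      moreover have "emeasure \<mu> {of_rat p<..<of_rat q::real} = 0"
        using that unfolding Pair N_def by (simp add: emeasure_eq_measure)
      ultimately show ?thesis unfolding Pair by (simp add: null_setsI)
    qed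
  qed
  moreover have "{x \<in> space \<mu>. x \<notin> meas_support \<mu>} \<subseteq> U"
  proof
    fix x assume "x \<in> {x \<in> space \<mu>. x \<notin> meas_support \<mu>}"
    then obtain e where e: "e > 0" "measure \<mu> {x - e<..<x + e} \<le> 0"
      by (auto simp: meas_support_def not_less)
    obtain p where p: "x - e < of_rat p" "of_rat p < x"
      using of_rat_dense[of "x - e" x] e by auto
    obtain q where q: "x < of_rat q" "of_rat q < x + e"
      using of_rat_dense[of x "x + e"] e by auto
    have "measure \<mu> {of_rat p<..<of_rat q} \<le> measure \<mu> {x - e<..<x + e}"
      using p q \<mu>(2) by (intro finite_measure_mono) auto
    then have "measure \<mu> {of_rat p<..<of_rat q} = 0" using e(2) measure_nonneg[of \<mu> "{of_rat p<..<of_rat q}"] by linarith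
    then have "(p, q) \<in> N" by (simp add: N_def)
    then show "x \<in> U" using p q unfolding U_def by force
  qed
  ultimately show ?thesis by (rule AE_I')
qed

lemma supp_bounds:
  assumes \<mu>: "prob_space \<mu>" "sets \<mu> = sets borel" and K: "compact (meas_support \<mu>)"
  shows "AE x in \<mu>. supp_lo \<mu> \<le> x" "AE x in \<mu>. x \<le> supp_hi \<mu>"
    "supp_lo \<mu> \<in> meas_support \<mu>" "supp_hi \<mu> \<in> meas_support \<mu>"
proof -
  interpret prob_space \<mu> by fact
  have ae: "AE x in \<mu>. x \<in> meas_support \<mu>" by (rule AE_meas_support[OF \<mu>])
  have ne: "meas_support \<mu> \<noteq> {}" using ae AE_False by fastforce
  have bdd: "bdd_above (meas_support \<mu>)" "bdd_below (meas_support \<mu>)"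
    by (rule bounded_imp_bdd_above bounded_imp_bdd_below, rule compact_imp_bounded[OF K])+
  show "AE x in \<mu>. supp_lo \<mu> \<le> x"
    using ae by eventually_elim (simp add: supp_lo_def cInf_lower bdd)
  show "AE x in \<mu>. x \<le> supp_hi \<mu>"
    using ae by eventually_elim (simp add: supp_hi_def cSup_upper bdd)
  show "supp_lo \<mu> \<in> meas_support \<mu>" "supp_hi \<mu> \<in> meas_support \<mu>"
    unfolding supp_lo_def supp_hi_def using K ne bdd
    by (simp_all add: closed_contains_Inf closed_contains_Sup compact_imp_closed)
qed

text \<open>The upper bound is a parameter so that the theory serves both edges: once for \<mu> with
  its upper edge, once for the reflected measure with minus the lower edge.\<close>

locale bounded_above_prob =
  fixes \<mu> :: "real measure" and b :: real
  assumes prob: "prob_space \<mu>" and sets_borel: "sets \<mu> = sets borel" and le_b: "AE x in \<mu>. x \<le> b"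
begin

interpretation prob_space \<mu> by (rule prob)

lemma measurable_kernel [measurable]: "(\<lambda>x. 1 / (z - x)) \<in> borel_measurable \<mu>"
proof -
  have "(\<lambda>x::real. 1 / (z - x)) \<in> borel_measurable borel" by measurable
  then show ?thesis by (simp add: measurable_cong_sets[OF sets_borel refl])
qed

lemma kernel_le:
  assumes "b < z0" "z0 \<le> z" "x \<le> b"
  shows "1 / (z - x) \<le> 1 / (z0 - b)" "0 < 1 / (z - x)"
  using assms by (auto intro!: divide_left_mono mult_pos_pos)

lemma integrable_kernel: "b < z \<Longrightarrow> integrable \<mu> (\<lambda>x. 1 / (z - x))"
  by (rule integrable_const_bound[where B = "1 / (z - b)"])
     (use le_b kernel_le[of z z] in \<open>auto intro: AE_mp\<close>)

lemma cauchy_transform_pos: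
  assumes "b < z"
  shows "0 < cauchy_transform \<mu> z"
proof -
  have "AE x in \<mu>. 0 < 1 / (z - x)"
    using le_b by eventually_elim (use assms in auto)
  then have "(\<integral>x. 0 \<partial>\<mu>) < (\<integral>x. 1 / (z - x) \<partial>\<mu>)"
    by (intro integral_less_AE_space integrable_kernel assms) (auto simp: emeasure_space_1)
  then show ?thesis by (simp add: cauchy_transform_def)
qed

lemma cauchy_transform_strict_antimono:
  assumes "b < z" "z < z'"
  shows "cauchy_transform \<mu> z' < cauchy_transform \<mu> z"
  unfolding cauchy_transform_def
proof (rule integral_less_AE_space)
  show "AE x in \<mu>. 1 / (z' - x) < 1 / (z - x)"
    using le_b by eventually_elim (use assms in \<open>auto intro!: divide_strict_left_mono mult_pos_pos\<close>)
qed (use assms in \<open>auto intro: integrable_kernel simp: emeasure_space_1\<close>)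

lemma cauchy_transform_le:
  assumes "b < z"
  shows "cauchy_transform \<mu> z \<le> 1 / (z - b)"
proof -
  have "cauchy_transform \<mu> z \<le> (\<integral>x. 1 / (z - b) \<partial>\<mu>)"
    unfolding cauchy_transform_def
    by (rule integral_mono_AE[OF integrable_kernel])
       (use le_b kernel_le[of z z] assms in \<open>auto intro: AE_mp\<close>)
  then show ?thesis by (simp add: prob_space)
qed

lemma continuous_on_cauchy_transform: "continuous_on {b<..} (cauchy_transform \<mu>)"
proof (rule continuous_at_imp_continuous_on, intro ballI)
  fix z assume "z \<in> {b<..}"
  then have z: "b < z" by simp
  show "isCont (cauchy_transform \<mu>) z"
    unfolding continuous_at_sequentially
  proof (intro allI impI)
    fix s :: "nat \<Rightarrow> real" assume s: "s \<longlonglongrightarrow> z"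
    \<comment> \<open>Staying to the right of the midpoint \<open>c\<close> bounds the kernels by
      1/(c - b), which is the dominating function.\<close>
    define c where "c = (b + z) / 2"
    have c: "b < c" "c < z" using z by (auto simp: c_def)
    have ev: "eventually (\<lambda>n. c < s n) sequentially" using s c(2) by (rule order_tendstoD)
    then obtain N where N: "\<And>n. N \<le> n \<Longrightarrow> c < s n" by (auto simp: eventually_sequentially)
    have "(\<lambda>n. cauchy_transform \<mu> (s (n + N))) \<longlonglongrightarrow> cauchy_transform \<mu> z"
      unfolding cauchy_transform_def
    proof (rule integral_dominated_convergence[where w = "\<lambda>_. 1 / (c - b)"])
      show "AE x in \<mu>. (\<lambda>n. 1 / (s (n + N) - x)) \<longlonglongrightarrow> 1 / (z - x)"
        using le_b
      proof eventually_elim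
        case (elim x)
        then show ?case using z LIMSEQ_ignore_initial_segment[OF s, of N]
          by (intro tendsto_divide tendsto_diff tendsto_const) auto
      qed
      show "AE x in \<mu>. norm (1 / (s (n + N) - x)) \<le> 1 / (c - b)" for n
        using le_b
      proof eventually_elim
        case (elim x)
        then show ?case using kernel_le[of c "s (n + N)" x] c N[of "n + N"] by simp
      qed
    qed auto
    then have "(\<lambda>n. cauchy_transform \<mu> (s n)) \<longlonglongrightarrow> cauchy_transform \<mu> z" by (rule LIMSEQ_offset)
    then show "(cauchy_transform \<mu> \<circ> s) \<longlonglongrightarrow> cauchy_transform \<mu> z" by (simp add: comp_def)
  qed
qed

text \<open>The transform decreases in \<open>z\<close>, so towards the edge it either tends to
  infinity or converges to its supremum; the supremum is not attained because the decrease is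
  strict.\<close>

lemma cauchy_transform_limit:
  assumes "\<not> filterlim (cauchy_transform \<mu>) at_top (at_right b)"
  shows "\<exists>L. (cauchy_transform \<mu> \<longlongrightarrow> L) (at_right b) \<and> (\<forall>z>b. cauchy_transform \<mu> z < L)"
proof -
  let ?g = "cauchy_transform \<mu>"
  have near: "eventually (\<lambda>z. C < ?g z) (at_right b)" if "b < z0" "C < ?g z0" for z0 C
    using eventually_at_right_real[OF that(1)]
    by eventually_elim (use that cauchy_transform_strict_antimono in \<open>auto intro: less_trans\<close>)
  obtain C where C: "\<not> eventually (\<lambda>z. C < ?g z) (at_right b)"
    using assms by (auto simp: filterlim_at_top_dense)
  have bd: "?g z \<le> C" if "b < z" for z using near[OF that, of C] C by (meson not_le)
  define L where "L = (SUP z\<in>{b<..}. ?g z)"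
  have bdd: "bdd_above (?g ` {b<..})" using bd by (auto intro!: bdd_aboveI[of _ C])
  have lt: "?g z < L" if "b < z" for z
  proof -
    have "?g z < ?g ((b + z) / 2)" using that by (intro cauchy_transform_strict_antimono) auto
    also have "\<dots> \<le> L" unfolding L_def by (rule cSUP_upper[OF _ bdd]) (use that in auto)
    finally show ?thesis .
  qed
  have "(?g \<longlongrightarrow> L) (at_right b)"
  proof (rule order_tendstoI)
    fix c assume "c < L"
    then obtain z where "b < z" "c < ?g z" unfolding L_def by (subst (asm) less_cSUP_iff[OF _ bdd]) auto
    then show "eventually (\<lambda>z. c < ?g z) (at_right b)" by (rule near)
  next
    fix c assume "L < c"
    have "eventually (\<lambda>z. b < z) (at_right b)" by (simp add: eventually_at_right_less)
    then show "eventually (\<lambda>z. ?g z < c) (at_right b)"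
      by eventually_elim (use lt \<open>L < c\<close> in \<open>auto intro: less_trans\<close>)
  qed
  then show ?thesis using lt by blast
qed

text \<open>The number \<open>theta_bar\<close> with the edge as a parameter;
  \<open>theta_under\<close> is minus this number for the reflected measure.\<close>

definition "critical = (if filterlim (cauchy_transform \<mu>) at_top (at_right b) then 0
                  else 1 / Lim (at_right b) (cauchy_transform \<mu>))"

text \<open>This eliminates the limit from all later arguments: a spike is subcritical when the
  transform never reaches 1/\<theta> to the right of the edge. The borderline \<theta> =
  \<open>critical\<close> is subcritical because the limit is not attained.\<close>

lemma critical_le_iff:
  assumes \<theta>: "0 < \<theta>"
  shows "\<theta> \<le> critical \<longleftrightarrow> (\<forall>z>b. cauchy_transform \<mu> z < 1 / \<theta>)"
proof (cases "filterlim (cauchy_transform \<mu>) at_top (at_right b)")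
  case True
  then have "eventually (\<lambda>z. 1 / \<theta> < cauchy_transform \<mu> z) (at_right b)"
    by (auto simp: filterlim_at_top_dense)
  moreover have "eventually (\<lambda>z. b < z) (at_right b)" by (simp add: eventually_at_right_less)
  ultimately have "eventually (\<lambda>z. b < z \<and> 1 / \<theta> < cauchy_transform \<mu> z) (at_right b)"
    by eventually_elim auto
  then obtain z where "b < z" "1 / \<theta> < cauchy_transform \<mu> z"
    using eventually_happens'[OF trivial_limit_at_right_real] by blast
  then show ?thesis using True \<theta> by (auto simp: critical_def dest: less_asym)
next
  case False
  obtain L where L: "(cauchy_transform \<mu> \<longlongrightarrow> L) (at_right b)" "\<And>z. b < z \<Longrightarrow> cauchy_transform \<mu> z < L"
    using cauchy_transform_limit[OF False] by auto
  have "Lim (at_right b) (cauchy_transform \<mu>) = L"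
    by (rule tendsto_Lim[OF trivial_limit_at_right_real L(1)])
  then have cr: "critical = 1 / L" using False by (simp add: critical_def)
  have Lpos: "0 < L" using L(2)[of "b + 1"] cauchy_transform_pos[of "b + 1"] by simp
  show ?thesis
  proof
    assume "\<theta> \<le> critical"
    then have "L \<le> 1 / \<theta>" using cr \<theta> Lpos by (simp add: field_simps)
    then show "\<forall>z>b. cauchy_transform \<mu> z < 1 / \<theta>" using L(2) by (auto intro: less_le_trans)
  next
    assume *: "\<forall>z>b. cauchy_transform \<mu> z < 1 / \<theta>"
    have "L \<le> 1 / \<theta>"
    proof (rule tendsto_upperbound[OF L(1) _ trivial_limit_at_right_real])
      have "eventually (\<lambda>z. b < z) (at_right b)" by (simp add: eventually_at_right_less)
      then show "eventually (\<lambda>z. cauchy_transform \<mu> z \<le> 1 / \<theta>) (at_right b)"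
        by eventually_elim (use * in \<open>auto intro: less_imp_le\<close>)
    qed
    then show "\<theta> \<le> critical" unfolding cr using \<theta> Lpos by (simp add: field_simps)
  qed
qed

lemma outlier_exists:
  assumes \<theta>: "0 < \<theta>" "critical < \<theta>"
  shows "\<exists>\<rho>>b. cauchy_transform \<mu> \<rho> = 1 / \<theta>"
proof -
  obtain z where z: "b < z" "1 / \<theta> \<le> cauchy_transform \<mu> z"
    using critical_le_iff[OF \<theta>(1)] \<theta>(2) by (auto simp: not_less)
  \<comment> \<open>From b + \<theta> on, the bound 1/(z - b) is at most 1/\<theta>, which supplies
    the right end for the intermediate value theorem.\<close>
  define y where "y = max (z + 1) (b + \<theta>)"
  have y: "b < y" "z \<le> y" "\<theta> \<le> y - b" using z by (auto simp: y_def)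
  have "cauchy_transform \<mu> y \<le> 1 / (y - b)" by (rule cauchy_transform_le[OF y(1)])
  also have "\<dots> \<le> 1 / \<theta>" using y \<theta> by (intro divide_left_mono) auto
  finally have "cauchy_transform \<mu> y \<le> 1 / \<theta>" .
  moreover have "continuous_on {z..y} (cauchy_transform \<mu>)"
    by (rule continuous_on_subset[OF continuous_on_cauchy_transform]) (use z in auto)
  ultimately obtain x where "z \<le> x" "x \<le> y" "cauchy_transform \<mu> x = 1 / \<theta>"
    using IVT2'[of "cauchy_transform \<mu>" y "1 / \<theta>" z] z y by auto
  then show ?thesis using z(1) by (intro exI[of _ x]) auto
qed

text \<open>\<open>location\<close> is \<open>b\<close> for subcritical \<open>\<theta>\<close> and the outlier otherwise; both cases are characterised by
  the sign of \<open>\<theta> G(z) - 1\<close>.\<close>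
definition "location \<theta> = (if critical < \<theta> then (THE z. b < z \<and> cauchy_transform \<mu> z = 1 / \<theta>) else b)"

lemma location:
  assumes \<theta>: "0 < \<theta>"
  shows "b \<le> location \<theta>"
    and "b < z \<Longrightarrow> location \<theta> < z \<Longrightarrow> \<theta> * cauchy_transform \<mu> z < 1"
    and "b < z \<Longrightarrow> z < location \<theta> \<Longrightarrow> 1 < \<theta> * cauchy_transform \<mu> z"
    and "critical < \<theta> \<Longrightarrow> b < location \<theta> \<and> cauchy_transform \<mu> (location \<theta>) = 1 / \<theta>"
proof -
  have *: "b < location \<theta> \<and> cauchy_transform \<mu> (location \<theta>) = 1 / \<theta>" if c: "critical < \<theta>"
  proof -
    obtain x where x: "b < x" "cauchy_transform \<mu> x = 1 / \<theta>" using outlier_exists[OF \<theta> c] by blast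
    have "location \<theta> = x"
      unfolding location_def if_P[OF c]
    proof (rule the_equality)
      fix y assume "b < y \<and> cauchy_transform \<mu> y = 1 / \<theta>"
      then show "y = x"
        using x cauchy_transform_strict_antimono[of x y] cauchy_transform_strict_antimono[of y x]
        by (cases x y rule: linorder_cases) auto
    qed (use x in auto)
    then show ?thesis using x by simp
  qed
  then show "critical < \<theta> \<Longrightarrow> b < location \<theta> \<and> cauchy_transform \<mu> (location \<theta>) = 1 / \<theta>" .
  show "b \<le> location \<theta>" using * by (cases "critical < \<theta>") (auto simp: location_def)
  show "\<theta> * cauchy_transform \<mu> z < 1" if "b < z" "location \<theta> < z"
  proof (cases "critical < \<theta>")
    case True
    have "cauchy_transform \<mu> z < 1 / \<theta>"
      using cauchy_transform_strict_antimono[of "location \<theta>" z] *[OF True] that by simp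
    then show ?thesis using \<theta> by (simp add: field_simps)
  next
    case False
    then show ?thesis using critical_le_iff[OF \<theta>] that \<theta> by (simp add: field_simps)
  qed
  show "1 < \<theta> * cauchy_transform \<mu> z" if "b < z" "z < location \<theta>"
  proof -
    have c: "critical < \<theta>" using that by (cases "critical < \<theta>") (auto simp: location_def)
    have "1 / \<theta> < cauchy_transform \<mu> z"
      using cauchy_transform_strict_antimono[of z "location \<theta>"] *[OF c] that by simp
    then show ?thesis using \<theta> by (simp add: field_simps)
  qed
qed

end

section \<open>Reflection of the measure and identification of \<open>rho\<close>\<close>

definition reflect :: "real measure \<Rightarrow> real measure" where
  "reflect \<mu> = distr \<mu> borel uminus"

lemma cauchy_transform_reflect:
  assumes "sets \<mu> = sets borel"
  shows "cauchy_transform (reflect \<mu>) z = - cauchy_transform \<mu> (- z)"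
proof -
  have m: "uminus \<in> measurable \<mu> borel" using assms by (simp add: measurable_cong_sets[OF assms refl])
  have "cauchy_transform (reflect \<mu>) z = (\<integral>x. 1 / (z - (- x)) \<partial>\<mu>)"
    unfolding cauchy_transform_def reflect_def by (rule integral_distr[OF m]) measurable
  also have "\<dots> = (\<integral>x. - (1 / (- z - x)) \<partial>\<mu>)"
  proof (rule Bochner_Integration.integral_cong[OF refl])
    fix x :: real
    have "- z - x = - (z - (- x))" by simp
    then show "1 / (z - (- x)) = - (1 / (- z - x))" by (metis minus_divide_right minus_minus)
  qed
  finally show ?thesis by (simp add: cauchy_transform_def)
qed

lemma bounded_above_prob_hi:
  assumes "prob_space \<mu>" "sets \<mu> = sets borel" "compact (meas_support \<mu>)"
  shows "bounded_above_prob \<mu> (supp_hi \<mu>)"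
  by (intro bounded_above_prob.intro assms supp_bounds)

lemma bounded_above_prob_lo:
  assumes "prob_space \<mu>" "sets \<mu> = sets borel" "compact (meas_support \<mu>)"
  shows "bounded_above_prob (reflect \<mu>) (- supp_lo \<mu>)"
proof (rule bounded_above_prob.intro)
  have m: "uminus \<in> measurable \<mu> borel" using assms by (simp add: measurable_cong_sets[OF assms(2) refl])
  show "prob_space (reflect \<mu>)" unfolding reflect_def by (rule prob_space.prob_space_distr[OF assms(1) m])
  show "sets (reflect \<mu>) = sets borel" by (simp add: reflect_def)
  show "AE x in reflect \<mu>. x \<le> - supp_lo \<mu>"
    unfolding reflect_def using supp_bounds(1)[OF assms] by (subst AE_distr_iff[OF m]) auto
qed

text \<open>The left-hand behaviour of the transform of \<mu> at the lower edge is, up to sign, the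
  right-hand behaviour of the transform of the reflected measure at minus that edge.\<close>

lemma theta_under_eq:
  assumes "prob_space \<mu>" "sets \<mu> = sets borel" "compact (meas_support \<mu>)"
  shows "theta_under \<mu> = - bounded_above_prob.critical (reflect \<mu>) (- supp_lo \<mu>)"
proof -
  interpret lo: bounded_above_prob "reflect \<mu>" "- supp_lo \<mu>" by (rule bounded_above_prob_lo[OF assms])
  let ?a = "supp_lo \<mu>" and ?g = "cauchy_transform (reflect \<mu>)"
  have G: "cauchy_transform \<mu> = (\<lambda>z. - ?g (- z))"
    using cauchy_transform_reflect[OF assms(2), of "- z" for z] by auto
  have iff: "filterlim (cauchy_transform \<mu>) at_bot (at_left ?a) \<longleftrightarrow> filterlim ?g at_top (at_right (- ?a))"
    unfolding G filterlim_uminus_at_top at_left_minus[of ?a] filterlim_filtermap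
    by simp
  show ?thesis
  proof (cases "filterlim ?g at_top (at_right (- ?a))")
    case True
    then show ?thesis using iff by (simp add: theta_under_def lo.critical_def)
  next
    case False
    obtain L where L: "(?g \<longlongrightarrow> L) (at_right (- ?a))" using lo.cauchy_transform_limit[OF False] by auto
    have "(cauchy_transform \<mu> \<longlongrightarrow> - L) (at_left ?a)"
      unfolding G at_left_minus[of ?a] filterlim_filtermap using tendsto_minus[OF L] by simp
    then have "Lim (at_left ?a) (cauchy_transform \<mu>) = - L"
      by (rule tendsto_Lim[OF trivial_limit_at_left_real])
    moreover have "Lim (at_right (- ?a)) ?g = L" by (rule tendsto_Lim[OF trivial_limit_at_right_real L])
    ultimately show ?thesis using iff False by (simp add: theta_under_def lo.critical_def)
  qed
qed

context bounded_above_prob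
begin

text \<open>With this, the two outlier branches in \<open>rho\<close> separate by the sign of
  \<theta>: a positive spike is never below \<open>theta_under\<close>, a negative one never above
  \<open>theta_bar\<close>.\<close>

lemma critical_nonneg: "0 \<le> critical"
proof (cases "filterlim (cauchy_transform \<mu>) at_top (at_right b)")
  case False
  obtain L where L: "(cauchy_transform \<mu> \<longlongrightarrow> L) (at_right b)" "\<And>z. b < z \<Longrightarrow> cauchy_transform \<mu> z < L"
    using cauchy_transform_limit[OF False] by auto
  have "0 < L" using L(2)[of "b + 1"] cauchy_transform_pos[of "b + 1"] by simp
  then show ?thesis using False tendsto_Lim[OF trivial_limit_at_right_real L(1)] by (simp add: critical_def)
qed (simp add: critical_def)

end

lemma rho_pos:
  assumes "prob_space \<mu>" "sets \<mu> = sets borel" "compact (meas_support \<mu>)" and \<theta>: "0 < \<theta>"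
  shows "rho \<mu> \<theta> = bounded_above_prob.location \<mu> (supp_hi \<mu>) \<theta>"
proof -
  interpret bounded_above_prob \<mu> "supp_hi \<mu>" by (rule bounded_above_prob_hi[OF assms(1-3)])
  interpret lo: bounded_above_prob "reflect \<mu>" "- supp_lo \<mu>" by (rule bounded_above_prob_lo[OF assms(1-3)])
  have "theta_bar \<mu> = critical" by (simp add: theta_bar_def critical_def)
  moreover have "\<not> \<theta> < theta_under \<mu>"
    using theta_under_eq[OF assms(1-3)] lo.critical_nonneg \<theta> by simp
  ultimately show ?thesis using \<theta> unfolding rho_def location_def by auto
qed

lemma rho_neg:
  assumes "prob_space \<mu>" "sets \<mu> = sets borel" "compact (meas_support \<mu>)" and \<theta>: "\<theta> < 0"
  shows "rho \<mu> \<theta> = - bounded_above_prob.location (reflect \<mu>) (- supp_lo \<mu>) (- \<theta>)"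
proof -
  interpret bounded_above_prob \<mu> "supp_hi \<mu>" by (rule bounded_above_prob_hi[OF assms(1-3)])
  interpret lo: bounded_above_prob "reflect \<mu>" "- supp_lo \<mu>" by (rule bounded_above_prob_lo[OF assms(1-3)])
  have "theta_bar \<mu> = critical" by (simp add: theta_bar_def critical_def)
  then have 1: "\<not> \<theta> > theta_bar \<mu>" using critical_nonneg \<theta> by simp
  have 2: "\<theta> < theta_under \<mu> \<longleftrightarrow> lo.critical < - \<theta>" using theta_under_eq[OF assms(1-3)] by auto
  show ?thesis
  proof (cases "\<theta> < theta_under \<mu>")
    case True
    have \<theta>': "0 < - \<theta>" using \<theta> by simp
    have G: "cauchy_transform \<mu> z = - cauchy_transform (reflect \<mu>) (- z)" for z
      using cauchy_transform_reflect[OF assms(2), of "- z"] by simp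
    note loc = lo.location(4)[OF \<theta>' True[unfolded 2]]
    have "rho \<mu> \<theta> = (THE z. z < supp_lo \<mu> \<and> cauchy_transform \<mu> z = 1 / \<theta>)"
      using 1 True by (simp add: rho_def)
    also have "\<dots> = - lo.location (- \<theta>)"
    proof (rule the_equality)
      show "- lo.location (- \<theta>) < supp_lo \<mu> \<and> cauchy_transform \<mu> (- lo.location (- \<theta>)) = 1 / \<theta>"
        using loc by (simp add: G)
      fix z assume z: "z < supp_lo \<mu> \<and> cauchy_transform \<mu> z = 1 / \<theta>"
      have "cauchy_transform (reflect \<mu>) (- z) = cauchy_transform (reflect \<mu>) (lo.location (- \<theta>))"
        using z loc by (simp add: G)
      then have "- z = lo.location (- \<theta>)"
        using z loc lo.cauchy_transform_strict_antimono[of "- z" "lo.location (- \<theta>)"]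
          lo.cauchy_transform_strict_antimono[of "lo.location (- \<theta>)" "- z"]
        by (cases "- z" "lo.location (- \<theta>)" rule: linorder_cases) auto
      then show "z = - lo.location (- \<theta>)" by simp
    qed
    finally show ?thesis .
  next
    case False
    then show ?thesis using 1 2 \<theta> by (simp add: rho_def lo.location_def)
  qed
qed

section \<open>Convergence of the spectral measures\<close>

lemma bounded_range_inverse:
  fixes c :: real and m :: "real \<Rightarrow> real"
  assumes "c > 0" "\<And>x. c \<le> m x"
  shows "bounded (range (\<lambda>x. 1 / m x))"
proof -
  have "\<bar>1 / m x\<bar> \<le> 1 / c" for x
  proof -
    have "0 < m x" using assms(2)[of x] assms(1) by linarith
    then show ?thesis using assms(2)[of x] assms(1) by (auto intro!: divide_left_mono)
  qed
  then show ?thesis by (auto simp: bounded_iff)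
qed

text \<open>Hypothesis (H1) as seen from the upper edge, for an arbitrary array of sorted numbers;
  the eigenvalues negated and read backwards are a second instance, for the lower edge.\<close>

locale spectral_convergence = bounded_above_prob \<mu> b for \<mu> b +
  fixes L :: "nat \<Rightarrow> nat \<Rightarrow> real"
  assumes L_mono: "j \<le> k \<Longrightarrow> k < n \<Longrightarrow> L n j \<le> L n k"
    and weak: "\<And>f :: real \<Rightarrow> real. continuous_on UNIV f \<Longrightarrow> bounded (range f) \<Longrightarrow>
      (\<lambda>n. (1 / real n) * (\<Sum>l<n. f (L n l))) \<longlonglongrightarrow> (\<integral>x. f x \<partial>\<mu>)"
    and edge: "(\<lambda>n. L n (n - 1)) \<longlonglongrightarrow> b"
    and b_support: "b \<in> meas_support \<mu>"
begin

lemma eventually_less: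
  assumes z: "b < z"
  shows "eventually (\<lambda>n. \<forall>k<n. L n k < z) sequentially"
  using order_tendstoD(2)[OF edge z]
proof eventually_elim
  case (elim n)
  show ?case
  proof (intro allI impI)
    fix k assume "k < n"
    then have "L n k \<le> L n (n - 1)" by (intro L_mono) auto
    then show "L n k < z" using elim by simp
  qed
qed

text \<open>The kernel 1/(z - x) is not a bounded continuous test function, but truncating its
  argument at the midpoint \<open>c\<close> of b and z makes it one. The truncation changes nothing
  \<mu>-almost everywhere, nor at any eigenvalue once the largest has dropped below
  \<open>c\<close>.\<close>

lemma trace_limit:
  assumes z: "b < z"
  shows "(\<lambda>n. (1 / real n) * (\<Sum>l<n. 1 / (z - L n l))) \<longlonglongrightarrow> cauchy_transform \<mu> z"
proof -
  define c where "c = (b + z) / 2"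
  have c: "b < c" "c < z" using z by (auto simp: c_def)
  define f where "f x = 1 / (z - min x c)" for x
  have "continuous_on UNIV f"
    unfolding f_def[abs_def] using c by (intro continuous_intros) (auto simp: min_def)
  moreover have "bounded (range f)"
    unfolding f_def[abs_def] by (rule bounded_range_inverse[of "z - c"]) (use c in auto)
  ultimately have 1: "(\<lambda>n. (1 / real n) * (\<Sum>l<n. f (L n l))) \<longlonglongrightarrow> (\<integral>x. f x \<partial>\<mu>)" by (rule weak)
  have "AE x in \<mu>. f x = 1 / (z - x)"
    using le_b by eventually_elim (use c in \<open>auto simp: f_def min_def\<close>)
  moreover have "f \<in> borel_measurable \<mu>"
    unfolding f_def[abs_def] measurable_cong_sets[OF sets_borel refl] by measurable
  ultimately have 2: "(\<integral>x. f x \<partial>\<mu>) = cauchy_transform \<mu> z"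
    unfolding cauchy_transform_def by (intro integral_cong_AE measurable_kernel) auto
  have "eventually (\<lambda>n. (1 / real n) * (\<Sum>l<n. f (L n l)) = (1 / real n) * (\<Sum>l<n. 1 / (z - L n l))) sequentially"
    using eventually_less[OF c(1)]
    by eventually_elim (auto simp: f_def min_def intro!: arg_cong2[where f = "(*)"] sum.cong)
  then show ?thesis using 1 unfolding 2 by (rule Lim_transform_eventually[rotated])
qed

text \<open>A bounded number of eigenvalues carries no mass in the limit, while a continuous function
  positive near a point of the support has a positive integral.\<close>
lemma many_eigs_near_edge:
  assumes \<epsilon>: "0 < \<epsilon>"
  shows "eventually (\<lambda>n. j < card {l. l < n \<and> \<bar>L n l - b\<bar> < \<epsilon>}) sequentially"
proof -
  interpret prob_space \<mu> by (rule prob)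
  \<comment> \<open>A tent at the edge: at least 1/2 within \<epsilon>/2 of \<open>b\<close>, so its
    integral is positive, and zero beyond distance \<epsilon>, so its average over the eigenvalues
    is at most the proportion of those near \<open>b\<close>.\<close>
  define f where "f x = max 0 (1 - \<bar>x - b\<bar> / \<epsilon>)" for x
  have f01: "0 \<le> f x" "f x \<le> 1" for x using \<epsilon> by (auto simp: f_def)
  have fin: "f x \<le> indicator {x. \<bar>x - b\<bar> < \<epsilon>} x" for x
    using \<epsilon> by (auto simp: f_def indicator_def)
  have "continuous_on UNIV f" unfolding f_def[abs_def] using \<epsilon> by (intro continuous_intros) auto
  moreover have "bounded (range f)" using f01 by (auto simp: bounded_iff intro!: exI[of _ 1])
  ultimately have 1: "(\<lambda>n. (1 / real n) * (\<Sum>l<n. f (L n l))) \<longlonglongrightarrow> (\<integral>x. f x \<partial>\<mu>)" by (rule weak)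
  let ?I = "{b - \<epsilon>/2 <..< b + \<epsilon>/2}"
  have I: "?I \<in> sets \<mu>" unfolding sets_borel by simp
  have fm: "f \<in> borel_measurable \<mu>"
    unfolding f_def[abs_def] measurable_cong_sets[OF sets_borel refl] by measurable
  have "(\<integral>x. (1/2) * indicator ?I x \<partial>\<mu>) \<le> (\<integral>x. f x \<partial>\<mu>)"
  proof (rule integral_mono)
    show "integrable \<mu> (\<lambda>x. (1/2) * indicator ?I x :: real)"
      using I by (intro integrable_mult_right integrable_real_indicator) (auto simp: emeasure_eq_measure)
    show "integrable \<mu> f"
      by (rule integrable_const_bound[where B = 1]) (use f01 fm in auto)
    show "(1/2) * indicator ?I x \<le> f x" for x
    proof (cases "x \<in> ?I")
      case True
      then have "\<bar>x - b\<bar> \<le> \<epsilon> / 2" by (auto simp: abs_if)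
      then have "\<bar>x - b\<bar> / \<epsilon> \<le> 1/2" using \<epsilon> by (simp add: field_simps)
      then show ?thesis using True by (auto simp: f_def)
    qed (simp add: f01)
  qed
  moreover have "(\<integral>x. (1/2) * indicator ?I x \<partial>\<mu>) = (1/2) * measure \<mu> ?I" using I by simp
  moreover have "measure \<mu> ?I > 0" using b_support \<epsilon> unfolding meas_support_def by auto
  ultimately have pos: "(\<integral>x. f x \<partial>\<mu>) > 0" by linarith
  have "eventually (\<lambda>n. (\<integral>x. f x \<partial>\<mu>) / 2 < (1 / real n) * (\<Sum>l<n. f (L n l))) sequentially"
    by (rule order_tendstoD[OF 1]) (use pos in simp)
  moreover have "eventually (\<lambda>n. real j / real n < (\<integral>x. f x \<partial>\<mu>) / 2) sequentially"
    by (rule order_tendstoD[OF lim_const_over_n]) (use pos in simp)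
  moreover have "eventually (\<lambda>n::nat. 0 < n) sequentially" by (rule eventually_gt_at_top)
  ultimately show ?thesis
  proof eventually_elim
    case (elim n)
    let ?C = "{l. l < n \<and> \<bar>L n l - b\<bar> < \<epsilon>}"
    have "(\<Sum>l<n. f (L n l)) \<le> (\<Sum>l<n. if l \<in> ?C then 1 else 0)"
    proof (rule sum_mono)
      fix l assume "l \<in> {..<n}"
      then show "f (L n l) \<le> (if l \<in> ?C then 1 else 0)"
        using fin[of "L n l"] f01 by (cases "l \<in> ?C") auto
    qed
    also have "\<dots> = real (card ({..<n} \<inter> ?C))" by (subst sum.If_cases) (simp_all add: Int_def)
    also have "{..<n} \<inter> ?C = ?C" by auto
    finally have "(1 / real n) * (\<Sum>l<n. f (L n l)) \<le> real (card ?C) / real n"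
      by (simp add: divide_right_mono)
    then have "real j / real n < real (card ?C) / real n" using elim by linarith
    then show ?case using elim by (simp add: divide_less_cancel)
  qed
qed

text \<open>If the eigenvalue at \<open>n - 1 - j\<close> were below \<open>z\<close>, at most
  \<open>j\<close> eigenvalues could lie within distance \<open>b - z\<close> of the edge.\<close>

lemma eventually_edge_ge:
  assumes z: "z < b"
  shows "eventually (\<lambda>n. z \<le> L n (n - 1 - j)) sequentially"
proof -
  have "0 < b - z" using z by simp
  from many_eigs_near_edge[OF this, of j] show ?thesis
  proof eventually_elim
    case (elim n)
    show ?case
    proof (rule ccontr)
      assume *: "\<not> z \<le> L n (n - 1 - j)"
      have "{l. l < n \<and> \<bar>L n l - b\<bar> < b - z} \<subseteq> {n - 1 - j <..< n}"
      proof
        fix l assume "l \<in> {l. l < n \<and> \<bar>L n l - b\<bar> < b - z}"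
        then have l: "l < n" "z < L n l" by auto
        have "\<not> l \<le> n - 1 - j"
        proof
          assume "l \<le> n - 1 - j"
          then have "L n l \<le> L n (n - 1 - j)" using l by (intro L_mono) auto
          then show False using * l by simp
        qed
        then show "l \<in> {n - 1 - j <..< n}" using l by simp
      qed
      then have "card {l. l < n \<and> \<bar>L n l - b\<bar> < b - z} \<le> card {n - 1 - j <..< n}"
        by (rule card_mono[rotated]) simp
      also have "\<dots> \<le> j" by simp
      finally show False using elim by simp
    qed
  qed
qed

end

lemma meas_support_reflect:
  assumes "sets \<mu> = sets borel"
  shows "x \<in> meas_support (reflect \<mu>) \<longleftrightarrow> - x \<in> meas_support \<mu>"
proof -
  have m: "uminus \<in> measurable \<mu> borel" using assms by (simp add: measurable_cong_sets[OF assms refl])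
  have sp: "space \<mu> = UNIV" using sets_eq_imp_space_eq[OF assms] by simp
  have "measure (reflect \<mu>) {x - e<..<x + e} = measure \<mu> {- x - e<..<- x + e}" for e
  proof -
    have "uminus -` {x - e<..<x + e} \<inter> space \<mu> = {- x - e<..<- x + e}" unfolding sp by auto
    then show ?thesis unfolding reflect_def by (subst measure_distr[OF m]) auto
  qed
  then show ?thesis by (simp add: meas_support_def)
qed

lemma H1_spectral_convergence_hi:
  assumes H: "hypothesis_H1 X \<mu>"
  shows "spectral_convergence \<mu> (supp_hi \<mu>) (\<lambda>n k. eigs (X n) ! k)"
proof (intro spectral_convergence.intro spectral_convergence_axioms.intro)
  have \<mu>: "prob_space \<mu>" "sets \<mu> = sets borel" "compact (meas_support \<mu>)"
    using H by (auto simp: hypothesis_H1_def)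
  show "bounded_above_prob \<mu> (supp_hi \<mu>)" by (rule bounded_above_prob_hi[OF \<mu>])
  show "supp_hi \<mu> \<in> meas_support \<mu>" by (rule supp_bounds[OF \<mu>])
  show "eigs (X n) ! j \<le> eigs (X n) ! k" if "j \<le> k" "k < n" for n j k
  proof -
    have "hermitian_mat n (X n)" using H that by (auto simp: hypothesis_H1_def)
    then obtain e where "spec n (\<lambda>i j. X n $$ (i,j)) e (\<lambda>k. eigs (X n) ! k)" using spec_eigs_exists by blast
    then show ?thesis using that by (simp add: spec_def)
  qed
qed (use H in \<open>auto simp: hypothesis_H1_def\<close>)

lemma H1_spectral_convergence_lo:
  assumes H: "hypothesis_H1 X \<mu>"
  shows "spectral_convergence (reflect \<mu>) (- supp_lo \<mu>) (\<lambda>n k. - eigs (X n) ! (n - 1 - k))"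
proof (intro spectral_convergence.intro spectral_convergence_axioms.intro)
  interpret hi: spectral_convergence \<mu> "supp_hi \<mu>" "\<lambda>n k. eigs (X n) ! k"
    by (rule H1_spectral_convergence_hi[OF H])
  have \<mu>: "prob_space \<mu>" "sets \<mu> = sets borel" "compact (meas_support \<mu>)"
    using H by (auto simp: hypothesis_H1_def)
  show "bounded_above_prob (reflect \<mu>) (- supp_lo \<mu>)" by (rule bounded_above_prob_lo[OF \<mu>])
  show "- supp_lo \<mu> \<in> meas_support (reflect \<mu>)"
    unfolding meas_support_reflect[OF \<mu>(2)] using supp_bounds(3)[OF \<mu>] by simp
  show "- eigs (X n) ! (n - 1 - j) \<le> - eigs (X n) ! (n - 1 - k)" if "j \<le> k" "k < n" for n j k
    using hi.L_mono[of "n - 1 - k" "n - 1 - j" n] that by simp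
  have "(\<lambda>n. - eigs (X n) ! 0) \<longlonglongrightarrow> - supp_lo \<mu>"
    using H by (intro tendsto_minus) (simp add: hypothesis_H1_def)
  then show "(\<lambda>n. - eigs (X n) ! (n - 1 - (n - 1))) \<longlonglongrightarrow> - supp_lo \<mu>" by simp
  fix f :: "real \<Rightarrow> real" assume f: "continuous_on UNIV f" "bounded (range f)"
  have "continuous_on UNIV (\<lambda>x. f (- x))"
    by (intro continuous_on_compose2[OF f(1)] continuous_intros) auto
  moreover have "bounded (range (\<lambda>x. f (- x)))" by (rule bounded_subset[OF f(2)]) auto
  ultimately have "(\<lambda>n. (1 / real n) * (\<Sum>l<n. f (- eigs (X n) ! l))) \<longlonglongrightarrow> (\<integral>x. f (- x) \<partial>\<mu>)"
    by (rule hi.weak)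
  moreover have "(\<Sum>l<n. f (- eigs (X n) ! l)) = (\<Sum>l<n. f (- eigs (X n) ! (n - 1 - l)))" for n
    by (rule sum.reindex_bij_witness[of _ "\<lambda>k. n - 1 - k" "\<lambda>k. n - 1 - k"]) auto
  moreover have "(\<integral>x. f x \<partial>reflect \<mu>) = (\<integral>x. f (- x) \<partial>\<mu>)"
    unfolding reflect_def
    by (rule integral_distr) (auto simp: measurable_cong_sets[OF \<mu>(2) refl] intro: borel_measurable_continuous_onI f)
  ultimately show "(\<lambda>n. (1 / real n) * (\<Sum>l<n. f (- eigs (X n) ! (n - 1 - l)))) \<longlonglongrightarrow> (\<integral>x. f x \<partial>reflect \<mu>)"
    by simp
qed

section \<open>From the logarithmic Sobolev inequality to sub-Gaussian tails\<close>

lemma exp_taylor2: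
  fixes y M :: real
  assumes "\<bar>y\<bar> \<le> M"
  shows "\<bar>exp y - 1 - y\<bar> \<le> y\<^sup>2 * exp M"
proof -
  obtain t where t: "\<bar>t\<bar> \<le> \<bar>y\<bar>" "exp y = (\<Sum>m<2. y ^ m / fact m) + exp t / fact 2 * y ^ 2"
    using Maclaurin_exp_le[of y 2] by auto
  have "(\<Sum>m<2. y ^ m / fact m) = 1 + y" by (simp add: numeral_2_eq_2)
  then have eq: "exp y - 1 - y = exp t / 2 * y\<^sup>2" using t(2) by (simp add: fact_2)
  have "\<bar>exp y - 1 - y\<bar> = y\<^sup>2 * (exp t / 2)" unfolding eq by (simp add: abs_mult)
  also have "\<dots> \<le> y\<^sup>2 * exp M"
  proof (rule mult_left_mono)
    have "t \<le> M" using t(1) assms by linarith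
    then have "exp t \<le> exp M" by simp
    then show "exp t / 2 \<le> exp M" using exp_gt_zero[of t] by linarith
  qed simp
  finally show ?thesis .
qed

section \<open>Laplace transforms of bounded functions and Herbst's argument\<close>

context
  fixes \<nu> :: "'a measure" and h :: "'a \<Rightarrow> real" and B :: real
  assumes prob: "prob_space \<nu>" and hm [measurable]: "h \<in> borel_measurable \<nu>" and hB: "\<And>x. \<bar>h x\<bar> \<le> B"
begin

interpretation prob_space \<nu> by (rule prob)

lemma integrable_bounded_fun:
  assumes "f \<in> borel_measurable \<nu>" "\<And>x. \<bar>f x\<bar> \<le> C"
  shows "integrable \<nu> (f :: 'a \<Rightarrow> real)"
  by (rule integrable_const_bound[where B = C]) (use assms in auto)

lemma bound_nonneg: "0 \<le> B"
  using hB[of undefined] by linarith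

lemma exp_bounded_le: "exp (t * h x) \<le> exp (\<bar>t\<bar> * B)"
proof -
  have "t * h x \<le> \<bar>t\<bar> * \<bar>h x\<bar>" by (simp add: abs_mult[symmetric])
  also have "\<dots> \<le> \<bar>t\<bar> * B" by (intro mult_left_mono hB) simp
  finally show ?thesis by simp
qed

lemma integrable_exp_bounded: "integrable \<nu> (\<lambda>x. exp (t * h x))"
  by (rule integrable_bounded_fun[where C = "exp (\<bar>t\<bar> * B)"]) (use exp_bounded_le in auto)

lemma integrable_mult_exp_bounded: "integrable \<nu> (\<lambda>x. h x * exp (t * h x))"
  by (rule integrable_bounded_fun[where C = "B * exp (\<bar>t\<bar> * B)"])
     (simp, unfold abs_mult abs_exp_cancel, intro mult_mono exp_bounded_le hB bound_nonneg, simp)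

text \<open>Boundedness of \<open>h\<close> makes the second-order Taylor remainder uniform over the
  space, so the difference quotient passes under the integral.\<close>

lemma has_real_derivative_mgf:
  "((\<lambda>t. \<integral>x. exp (t * h x) \<partial>\<nu>) has_real_derivative (\<integral>x. h x * exp (t * h x) \<partial>\<nu>)) (at t)"
proof -
  let ?H = "\<lambda>t. \<integral>x. exp (t * h x) \<partial>\<nu>" and ?H' = "\<integral>x. h x * exp (t * h x) \<partial>\<nu>"
  define C where "C = exp (\<bar>t\<bar> * B) * (B\<^sup>2 * exp B)"
  have C0: "0 \<le> C" by (simp add: C_def)
  have bound: "\<bar>?H (t + d) - ?H t - d * ?H'\<bar> \<le> C * d\<^sup>2" if d: "\<bar>d\<bar> \<le> 1" for d
  proof -
    have "?H (t + d) - ?H t - d * ?H' = (\<integral>x. exp ((t + d) * h x) - exp (t * h x) - d * (h x * exp (t * h x)) \<partial>\<nu>)"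
      by (simp add: integrable_exp_bounded integrable_mult_exp_bounded)
    moreover have "norm (\<integral>x. exp ((t + d) * h x) - exp (t * h x) - d * (h x * exp (t * h x)) \<partial>\<nu>) \<le> (\<integral>x. C * d\<^sup>2 \<partial>\<nu>)"
    proof (rule order_trans[OF Bochner_Integration.integral_norm_bound integral_mono[OF integrable_norm]])
      show "integrable \<nu> (\<lambda>x. exp ((t + d) * h x) - exp (t * h x) - d * (h x * exp (t * h x)))"
        by (intro Bochner_Integration.integrable_diff integrable_exp_bounded integrable_mult_right integrable_mult_exp_bounded)
      fix x
      have le: "\<bar>d * h x\<bar> \<le> B"
        using mult_mono[OF d hB[of x]] by (simp add: abs_mult)
      have sq: "(d * h x)\<^sup>2 \<le> d\<^sup>2 * B\<^sup>2"
        unfolding power_mult_distrib using hB[of x] bound_nonneg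
        by (intro mult_left_mono) (auto intro: abs_le_square_iff[THEN iffD1])
      have eq: "exp ((t + d) * h x) - exp (t * h x) - d * (h x * exp (t * h x))
          = exp (t * h x) * (exp (d * h x) - 1 - d * h x)"
        by (simp add: algebra_simps exp_add)
      have "norm (exp (t * h x) * (exp (d * h x) - 1 - d * h x)) \<le> exp (\<bar>t\<bar> * B) * ((d * h x)\<^sup>2 * exp B)"
        unfolding norm_mult by (intro mult_mono) (use exp_bounded_le[of t x] exp_taylor2[OF le] in auto)
      also have "\<dots> \<le> exp (\<bar>t\<bar> * B) * ((d\<^sup>2 * B\<^sup>2) * exp B)"
        by (intro mult_left_mono mult_right_mono sq) auto
      finally show "norm (exp ((t + d) * h x) - exp (t * h x) - d * (h x * exp (t * h x))) \<le> C * d\<^sup>2"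
        unfolding eq by (simp add: C_def mult_ac)
    qed simp
    ultimately show ?thesis by (simp add: prob_space)
  qed
  have "((\<lambda>d. (?H (t + d) - ?H t) / d) \<longlongrightarrow> ?H') (at 0)"
  proof (rule Lim_null[THEN iffD2], rule Lim_null_comparison)
    have "eventually (\<lambda>d::real. \<bar>d\<bar> < 1 \<and> d \<noteq> 0) (at 0)"
      unfolding eventually_at by (intro exI[of _ 1]) (auto simp: dist_real_def)
    then show "eventually (\<lambda>d. norm ((?H (t + d) - ?H t) / d - ?H') \<le> C * \<bar>d\<bar>) (at 0)"
    proof eventually_elim
      case (elim d)
      have "(?H (t + d) - ?H t) / d - ?H' = (?H (t + d) - ?H t - d * ?H') / d"
        using elim by (simp add: field_simps)
      then have "norm ((?H (t + d) - ?H t) / d - ?H') = \<bar>?H (t + d) - ?H t - d * ?H'\<bar> / \<bar>d\<bar>"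
        by simp
      also have "\<dots> \<le> (C * d\<^sup>2) / \<bar>d\<bar>" by (rule divide_right_mono[OF bound]) (use elim in auto)
      also have "\<dots> = C * \<bar>d\<bar>"
      proof -
        have "C * d\<^sup>2 = (C * \<bar>d\<bar>) * \<bar>d\<bar>" by (simp add: power2_eq_square)
        moreover have "\<bar>d\<bar> \<noteq> 0" using elim by simp
        ultimately show ?thesis by (metis nonzero_mult_div_cancel_right)
      qed
      finally show ?case .
    qed
    show "((\<lambda>d::real. C * \<bar>d\<bar>) \<longlongrightarrow> 0) (at 0)" by (auto intro!: tendsto_eq_intros)
  qed
  then show ?thesis by (simp add: DERIV_def)
qed

lemma mgf_pos: "0 < (\<integral>x. exp (t * h x) \<partial>\<nu>)"
proof -
  have "(\<integral>x. exp (- (\<bar>t\<bar> * B)) \<partial>\<nu>) \<le> (\<integral>x. exp (t * h x) \<partial>\<nu>)"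
  proof (rule integral_mono[OF _ integrable_exp_bounded])
    show "exp (- (\<bar>t\<bar> * B)) \<le> exp (t * h x)" for x
      using exp_bounded_le[of "- t" x] by simp
  qed simp
  moreover have "(\<integral>x. exp (- (\<bar>t\<bar> * B)) \<partial>\<nu>) = exp (- (\<bar>t\<bar> * B))" by (simp add: prob_space)
  ultimately show ?thesis using exp_gt_zero[of "- (\<bar>t\<bar> * B)"] by linarith
qed

text \<open>Herbst's argument: the entropy bound says that \<open>ln H(t) / t - c t / 2\<close> is nonincreasing.\<close>
lemma herbst:
  assumes ent: "\<And>t. 0 < t \<Longrightarrow> t * (\<integral>x. h x * exp (t * h x) \<partial>\<nu>)
      - (\<integral>x. exp (t * h x) \<partial>\<nu>) * ln (\<integral>x. exp (t * h x) \<partial>\<nu>) \<le> c * t\<^sup>2 / 2 * (\<integral>x. exp (t * h x) \<partial>\<nu>)"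
    and lam: "0 \<le> l"
  shows "(\<integral>x. exp (l * h x) \<partial>\<nu>) \<le> exp (l * (\<integral>x. h x \<partial>\<nu>) + c * l\<^sup>2 / 2)"
proof (cases "l = 0")
  case True
  then show ?thesis by (simp add: prob_space)
next
  case False
  then have l: "0 < l" using lam by simp
  define H where "H t = (\<integral>x. exp (t * h x) \<partial>\<nu>)" for t
  define H' where "H' t = (\<integral>x. h x * exp (t * h x) \<partial>\<nu>)" for t
  have dH: "(H has_real_derivative H' t) (at t)" for t
    unfolding H_def[abs_def] H'_def by (rule has_real_derivative_mgf)
  have Hp: "0 < H t" for t unfolding H_def by (rule mgf_pos)
  define \<phi> where "\<phi> t = ln (H t) / t - c * t / 2" for t
  have d\<phi>: "(\<phi> has_real_derivative ((H' t / H t) * t - ln (H t)) / (t * t) - c / 2) (at t)" if "0 < t" for t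
    unfolding \<phi>_def[abs_def] using that Hp[of t]
    by (auto intro!: derivative_eq_intros dH simp: field_simps)
  have le0: "((H' t / H t) * t - ln (H t)) / (t * t) - c / 2 \<le> 0" if "0 < t" for t
  proof -
    have "t * H' t - H t * ln (H t) \<le> c * t\<^sup>2 / 2 * H t"
      using ent[OF that] by (simp add: H_def H'_def)
    then have "(t * H' t - H t * ln (H t)) / H t \<le> c * t\<^sup>2 / 2"
      using Hp[of t] by (simp add: pos_divide_le_eq)
    moreover have "(t * H' t - H t * ln (H t)) / H t = (H' t / H t) * t - ln (H t)"
      using Hp[of t] by (simp add: field_simps)
    ultimately have "((H' t / H t) * t - ln (H t)) / (t * t) \<le> c / 2"
      using that by (simp add: pos_divide_le_eq power2_eq_square mult_ac)
    then show ?thesis by simp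
  qed
  have mono: "\<phi> l \<le> \<phi> t" if "0 < t" "t \<le> l" for t
    by (rule DERIV_nonpos_imp_nonincreasing[OF that(2)]) (use d\<phi> le0 that in \<open>meson less_le_trans\<close>)
  have H0: "H 0 = 1" "H' 0 = (\<integral>x. h x \<partial>\<nu>)" by (simp_all add: H_def H'_def prob_space)
  \<comment> \<open>The quotient \<open>ln (H t) / t\<close> tends to the derivative of
    \<open>ln H\<close> at 0, which is the mean of \<open>h\<close>.\<close>
  have "((\<lambda>t. ln (H t)) has_real_derivative (\<integral>x. h x \<partial>\<nu>)) (at 0)"
    using H0 by (auto intro!: derivative_eq_intros dH)
  then have "((\<lambda>t. ln (H t) / t) \<longlongrightarrow> (\<integral>x. h x \<partial>\<nu>)) (at 0)"
    by (simp add: DERIV_def H0)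
  then have "((\<lambda>t. ln (H t) / t) \<longlongrightarrow> (\<integral>x. h x \<partial>\<nu>)) (at_right 0)"
    by (rule tendsto_mono[OF at_le[OF subset_UNIV]])
  then have "(\<phi> \<longlongrightarrow> (\<integral>x. h x \<partial>\<nu>) - c * 0 / 2) (at_right 0)"
    unfolding \<phi>_def[abs_def] by (intro tendsto_diff) (auto intro!: tendsto_eq_intros)
  then have lim: "(\<phi> \<longlongrightarrow> (\<integral>x. h x \<partial>\<nu>)) (at_right 0)" by simp
  have "\<phi> l \<le> (\<integral>x. h x \<partial>\<nu>)"
  proof (rule tendsto_lowerbound[OF lim _ trivial_limit_at_right_real])
    show "eventually (\<lambda>t. \<phi> l \<le> \<phi> t) (at_right 0)"
      using eventually_at_right_real[OF l] by eventually_elim (use mono in auto)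
  qed
  then have "ln (H l) / l \<le> (\<integral>x. h x \<partial>\<nu>) + c * l / 2" by (simp add: \<phi>_def)
  then have "ln (H l) \<le> ((\<integral>x. h x \<partial>\<nu>) + c * l / 2) * l"
    using l by (simp add: pos_divide_le_eq)
  then have "ln (H l) \<le> l * (\<integral>x. h x \<partial>\<nu>) + c * l\<^sup>2 / 2"
    by (simp add: power2_eq_square algebra_simps)
  then have "H l \<le> exp (l * (\<integral>x. h x \<partial>\<nu>) + c * l\<^sup>2 / 2)"
    using Hp[of l] by (metis exp_le_cancel_iff exp_ln)
  then show ?thesis by (simp only: H_def)
qed

end

lemma abs_arctan_le: "\<bar>arctan y\<bar> \<le> \<bar>y\<bar>"
proof -
  have "norm (arctan y - arctan 0) \<le> 1 * norm (y - 0)"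
    by (rule field_differentiable_bound[where S = UNIV and f' = "\<lambda>x. inverse (1 + x\<^sup>2)"])
       (auto intro!: DERIV_arctan[THEN has_field_derivative_at_within] simp: inverse_le_1_iff)
  then show ?thesis by simp
qed

text \<open>n arctan(x/n) is a bounded, smooth, 1-Lipschitz truncation of x. Such a truncation is
  called for because \<open>log_sobolev\<close> speaks only of bounded functions with bounded
  gradient.\<close>

lemma tendsto_mult_arctan:
  fixes x :: real
  shows "(\<lambda>n. real (Suc n) * arctan (x / real (Suc n))) \<longlonglongrightarrow> x"
proof -
  have "((\<lambda>h. arctan (h * x)) has_real_derivative x) (at 0)"
    by (auto intro!: derivative_eq_intros)
  then have "((\<lambda>h. arctan (h * x) / h) \<longlongrightarrow> x) (at 0)" by (simp add: DERIV_def)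
  moreover have "filterlim (\<lambda>n. inverse (real (Suc n))) (at 0) sequentially"
    unfolding filterlim_at using LIMSEQ_inverse_real_of_nat by auto
  ultimately have "(\<lambda>n. arctan (inverse (real (Suc n)) * x) / inverse (real (Suc n))) \<longlonglongrightarrow> x"
    by (rule filterlim_compose)
  then show ?thesis by (simp add: divide_inverse mult.commute)
qed

text \<open>Herbst's argument is applied to truncations of the real linear functional z -> Re(cnj t
  z)/|t|, whose gradient has norm 1. The means of the truncations tend to 0 by dominated
  convergence, and Fatou's lemma removes the truncation from the exponential moment.\<close>

lemma log_sobolev_subgaussian:
  assumes prob: "prob_space \<nu>" and sets: "sets \<nu> = sets borel" and LS: "log_sobolev \<nu>"
    and int: "integrable \<nu> (\<lambda>z. z)" and mean: "(\<integral>z. z \<partial>\<nu>) = 0"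
  shows "\<exists>c>0. \<forall>t::complex. (\<integral>\<^sup>+z. ennreal (exp (Re (cnj t * z))) \<partial>\<nu>) \<le> ennreal (exp (c * (cmod t)\<^sup>2 / 2))"
proof -
  interpret prob_space \<nu> by fact
  obtain c where c: "c > 0" and LSI: "\<And>(f :: complex \<Rightarrow> real) Df.
      (\<forall>z. (f has_derivative Df z) (at z)) \<Longrightarrow>
      continuous_on UNIV (\<lambda>z. Df z 1) \<Longrightarrow> continuous_on UNIV (\<lambda>z. Df z \<i>) \<Longrightarrow>
      bounded (range f) \<Longrightarrow> bounded (range (\<lambda>z. Df z 1)) \<Longrightarrow> bounded (range (\<lambda>z. Df z \<i>)) \<Longrightarrow>
      (\<integral>z. (f z)\<^sup>2 * ln ((f z)\<^sup>2) \<partial>\<nu>) - (\<integral>z. (f z)\<^sup>2 \<partial>\<nu>) * ln (\<integral>z. (f z)\<^sup>2 \<partial>\<nu>)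
        \<le> 2 * c * (\<integral>z. (Df z 1)\<^sup>2 + (Df z \<i>)\<^sup>2 \<partial>\<nu>)"
    using LS unfolding log_sobolev_def by blast
  have "(\<integral>\<^sup>+z. ennreal (exp (Re (cnj t * z))) \<partial>\<nu>) \<le> ennreal (exp (c * (cmod t)\<^sup>2 / 2))" for t :: complex
  proof (cases "t = 0")
    case True
    then show ?thesis by (simp add: emeasure_space_1)
  next
    case False
    define l where "l = cmod t"
    define p q where "p = Re t / l" and "q = Im t / l"
    have l: "0 < l" using False by (simp add: l_def)
    have pq: "p\<^sup>2 + q\<^sup>2 = 1"
    proof -
      have "p\<^sup>2 + q\<^sup>2 = ((Re t)\<^sup>2 + (Im t)\<^sup>2) / l\<^sup>2"
        by (simp add: p_def q_def power_divide add_divide_distrib)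
      also have "(Re t)\<^sup>2 + (Im t)\<^sup>2 = l\<^sup>2" by (simp add: l_def cmod_power2)
      finally show ?thesis using l by simp
    qed
    define L where "L z = p * Re z + q * Im z" for z
    have tz: "Re (cnj t * z) = l * L z" for z
      using l by (simp add: L_def p_def q_def field_simps)
    define h where "h n z = real (Suc n) * arctan (L z / real (Suc n))" for n z
    have Lm [measurable]: "L \<in> borel_measurable borel" unfolding L_def[abs_def] by measurable
    have hm: "h n \<in> borel_measurable \<nu>" for n
      unfolding h_def[abs_def] measurable_cong_sets[OF sets refl] by measurable
    have hb: "\<bar>h n z\<bar> \<le> real (Suc n) * pi" for n z
    proof -
      have "\<bar>arctan (L z / real (Suc n))\<bar> \<le> pi"
        using arctan_bounded[of "L z / real (Suc n)"] pi_gt_zero by linarith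
      then show ?thesis unfolding h_def abs_mult by (intro mult_mono) auto
    qed
    have hL: "\<bar>h n z\<bar> \<le> \<bar>L z\<bar>" for n z
    proof -
      have "\<bar>h n z\<bar> = real (Suc n) * \<bar>arctan (L z / real (Suc n))\<bar>" by (simp add: h_def abs_mult)
      also have "\<dots> \<le> real (Suc n) * \<bar>L z / real (Suc n)\<bar>" by (intro mult_left_mono abs_arctan_le) simp
      also have "\<dots> = \<bar>L z\<bar>" by (simp add: abs_divide)
      finally show ?thesis .
    qed
    define w where "w n z = inverse (1 + (L z / real (Suc n))\<^sup>2)" for n z
    have w01: "0 \<le> w n z" "w n z \<le> 1" for n z
      unfolding w_def by (simp_all add: inverse_le_1_iff)
    have wc: "continuous_on UNIV (w n)" for n
    proof -
      have "1 + (L z / real (Suc n))\<^sup>2 \<noteq> 0" for z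
        using zero_le_power2[of "L z / real (Suc n)"] by linarith
      then show ?thesis unfolding w_def[abs_def] L_def by (intro continuous_intros) (auto simp: L_def)
    qed
    have mgf: "(\<integral>z. exp (l * h n z) \<partial>\<nu>) \<le> exp (l * (\<integral>z. h n z \<partial>\<nu>) + c * l\<^sup>2 / 2)" for n
    proof (rule herbst[OF prob hm hb])
      fix s :: real assume s: "0 < s"
      \<comment> \<open>The square of \<open>f\<close> is exp(s h), so the inequality for
        \<open>f\<close> is an entropy bound for exp(s h), which is the hypothesis of
        \<open>herbst\<close>.\<close>
      define f where "f z = exp (s / 2 * h n z)" for z
      define Df where "Df z v = f z * (s / 2) * (w n z * L v)" for z v
      have f2: "(f z)\<^sup>2 = exp (s * h n z)" for z
        by (simp add: f_def power2_eq_square mult_exp_exp)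
      have Lc: "continuous_on UNIV L" unfolding L_def[abs_def] by (intro continuous_intros)
      have fc: "continuous_on UNIV f"
        unfolding f_def[abs_def] h_def by (intro continuous_intros Lc) auto
      have fb: "\<bar>f z\<bar> \<le> exp (\<bar>s / 2\<bar> * (real (Suc n) * pi))" for z
        using exp_bounded_le[OF prob hm hb, of "s / 2" n z] by (simp add: f_def)
      have wL: "\<bar>w n z * a\<bar> \<le> \<bar>a\<bar>" for z a using w01[of n z] by (simp add: abs_mult mult_left_le_one_le)
      have Dc: "continuous_on UNIV (\<lambda>z. Df z v)" for v
        unfolding Df_def by (intro continuous_intros fc wc)
      have Db: "bounded (range (\<lambda>z. Df z v))" for v
      proof -
        have "\<bar>Df z v\<bar> \<le> exp (\<bar>s / 2\<bar> * (real (Suc n) * pi)) * \<bar>s / 2\<bar> * \<bar>L v\<bar>" for z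
          unfolding Df_def abs_mult[of _ "w n z * L v"] abs_mult[of "f z"]
          by (intro mult_mono fb wL) auto
        then show ?thesis
          unfolding bounded_iff by (intro exI ballI) (elim rangeE, simp only: real_norm_def)
      qed
      have fb': "bounded (range f)" using fb by (auto simp: bounded_iff)
      have D: "(f has_derivative Df z) (at z)" for z
      proof -
        have dL: "(L has_derivative L) (at z)"
          unfolding L_def[abs_def] by (auto intro!: derivative_eq_intros)
        have "((\<lambda>x. exp (s / 2 * (real (Suc n) * arctan (x / real (Suc n))))) has_real_derivative
            exp (s / 2 * (real (Suc n) * arctan (L z / real (Suc n)))) * (s / 2 * w n z)) (at (L z))"
          unfolding w_def
          by (rule derivative_eq_intros refl | simp)+
        then have "((\<lambda>x. exp (s / 2 * (real (Suc n) * arctan (x / real (Suc n))))) has_derivative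
            (\<lambda>y. exp (s / 2 * (real (Suc n) * arctan (L z / real (Suc n)))) * (s / 2 * w n z) * y)) (at (L z))"
          unfolding has_field_derivative_def .
        from has_derivative_compose[OF dL this] show ?thesis
          unfolding f_def[abs_def] h_def Df_def by (simp add: mult_ac)
      qed
      have "(\<integral>z. (f z)\<^sup>2 * ln ((f z)\<^sup>2) \<partial>\<nu>) - (\<integral>z. (f z)\<^sup>2 \<partial>\<nu>) * ln (\<integral>z. (f z)\<^sup>2 \<partial>\<nu>)
        \<le> 2 * c * (\<integral>z. (Df z 1)\<^sup>2 + (Df z \<i>)\<^sup>2 \<partial>\<nu>)"
        by (rule LSI) (use D Dc Db fb' in auto)
      \<comment> \<open>The gradient of the truncated functional has norm \<open>w n z\<close>,
        because p^2 + q^2 = 1, and \<open>w\<close> is at most 1; the chain rule contributes (s/2)^2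
        exp(s h).\<close>
      also have "(\<integral>z. (Df z 1)\<^sup>2 + (Df z \<i>)\<^sup>2 \<partial>\<nu>) \<le> (\<integral>z. (s / 2)\<^sup>2 * exp (s * h n z) \<partial>\<nu>)"
      proof (rule integral_mono)
        have eq: "(Df z 1)\<^sup>2 + (Df z \<i>)\<^sup>2 = (s / 2)\<^sup>2 * exp (s * h n z) * (w n z)\<^sup>2" for z
        proof -
          have "(Df z 1)\<^sup>2 + (Df z \<i>)\<^sup>2 = (f z)\<^sup>2 * (s / 2)\<^sup>2 * (w n z)\<^sup>2 * (p\<^sup>2 + q\<^sup>2)"
            by (simp add: Df_def L_def power_mult_distrib power_divide) (simp add: algebra_simps)
          then show ?thesis by (simp add: pq f2 mult_ac)
        qed
        show le: "(Df z 1)\<^sup>2 + (Df z \<i>)\<^sup>2 \<le> (s / 2)\<^sup>2 * exp (s * h n z)" for z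
          unfolding eq using w01[of n z] by (intro mult_right_le_one_le) (auto simp: power_le_one)
        show i2: "integrable \<nu> (\<lambda>z. (s / 2)\<^sup>2 * exp (s * h n z))"
          by (intro integrable_mult_right integrable_exp_bounded[OF prob hm hb])
        have "(\<lambda>z. (Df z 1)\<^sup>2 + (Df z \<i>)\<^sup>2) \<in> borel_measurable \<nu>"
          unfolding measurable_cong_sets[OF sets refl]
          by (intro borel_measurable_continuous_onI continuous_intros Dc)
        then show "integrable \<nu> (\<lambda>z. (Df z 1)\<^sup>2 + (Df z \<i>)\<^sup>2)"
          by (rule Bochner_Integration.integrable_bound[OF i2]) (use le in auto)
      qed
      finally show "s * (\<integral>z. h n z * exp (s * h n z) \<partial>\<nu>)
          - (\<integral>z. exp (s * h n z) \<partial>\<nu>) * ln (\<integral>z. exp (s * h n z) \<partial>\<nu>) \<le> c * s\<^sup>2 / 2 * (\<integral>z. exp (s * h n z) \<partial>\<nu>)"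
        using c by (simp add: f2 mult_ac power_divide)
    qed (use l in simp)
    have intL: "integrable \<nu> L"
      unfolding L_def[abs_def] using int by (intro Bochner_Integration.integrable_add integrable_mult_right) auto
    have L0: "(\<integral>z. L z \<partial>\<nu>) = 0"
      unfolding L_def[abs_def] using int mean by (subst Bochner_Integration.integral_add) (auto simp: integrable_Re integrable_Im)
    have "(\<lambda>n. \<integral>z. h n z \<partial>\<nu>) \<longlonglongrightarrow> (\<integral>z. L z \<partial>\<nu>)"
    proof (rule integral_dominated_convergence[where w = "\<lambda>z. \<bar>L z\<bar>"])
      show "L \<in> borel_measurable \<nu>" using intL by simp
      show "integrable \<nu> (\<lambda>z. \<bar>L z\<bar>)" using intL by simp
      show "AE z in \<nu>. (\<lambda>n. h n z) \<longlonglongrightarrow> L z" unfolding h_def by (simp only: tendsto_mult_arctan) simp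
    qed (use hm hL in auto)
    then have lim: "(\<lambda>n. ennreal (exp (l * (\<integral>z. h n z \<partial>\<nu>) + c * l\<^sup>2 / 2))) \<longlonglongrightarrow> ennreal (exp (l * 0 + c * l\<^sup>2 / 2))"
      unfolding L0 by (intro tendsto_ennrealI tendsto_intros)
    \<comment> \<open>Fatou's lemma is used because no integrable majorant of the untruncated
      exponential is known at this point.\<close>
    have "(\<integral>\<^sup>+z. ennreal (exp (l * L z)) \<partial>\<nu>) = (\<integral>\<^sup>+z. liminf (\<lambda>n. ennreal (exp (l * h n z))) \<partial>\<nu>)"
    proof (intro nn_integral_cong)
      fix z
      have "(\<lambda>n. ennreal (exp (l * h n z))) \<longlonglongrightarrow> ennreal (exp (l * L z))"
        unfolding h_def by (intro tendsto_ennrealI tendsto_intros tendsto_mult_arctan)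
      then show "ennreal (exp (l * L z)) = liminf (\<lambda>n. ennreal (exp (l * h n z)))"
        by (intro lim_imp_Liminf[symmetric]) auto
    qed
    also have "\<dots> \<le> liminf (\<lambda>n. \<integral>\<^sup>+z. ennreal (exp (l * h n z)) \<partial>\<nu>)"
      by (rule nn_integral_liminf) (use hm in measurable)
    also have "\<dots> \<le> liminf (\<lambda>n. ennreal (exp (l * (\<integral>z. h n z \<partial>\<nu>) + c * l\<^sup>2 / 2)))"
    proof (intro Liminf_mono always_eventually allI)
      fix n
      have "(\<integral>\<^sup>+z. ennreal (exp (l * h n z)) \<partial>\<nu>) = ennreal (\<integral>z. exp (l * h n z) \<partial>\<nu>)"
        by (intro nn_integral_eq_integral integrable_exp_bounded[OF prob hm hb]) auto
      also have "\<dots> \<le> ennreal (exp (l * (\<integral>z. h n z \<partial>\<nu>) + c * l\<^sup>2 / 2))" by (intro ennreal_leI mgf)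
      finally show "(\<integral>\<^sup>+z. ennreal (exp (l * h n z)) \<partial>\<nu>) \<le> ennreal (exp (l * (\<integral>z. h n z \<partial>\<nu>) + c * l\<^sup>2 / 2))" .
    qed
    also have "\<dots> = ennreal (exp (l * 0 + c * l\<^sup>2 / 2))" by (rule lim_imp_Liminf[OF _ lim]) simp
    finally show ?thesis unfolding tz by (simp add: l_def)
  qed
  then show ?thesis using c by blast
qed

text \<open>For every z, |Re z| + |Im z| equals Re(cnj t z) for one of the four corners t with
  coordinates 1 or -1. Summing over the corners gives the factor 4, and |t|^2 = 2 turns c/2 into
  c.\<close>

lemma nn_integral_exp_norm_le:
  assumes sets: "sets \<nu> = sets borel"
    and SG: "\<And>t::complex. (\<integral>\<^sup>+z. ennreal (exp (Re (cnj t * z))) \<partial>\<nu>) \<le> ennreal (exp (c * (cmod t)\<^sup>2 / 2))"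
    and l: "0 \<le> l"
  shows "(\<integral>\<^sup>+z. ennreal (exp (l * cmod z)) \<partial>\<nu>) \<le> ennreal (4 * exp (c * l\<^sup>2))"
proof -
  have pt: "ennreal (exp (l * cmod z)) \<le> (\<Sum>t\<in>{Complex 1 1, Complex 1 (-1), Complex (-1) 1, Complex (-1) (-1)}. ennreal (exp (Re (cnj (of_real l * t) * z))))" for z
  proof -
    let ?t = "Complex (if 0 \<le> Re z then 1 else - 1) (if 0 \<le> Im z then 1 else - 1)"
    have "l * cmod z \<le> l * (\<bar>Re z\<bar> + \<bar>Im z\<bar>)" by (intro mult_left_mono cmod_le l)
    also have "\<dots> = Re (cnj (of_real l * ?t) * z)" by (simp add: algebra_simps abs_if)
    finally have "ennreal (exp (l * cmod z)) \<le> ennreal (exp (Re (cnj (of_real l * ?t) * z)))"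
      by (intro ennreal_leI) simp
    also have "\<dots> \<le> (\<Sum>t\<in>{Complex 1 1, Complex 1 (-1), Complex (-1) 1, Complex (-1) (-1)}. ennreal (exp (Re (cnj (of_real l * t) * z))))"
      by (rule member_le_sum[where f = "\<lambda>t. ennreal (exp (Re (cnj (of_real l * t) * z)))"]) auto
    finally show ?thesis .
  qed
  have "(\<integral>\<^sup>+z. ennreal (exp (l * cmod z)) \<partial>\<nu>)
    \<le> (\<integral>\<^sup>+z. (\<Sum>t\<in>{Complex 1 1, Complex 1 (-1), Complex (-1) 1, Complex (-1) (-1)}. ennreal (exp (Re (cnj (of_real l * t) * z)))) \<partial>\<nu>)"
    by (intro nn_integral_mono pt)
  also have "\<dots> = (\<Sum>t\<in>{Complex 1 1, Complex 1 (-1), Complex (-1) 1, Complex (-1) (-1)}. \<integral>\<^sup>+z. ennreal (exp (Re (cnj (of_real l * t) * z))) \<partial>\<nu>)"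
    by (rule nn_integral_sum) (unfold measurable_cong_sets[OF sets refl], measurable)
  also have "\<dots> \<le> (\<Sum>t\<in>{Complex 1 1, Complex 1 (-1), Complex (-1) 1, Complex (-1) (-1)}. ennreal (exp (c * l\<^sup>2)))"
  proof (rule sum_mono)
    fix t assume "t \<in> {Complex 1 1, Complex 1 (-1), Complex (-1) 1, Complex (-1) (-1)}"
    then have "(cmod t)\<^sup>2 = 2" by (auto simp: cmod_power2)
    then have "c * (cmod (of_real l * t))\<^sup>2 / 2 = c * l\<^sup>2" by (simp add: norm_mult power_mult_distrib)
    then show "(\<integral>\<^sup>+z. ennreal (exp (Re (cnj (of_real l * t) * z))) \<partial>\<nu>) \<le> ennreal (exp (c * l\<^sup>2))"
      using SG[of "of_real l * t"] by (simp only:)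
  qed
  also have "\<dots> = ennreal (4 * exp (c * l\<^sup>2))"
  proof -
    have "(\<Sum>t\<in>{Complex 1 1, Complex 1 (-1), Complex (-1) 1, Complex (-1) (-1)}. ennreal (exp (c * l\<^sup>2)))
      = ennreal (\<Sum>t\<in>{Complex 1 1, Complex 1 (-1), Complex (-1) 1, Complex (-1) (-1)}. exp (c * l\<^sup>2))"
      by (rule sum_ennreal) simp
    then show ?thesis by (simp add: complex_eq_iff)
  qed
  finally show ?thesis .
qed

text \<open>On \<open>m \<le> \<bar>z\<bar> < m + 1\<close> the Gaussian weight is compared with an exponential one of slope
  proportional to \<open>m\<close>.\<close>
lemma exp_square_integrable:
  assumes sets: "sets \<nu> = sets borel" and c: "0 < c"
    and SG: "\<And>t::complex. (\<integral>\<^sup>+z. ennreal (exp (Re (cnj t * z))) \<partial>\<nu>) \<le> ennreal (exp (c * (cmod t)\<^sup>2 / 2))"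
  shows "\<exists>s>0. \<exists>D\<ge>0. (\<integral>\<^sup>+z. ennreal (exp (s * (cmod z)\<^sup>2)) \<partial>\<nu>) \<le> ennreal D"
proof -
  \<comment> \<open>With these choices the exponent on slab m is s (m+1)^2 - 8 s m^2 + 4 s m^2,
    which is at most 2 s - 2 s m; the series is thus dominated by a geometric one.\<close>
  define s where "s = 1 / (16 * c)"
  define l where "l = 1 / (2 * c)"
  have s: "0 < s" and l: "0 < l" using c by (simp_all add: s_def l_def)
  define g where "g m z = exp (s * (real m + 1)\<^sup>2 - l * (real m)\<^sup>2) * exp (l * real m * cmod z)" for m :: nat and z :: complex
  have pt: "ennreal (exp (s * (cmod z)\<^sup>2)) \<le> (\<Sum>m. ennreal (g m z))" for z
  proof -
    define m where "m = nat \<lfloor>cmod z\<rfloor>"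
    have m: "real m \<le> cmod z" "cmod z \<le> real m + 1" unfolding m_def by (simp_all add: of_nat_nat)
    have "s * (cmod z)\<^sup>2 \<le> s * (real m + 1)\<^sup>2" using s m by (intro mult_left_mono power_mono) auto
    moreover have "l * real m * real m \<le> l * real m * cmod z" using l m by (intro mult_left_mono) auto
    ultimately have "s * (cmod z)\<^sup>2 \<le> s * (real m + 1)\<^sup>2 - l * (real m)\<^sup>2 + l * real m * cmod z"
      by (simp add: power2_eq_square)
    then have "exp (s * (cmod z)\<^sup>2) \<le> g m z" unfolding g_def mult_exp_exp by simp
    then have "ennreal (exp (s * (cmod z)\<^sup>2)) \<le> ennreal (g m z)" by (rule ennreal_leI)
    also have "\<dots> \<le> (\<Sum>m. ennreal (g m z))"
      using sum_le_suminf[of "\<lambda>m. ennreal (g m z)" "{m}"] by simp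
    finally show ?thesis .
  qed
  define q where "q = exp (- 2 * s)"
  have q: "0 < q" "q < 1" using s by (auto simp: q_def)
  have term_le: "(\<integral>\<^sup>+z. ennreal (g m z) \<partial>\<nu>) \<le> ennreal (4 * exp (2 * s) * q ^ m)" for m
  proof -
    have "(\<integral>\<^sup>+z. ennreal (g m z) \<partial>\<nu>)
        = ennreal (exp (s * (real m + 1)\<^sup>2 - l * (real m)\<^sup>2)) * (\<integral>\<^sup>+z. ennreal (exp (l * real m * cmod z)) \<partial>\<nu>)"
      unfolding g_def by (subst nn_integral_cmult[symmetric])
        (unfold measurable_cong_sets[OF sets refl], auto simp: ennreal_mult)
    also have "\<dots> \<le> ennreal (exp (s * (real m + 1)\<^sup>2 - l * (real m)\<^sup>2)) * ennreal (4 * exp (c * (l * real m)\<^sup>2))"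
      using l by (intro mult_left_mono nn_integral_exp_norm_le[OF sets SG]) auto
    also have "\<dots> = ennreal (4 * exp (s * (real m + 1)\<^sup>2 - l * (real m)\<^sup>2 + c * (l * real m)\<^sup>2))"
      by (simp add: ennreal_mult'[symmetric] exp_add mult_ac)
    also have "\<dots> \<le> ennreal (4 * exp (2 * s - 2 * s * real m))"
    proof (intro ennreal_leI mult_left_mono)
      have cl: "c * (l * real m)\<^sup>2 = 4 * s * (real m)\<^sup>2" "l * (real m)\<^sup>2 = 8 * s * (real m)\<^sup>2"
        using c by (simp_all add: l_def s_def power2_eq_square field_simps)
      have "(real m + 1)\<^sup>2 \<le> 2 * (real m)\<^sup>2 + 2"
        using zero_le_power2[of "real m - 1"] by (simp add: power2_eq_square algebra_simps)
      then have "s * (real m + 1)\<^sup>2 \<le> s * (2 * (real m)\<^sup>2 + 2)" using s by (intro mult_left_mono) auto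
      moreover have "s * (2 * real m) \<le> s * (2 * (real m)\<^sup>2)"
      proof -
        have "real m \<le> real (m\<^sup>2)" by (intro of_nat_mono) (simp add: power2_eq_square)
        then show ?thesis using s by (intro mult_left_mono) auto
      qed
      ultimately show "exp (s * (real m + 1)\<^sup>2 - l * (real m)\<^sup>2 + c * (l * real m)\<^sup>2) \<le> exp (2 * s - 2 * s * real m)"
        unfolding cl by (simp add: algebra_simps)
    qed simp
    also have "4 * exp (2 * s - 2 * s * real m) = 4 * exp (2 * s) * q ^ m"
      by (simp add: q_def exp_diff exp_minus exp_of_nat_mult[symmetric] field_simps)
    finally show ?thesis .
  qed
  have "(\<integral>\<^sup>+z. ennreal (exp (s * (cmod z)\<^sup>2)) \<partial>\<nu>) \<le> (\<integral>\<^sup>+z. (\<Sum>m. ennreal (g m z)) \<partial>\<nu>)"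
    by (intro nn_integral_mono pt)
  also have "\<dots> = (\<Sum>m. \<integral>\<^sup>+z. ennreal (g m z) \<partial>\<nu>)"
    by (rule nn_integral_suminf) (unfold measurable_cong_sets[OF sets refl] g_def, measurable)
  also have "\<dots> \<le> (\<Sum>m. ennreal (4 * exp (2 * s) * q ^ m))" by (intro suminf_le term_le) auto
  also have "\<dots> = ennreal (\<Sum>m. 4 * exp (2 * s) * q ^ m)"
    using q by (intro suminf_ennreal2 summable_mult summable_geometric) auto
  finally have "(\<integral>\<^sup>+z. ennreal (exp (s * (cmod z)\<^sup>2)) \<partial>\<nu>) \<le> ennreal (\<Sum>m. 4 * exp (2 * s) * q ^ m)" .
  moreover have "0 \<le> (\<Sum>m. 4 * exp (2 * s) * q ^ m)"
    using q by (intro suminf_nonneg summable_mult summable_geometric) auto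
  ultimately show ?thesis using s by blast
qed

text \<open>The consequences of (A1) used for concentration. Centring is encoded in
  \<open>SG\<close>, whose right-hand side has no linear term in \<open>t\<close>; the bilinear
  forms use \<open>SG\<close>, the diagonal ones the unit second moment.\<close>

locale subgaussian_law =
  fixes \<nu> :: "complex measure" and c s D :: real
  assumes prob: "prob_space \<nu>" and sets_borel: "sets \<nu> = sets borel"
    and c_pos: "0 < c" and s_pos: "0 < s" and D_nonneg: "0 \<le> D"
    and SG: "\<And>t::complex. (\<integral>\<^sup>+z. ennreal (exp (Re (cnj t * z))) \<partial>\<nu>) \<le> ennreal (exp (c * (cmod t)\<^sup>2 / 2))"
    and exp_sq: "(\<integral>\<^sup>+z. ennreal (exp (s * (cmod z)\<^sup>2)) \<partial>\<nu>) \<le> ennreal D"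
    and sq_int: "integrable \<nu> (\<lambda>z. (cmod z)\<^sup>2)" and sq_one: "(\<integral>z. (cmod z)\<^sup>2 \<partial>\<nu>) = 1"
begin

text \<open>Convexity of exp between the exponents 0 and s gives a bound whose logarithm is linear
  in \<open>q\<close>, so that a small \<open>q\<close> costs little per coordinate.\<close>

lemma exp_sq_small:
  assumes q: "0 \<le> q" "q \<le> s"
  shows "(\<integral>\<^sup>+z. ennreal (exp (q * (cmod z)\<^sup>2)) \<partial>\<nu>) \<le> ennreal (exp (D * q / s))"
proof -
  interpret prob_space \<nu> by (rule prob)
  have pt: "exp (q * y) \<le> 1 + q / s * exp (s * y)" for y
  proof -
    have "exp ((1 - q / s) *\<^sub>R 0 + (q / s) *\<^sub>R (s * y)) \<le> (1 - q / s) * exp 0 + (q / s) * exp (s * y)"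
      using q s_pos by (intro convex_onD[OF exp_convex]) auto
    then have "exp (q * y) \<le> (1 - q / s) + (q / s) * exp (s * y)" using s_pos by simp
    then show ?thesis using q s_pos by (smt (verit) divide_nonneg_nonneg)
  qed
  have "(\<integral>\<^sup>+z. ennreal (exp (q * (cmod z)\<^sup>2)) \<partial>\<nu>) \<le> (\<integral>\<^sup>+z. 1 + ennreal (q / s) * ennreal (exp (s * (cmod z)\<^sup>2)) \<partial>\<nu>)"
    using pt q s_pos
    by (intro nn_integral_mono) (simp add: ennreal_mult[symmetric] ennreal_plus[symmetric] ennreal_leI flip: ennreal_1 del: ennreal_plus)
  also have "\<dots> = 1 + ennreal (q / s) * (\<integral>\<^sup>+z. ennreal (exp (s * (cmod z)\<^sup>2)) \<partial>\<nu>)"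
    by (subst nn_integral_add) (unfold measurable_cong_sets[OF sets_borel refl], auto simp: emeasure_space_1
        intro!: nn_integral_cmult simp: measurable_cong_sets[OF sets_borel refl])
  also have "\<dots> \<le> 1 + ennreal (q / s) * ennreal D" by (intro add_left_mono mult_left_mono exp_sq) simp
  also have "\<dots> = ennreal (1 + q / s * D)"
    using q s_pos D_nonneg by (simp add: ennreal_mult[symmetric] ennreal_plus[symmetric] flip: ennreal_1 del: ennreal_plus)
  also have "\<dots> \<le> ennreal (exp (D * q / s))"
    using exp_ge_add_one_self[of "D * q / s"] by (intro ennreal_leI) (simp add: mult.commute)
  finally show ?thesis .
qed

text \<open>The linear Taylor term integrates to 0 because the second moment is 1. The quadratic one
  is absorbed in exp(s |z|^2): half of the available exponent bounds the exponential factor of the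
  remainder, the other half bounds the square through y^2 \<le> 2 exp y.\<close>

lemma exp_centred_sq:
  assumes b: "\<bar>b\<bar> \<le> s / 2"
  shows "(\<integral>\<^sup>+z. ennreal (exp (b * ((cmod z)\<^sup>2 - 1))) \<partial>\<nu>) \<le> ennreal (exp (8 * exp s * D / s\<^sup>2 * b\<^sup>2))"
proof -
  interpret prob_space \<nu> by (rule prob)
  define A where "A = 8 * b\<^sup>2 / s\<^sup>2 * exp s"
  have pt: "exp (b * (w - 1)) \<le> 1 + b * (w - 1) + A * exp (s * w)" if w: "0 \<le> w" for w
  proof -
    define y where "y = (s / 2) * \<bar>w - 1\<bar>"
    have y0: "0 \<le> y" using s_pos by (simp add: y_def)
    have by_le: "\<bar>b * (w - 1)\<bar> \<le> y" unfolding y_def abs_mult using b by (intro mult_right_mono) auto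
    have "exp (b * (w - 1)) - 1 - b * (w - 1) \<le> (b * (w - 1))\<^sup>2 * exp y"
      using exp_taylor2[OF by_le] by linarith
    also have "(b * (w - 1))\<^sup>2 = (4 * b\<^sup>2 / s\<^sup>2) * y\<^sup>2"
      using s_pos by (simp add: y_def power_mult_distrib power_divide)
    also have "(4 * b\<^sup>2 / s\<^sup>2) * y\<^sup>2 * exp y \<le> (4 * b\<^sup>2 / s\<^sup>2) * (2 * exp y) * exp y"
      using exp_lower_Taylor_quadratic[OF y0] y0
      by (intro mult_right_mono mult_left_mono) auto
    also have "\<dots> = (8 * b\<^sup>2 / s\<^sup>2) * exp (2 * y)" by (simp add: mult_exp_exp)
    also have "\<dots> \<le> (8 * b\<^sup>2 / s\<^sup>2) * exp (s + s * w)"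
    proof (intro mult_left_mono)
      have "s * \<bar>w - 1\<bar> \<le> s * (w + 1)" using w s_pos by (intro mult_left_mono) auto
      then show "exp (2 * y) \<le> exp (s + s * w)" by (simp add: y_def algebra_simps)
    qed (use s_pos in simp)
    finally show ?thesis by (simp add: A_def exp_add mult_ac)
  qed
  have ms: "(\<lambda>z. exp (s * (cmod z)\<^sup>2)) \<in> borel_measurable \<nu>"
    unfolding measurable_cong_sets[OF sets_borel refl] by measurable
  have isq: "integrable \<nu> (\<lambda>z. exp (s * (cmod z)\<^sup>2))"
    by (rule integrableI_bounded[OF ms]) (use exp_sq le_less_trans[OF _ ennreal_less_top] in auto)
  have "ennreal (\<integral>z. exp (s * (cmod z)\<^sup>2) \<partial>\<nu>) \<le> ennreal D"
    using exp_sq nn_integral_eq_integral[OF isq] by simp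
  then have isD: "(\<integral>z. exp (s * (cmod z)\<^sup>2) \<partial>\<nu>) \<le> D" using D_nonneg by (simp add: ennreal_le_iff)
  let ?g = "\<lambda>z. 1 + b * ((cmod z)\<^sup>2 - 1) + A * exp (s * (cmod z)\<^sup>2)"
  have ig: "integrable \<nu> ?g" using isq sq_int by (intro Bochner_Integration.integrable_add integrable_mult_right Bochner_Integration.integrable_diff) auto
  have "(\<integral>\<^sup>+z. ennreal (exp (b * ((cmod z)\<^sup>2 - 1))) \<partial>\<nu>) \<le> (\<integral>\<^sup>+z. ennreal (?g z) \<partial>\<nu>)"
    by (intro nn_integral_mono ennreal_leI pt) simp
  also have "\<dots> = ennreal (\<integral>z. ?g z \<partial>\<nu>)"
  proof (rule nn_integral_eq_integral[OF ig])
    have "0 \<le> ?g z" for z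
      using pt[of "(cmod z)\<^sup>2"] exp_ge_zero[of "b * ((cmod z)\<^sup>2 - 1)"] zero_le_power2[of "cmod z"] by linarith
    then show "AE z in \<nu>. 0 \<le> ?g z" by simp
  qed
  also have "(\<integral>z. ?g z \<partial>\<nu>) = 1 + A * (\<integral>z. exp (s * (cmod z)\<^sup>2) \<partial>\<nu>)"
    using isq sq_int sq_one by (simp add: prob_space)
  also have "\<dots> \<le> exp (A * D)"
  proof -
    have "A * (\<integral>z. exp (s * (cmod z)\<^sup>2) \<partial>\<nu>) \<le> A * D" using isD by (intro mult_left_mono) (auto simp: A_def)
    then show ?thesis using exp_ge_add_one_self[of "A * D"] by linarith
  qed
  finally show ?thesis by (simp add: A_def ennreal_leI mult_ac)
qed

end

section \<open>Decoupling by a random subset of the indices\<close>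

lemma card_separating_subsets:
  assumes "finite I" "i \<in> I" "j \<in> I" "i \<noteq> j"
  shows "card {J \<in> Pow I. i \<in> J \<and> j \<notin> J} * 4 = 2 ^ card I"
proof -
  have "bij_betw (insert i) (Pow (I - {i,j})) {J \<in> Pow I. i \<in> J \<and> j \<notin> J}"
    by (rule bij_betw_byWitness[where f' = "\<lambda>J. J - {i}"]) (use assms in auto)
  then have "card {J \<in> Pow I. i \<in> J \<and> j \<notin> J} = card (Pow (I - {i,j}))" by (simp add: bij_betw_same_card)
  also have "\<dots> = 2 ^ (card I - 2)" using assms by (simp add: card_Pow card_Diff_subset)
  finally have "card {J \<in> Pow I. i \<in> J \<and> j \<notin> J} * 4 = 2 ^ (card I - 2 + 2)" by (simp add: power_add)
  moreover have "2 \<le> card I" using assms card_mono[of I "{i,j}"] by simp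
  ultimately show ?thesis using le_add_diff_inverse2 by metis
qed

text \<open>A uniformly random subset contains \<open>i\<close> and misses \<open>j\<close> with
  probability 1/4, so the off-diagonal sum is 4 times the average of the sums from \<open>J\<close>
  to its complement.\<close>

lemma decoupling_identity:
  fixes a :: "'i \<Rightarrow> 'i \<Rightarrow> real"
  assumes "finite I"
  shows "(\<Sum>i\<in>I. \<Sum>j\<in>I - {i}. a i j) = (\<Sum>J\<in>Pow I. (1 / 2 ^ card I) * (4 * (\<Sum>i\<in>J. \<Sum>j\<in>I - J. a i j)))"
proof -
  have "(\<Sum>J\<in>Pow I. \<Sum>i\<in>J. \<Sum>j\<in>I - J. a i j) = (\<Sum>J\<in>Pow I. \<Sum>i\<in>I. \<Sum>j\<in>I. if i \<in> J \<and> j \<notin> J then a i j else 0)"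
  proof (rule sum.cong[OF refl])
    fix J assume "J \<in> Pow I"
    then have J: "J \<subseteq> I" by simp
    have "(\<Sum>i\<in>I. \<Sum>j\<in>I. if i \<in> J \<and> j \<notin> J then a i j else 0) = (\<Sum>i\<in>I. if i \<in> J then \<Sum>j\<in>I. if j \<notin> J then a i j else 0 else 0)"
      by (intro sum.cong) auto
    also have "\<dots> = (\<Sum>i\<in>I \<inter> J. \<Sum>j\<in>I. if j \<notin> J then a i j else 0)" using assms by (simp add: sum.inter_restrict)
    also have "\<dots> = (\<Sum>i\<in>J. \<Sum>j\<in>I - J. a i j)"
    proof (rule sum.cong)
      fix i
      have "(\<Sum>j\<in>I. if j \<notin> J then a i j else 0) = (\<Sum>j | j \<in> I \<and> j \<notin> J. a i j)"
        using assms by (simp only: sum.inter_filter)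
      also have "{j. j \<in> I \<and> j \<notin> J} = I - J" by auto
      finally show "(\<Sum>j\<in>I. if j \<notin> J then a i j else 0) = (\<Sum>j\<in>I - J. a i j)" .
    qed (use J in auto)
    finally show "(\<Sum>i\<in>J. \<Sum>j\<in>I - J. a i j) = (\<Sum>i\<in>I. \<Sum>j\<in>I. if i \<in> J \<and> j \<notin> J then a i j else 0)" by simp
  qed
  also have "\<dots> = (\<Sum>i\<in>I. \<Sum>j\<in>I. \<Sum>J\<in>Pow I. if i \<in> J \<and> j \<notin> J then a i j else 0)"
    by (subst sum.swap) (intro sum.cong refl sum.swap)
  also have "\<dots> = (\<Sum>i\<in>I. \<Sum>j\<in>I. real (card {J \<in> Pow I. i \<in> J \<and> j \<notin> J}) * a i j)"
    using assms by (intro sum.cong refl) (simp add: sum.inter_filter[symmetric])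
  also have "\<dots> = (\<Sum>i\<in>I. \<Sum>j\<in>I - {i}. 2 ^ card I / 4 * a i j)"
  proof (rule sum.cong[OF refl])
    fix i assume i: "i \<in> I"
    have "(\<Sum>j\<in>I. real (card {J \<in> Pow I. i \<in> J \<and> j \<notin> J}) * a i j)
      = (\<Sum>j\<in>I - {i}. real (card {J \<in> Pow I. i \<in> J \<and> j \<notin> J}) * a i j)"
      using assms i by (subst sum.remove[of _ i]) (auto intro!: arg_cong[where f = card])
    also have "\<dots> = (\<Sum>j\<in>I - {i}. 2 ^ card I / 4 * a i j)"
    proof (rule sum.cong[OF refl])
      fix j assume "j \<in> I - {i}"
      then have "real (card {J \<in> Pow I. i \<in> J \<and> j \<notin> J} * 4) = real (2 ^ card I)"
        using card_separating_subsets[OF assms i, of j] by (intro arg_cong[where f = real]) auto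
      then have "real (card {J \<in> Pow I. i \<in> J \<and> j \<notin> J}) = 2 ^ card I / 4" by simp
      then show "real (card {J \<in> Pow I. i \<in> J \<and> j \<notin> J}) * a i j = 2 ^ card I / 4 * a i j" by simp
    qed
    finally show "(\<Sum>j\<in>I. real (card {J \<in> Pow I. i \<in> J \<and> j \<notin> J}) * a i j) = (\<Sum>j\<in>I - {i}. 2 ^ card I / 4 * a i j)" .
  qed
  finally have *: "(\<Sum>J\<in>Pow I. \<Sum>i\<in>J. \<Sum>j\<in>I - J. a i j) = 2 ^ card I / 4 * (\<Sum>i\<in>I. \<Sum>j\<in>I - {i}. a i j)"
    by (simp only: sum_distrib_left)
  show ?thesis unfolding sum_distrib_left[symmetric] * by simp
qed

text \<open>Jensen's inequality for the uniform average over subsets; it passes bounds on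
  exponential moments from the decoupled forms to the off-diagonal form.\<close>

lemma exp_average_le:
  fixes f :: "'i set \<Rightarrow> real"
  assumes "finite I"
  shows "exp (\<Sum>J\<in>Pow I. (1 / 2 ^ card I) * f J) \<le> (\<Sum>J\<in>Pow I. (1 / 2 ^ card I) * exp (f J))"
  using convex_on_sum[OF _ _ exp_convex, of "Pow I" "\<lambda>_. 1 / 2 ^ card I" f] assms
  by (auto simp: card_Pow)

section \<open>Concentration of quadratic forms\<close>

text \<open>The operator norm on vectors indexed by \<open>I\<close> is at most the absolute value
  of \<open>K\<close>. The index type is left open because pairs of a vector number and a coordinate
  will serve as indices.\<close>

definition op_bound :: "'i set \<Rightarrow> ('i \<Rightarrow> 'i \<Rightarrow> complex) \<Rightarrow> real \<Rightarrow> bool" where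
  "op_bound I B K \<longleftrightarrow> (\<forall>y. (\<Sum>i\<in>I. (cmod (\<Sum>j\<in>I. B i j * y j))\<^sup>2) \<le> K\<^sup>2 * (\<Sum>j\<in>I. (cmod (y j))\<^sup>2))"

lemma op_bound_entry:
  assumes "op_bound I B K" "0 \<le> K" "finite I" "i \<in> I" "j \<in> I"
  shows "cmod (B i j) \<le> K"
proof -
  have 1: "(\<Sum>b\<in>I. B a b * (if b = j then 1 else 0)) = B a j" for a
    using assms by (subst sum.remove[of _ j]) auto
  have 2: "(\<Sum>b\<in>I. (cmod (if b = j then 1 else 0))\<^sup>2) = 1"
    using assms by (subst sum.remove[of _ j]) auto
  have "(cmod (B i j))\<^sup>2 \<le> (\<Sum>a\<in>I. (cmod (B a j))\<^sup>2)"
    using assms by (intro member_le_sum) auto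
  also have "\<dots> \<le> K\<^sup>2"
    using assms(1)[unfolded op_bound_def, rule_format, of "\<lambda>b. if b = j then 1 else 0"]
    unfolding 1 2 by simp
  finally show ?thesis using assms(2) by (rule power2_le_imp_le)
qed

context subgaussian_law
begin

sublocale product_sigma_finite "\<lambda>_::'i. \<nu>"
  by (intro product_sigma_finite.intro prob_space_imp_sigma_finite prob)

lemma prob_space_PiM_law: "prob_space (PiM I (\<lambda>_::'i. \<nu>))"
  by (intro prob_space_PiM prob)

lemma measurable_coord: "i \<in> I \<Longrightarrow> (\<lambda>x. x i) \<in> borel_measurable (PiM I (\<lambda>_. \<nu>))"
  using measurable_component_singleton[of i I "\<lambda>_. \<nu>"]
  by (simp add: measurable_cong_sets[OF refl sets_borel])

lemma measurable_quadratic: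
  assumes "J \<subseteq> I" "\<And>i. i \<in> J \<Longrightarrow> L i \<subseteq> I"
  shows "(\<lambda>x. \<Sum>i\<in>J. \<Sum>j\<in>L i. cnj (x i) * B i j * x j) \<in> borel_measurable (PiM I (\<lambda>_. \<nu>))"
proof -
  have "(\<lambda>x. cnj (x i) * B i j * x j) \<in> borel_measurable (PiM I (\<lambda>_. \<nu>))" if "i \<in> J" "j \<in> L i" for i j
  proof -
    have [measurable]: "(\<lambda>x. x i) \<in> borel_measurable (PiM I (\<lambda>_. \<nu>))" "(\<lambda>x. x j) \<in> borel_measurable (PiM I (\<lambda>_. \<nu>))"
      using that assms by (auto intro!: measurable_coord)
    have "cnj \<in> borel_measurable borel" by (intro borel_measurable_continuous_onI continuous_intros)
    then have [measurable]: "(\<lambda>x. cnj (x i)) \<in> borel_measurable (PiM I (\<lambda>_. \<nu>))"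
      by (rule measurable_compose_rev) measurable
    show ?thesis by measurable
  qed
  then show ?thesis by (intro borel_measurable_sum) auto
qed

text \<open>Given the coordinates outside \<open>J\<close>, the decoupled form is linear in the remaining ones.\<close>
lemma bilinear_exp_bound:
  assumes I: "finite I" and J: "J \<subseteq> I" and op: "op_bound I B K"
    and small: "c * \<tau>\<^sup>2 * K\<^sup>2 / 2 \<le> s"
  shows "(\<integral>\<^sup>+x. ennreal (exp (\<tau> * Re (\<Sum>i\<in>J. \<Sum>j\<in>I - J. cnj (x i) * B i j * x j))) \<partial>PiM I (\<lambda>_. \<nu>))
    \<le> ennreal (exp (card I * (D * (c * \<tau>\<^sup>2 * K\<^sup>2 / 2) / s)))"
proof -
  define q where "q = c * \<tau>\<^sup>2 * K\<^sup>2 / 2"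
  have q: "0 \<le> q" "q \<le> s" using small c_pos by (auto simp: q_def)
  define F where "F x = ennreal (exp (\<tau> * Re (\<Sum>i\<in>J. \<Sum>j\<in>I - J. cnj (x i) * B i j * x j)))" for x
  have fin: "finite J" "finite (I - J)" using I J by (auto intro: finite_subset)
  have IJ: "(I - J) \<union> J = I" "(I - J) \<inter> J = {}" using J by auto
  have Fm: "F \<in> borel_measurable (PiM I (\<lambda>_. \<nu>))"
  proof -
    have [measurable]: "(\<lambda>x. \<Sum>i\<in>J. \<Sum>j\<in>I - J. cnj (x i) * B i j * x j) \<in> borel_measurable (PiM I (\<lambda>_. \<nu>))"
      using J by (intro measurable_quadratic) auto
    show ?thesis unfolding F_def[abs_def] by measurable
  qed
  \<comment> \<open>Once the coordinates outside \<open>J\<close> are fixed, the form is the sum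
    over \<open>J\<close> of \<open>cnj (y i) * L x i\<close>; its exponential factorises over
    independent coordinates and \<open>SG\<close> applies to each factor.\<close>
  define L where "L x i = (\<Sum>j\<in>I - J. B i j * x j)" for x i
  have merge: "F (merge (I - J) J (x, y)) = (\<Prod>i\<in>J. ennreal (exp (Re (cnj (of_real \<tau> * L x i) * y i))))" for x y
  proof -
    have "\<tau> * Re (\<Sum>i\<in>J. \<Sum>j\<in>I - J. cnj (merge (I - J) J (x, y) i) * B i j * merge (I - J) J (x, y) j)
       = \<tau> * Re (\<Sum>i\<in>J. cnj (y i) * L x i)"
      unfolding L_def sum_distrib_left
      by (intro arg_cong[where f = "\<lambda>z. \<tau> * Re z"] sum.cong refl) (auto simp: merge_def mult.assoc)
    also have "\<dots> = (\<Sum>i\<in>J. Re (cnj (of_real \<tau> * L x i) * y i))"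
      unfolding Re_sum sum_distrib_left by (intro sum.cong refl) (simp add: algebra_simps)
    finally show ?thesis using fin unfolding F_def by (simp add: exp_sum prod_ennreal)
  qed
  have "(\<integral>\<^sup>+x. F x \<partial>PiM I (\<lambda>_. \<nu>)) = (\<integral>\<^sup>+x. (\<integral>\<^sup>+y. F (merge (I - J) J (x, y)) \<partial>PiM J (\<lambda>_. \<nu>)) \<partial>PiM (I - J) (\<lambda>_. \<nu>))"
    using product_nn_integral_fold[of "I - J" J F] Fm fin IJ by simp
  also have "\<dots> \<le> (\<integral>\<^sup>+x. (\<Prod>j\<in>I - J. ennreal (exp (q * (cmod (x j))\<^sup>2))) \<partial>PiM (I - J) (\<lambda>_. \<nu>))"
  proof (rule nn_integral_mono)
    fix x
    have "(\<integral>\<^sup>+y. F (merge (I - J) J (x, y)) \<partial>PiM J (\<lambda>_. \<nu>))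
       = (\<Prod>i\<in>J. \<integral>\<^sup>+z. ennreal (exp (Re (cnj (of_real \<tau> * L x i) * z))) \<partial>\<nu>)"
      unfolding merge using fin
      by (intro product_nn_integral_prod) (unfold measurable_cong_sets[OF sets_borel refl], measurable)
    also have "\<dots> \<le> (\<Prod>i\<in>J. ennreal (exp (c * (cmod (of_real \<tau> * L x i))\<^sup>2 / 2)))"
      by (intro prod_mono_ennreal SG)
    also have "\<dots> = ennreal (exp (\<Sum>i\<in>J. c * (cmod (of_real \<tau> * L x i))\<^sup>2 / 2))"
      using fin by (simp add: exp_sum prod_ennreal)
    also have "\<dots> \<le> ennreal (exp (\<Sum>j\<in>I - J. q * (cmod (x j))\<^sup>2))"
    proof -
      \<comment> \<open>The fixed coordinates extended by 0 over \<open>J\<close>, so that the bound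
        on the operator norm controls the sum of |L x i|^2. What remains is a product of square
        exponentials, handled by \<open>exp_sq_small\<close>.\<close>
      define y where "y j = (if j \<in> I - J then x j else 0)" for j
      have Ly: "(\<Sum>j\<in>I. B i j * y j) = L x i" for i
        unfolding L_def y_def using I by (intro sum.mono_neutral_cong_right) auto
      have "(\<Sum>i\<in>J. (cmod (L x i))\<^sup>2) \<le> (\<Sum>i\<in>I. (cmod (L x i))\<^sup>2)" using I J by (intro sum_mono2) auto
      also have "\<dots> \<le> K\<^sup>2 * (\<Sum>j\<in>I. (cmod (y j))\<^sup>2)"
        using op[unfolded op_bound_def, rule_format, of y] unfolding Ly .
      also have "(\<Sum>j\<in>I. (cmod (y j))\<^sup>2) = (\<Sum>j\<in>I - J. (cmod (x j))\<^sup>2)"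
        unfolding y_def using I by (intro sum.mono_neutral_cong_right) auto
      finally have "(c * \<tau>\<^sup>2 / 2) * (\<Sum>i\<in>J. (cmod (L x i))\<^sup>2) \<le> (c * \<tau>\<^sup>2 / 2) * (K\<^sup>2 * (\<Sum>j\<in>I - J. (cmod (x j))\<^sup>2))"
        using c_pos by (intro mult_left_mono) auto
      moreover have "(c * \<tau>\<^sup>2 / 2) * (\<Sum>i\<in>J. (cmod (L x i))\<^sup>2) = (\<Sum>i\<in>J. c * (cmod (of_real \<tau> * L x i))\<^sup>2 / 2)"
        unfolding sum_distrib_left by (intro sum.cong refl) (simp add: norm_mult power_mult_distrib)
      moreover have "(c * \<tau>\<^sup>2 / 2) * (K\<^sup>2 * (\<Sum>j\<in>I - J. (cmod (x j))\<^sup>2)) = (\<Sum>j\<in>I - J. q * (cmod (x j))\<^sup>2)"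
        unfolding sum_distrib_left q_def by (intro sum.cong refl) simp
      ultimately have "(\<Sum>i\<in>J. c * (cmod (of_real \<tau> * L x i))\<^sup>2 / 2) \<le> (\<Sum>j\<in>I - J. q * (cmod (x j))\<^sup>2)"
        by (simp only:)
      then show ?thesis by (intro ennreal_leI) simp
    qed
    also have "\<dots> = (\<Prod>j\<in>I - J. ennreal (exp (q * (cmod (x j))\<^sup>2)))"
      using fin by (simp add: exp_sum prod_ennreal)
    finally show "(\<integral>\<^sup>+y. F (merge (I - J) J (x, y)) \<partial>PiM J (\<lambda>_. \<nu>)) \<le> (\<Prod>j\<in>I - J. ennreal (exp (q * (cmod (x j))\<^sup>2)))" .
  qed
  also have "\<dots> = (\<Prod>j\<in>I - J. \<integral>\<^sup>+z. ennreal (exp (q * (cmod z)\<^sup>2)) \<partial>\<nu>)"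
    using fin by (intro product_nn_integral_prod) (unfold measurable_cong_sets[OF sets_borel refl], measurable)
  also have "\<dots> \<le> (\<Prod>j\<in>I - J. ennreal (exp (D * q / s)))"
    by (intro prod_mono_ennreal exp_sq_small q)
  also have "\<dots> = ennreal (exp (card (I - J) * (D * q / s)))"
    by (simp add: ennreal_power flip: exp_of_nat_mult)
  also have "\<dots> \<le> ennreal (exp (card I * (D * q / s)))"
  proof -
    have "real (card (I - J)) \<le> real (card I)" using I by (intro of_nat_mono card_mono) auto
    then have "real (card (I - J)) * (D * q / s) \<le> real (card I) * (D * q / s)"
      using q s_pos D_nonneg by (intro mult_right_mono) auto
    then show ?thesis by (intro ennreal_leI) simp
  qed
  finally show ?thesis by (simp only: F_def q_def)
qed

text \<open>The factor 4 of the decoupling identity means that each decoupled form is taken at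
  parameter 4 l; hence c (4 l)^2 K^2 / 2 = 8 c l^2 K^2.\<close>

lemma off_diagonal_exp_bound:
  assumes I: "finite I" and op: "op_bound I B K" and small: "8 * c * l\<^sup>2 * K\<^sup>2 \<le> s"
  shows "(\<integral>\<^sup>+x. ennreal (exp (l * Re (\<Sum>i\<in>I. \<Sum>j\<in>I - {i}. cnj (x i) * B i j * x j))) \<partial>PiM I (\<lambda>_. \<nu>))
    \<le> ennreal (exp (card I * (D * (8 * c * l\<^sup>2 * K\<^sup>2) / s)))"
proof -
  define Q where "Q J x = Re (\<Sum>i\<in>J. \<Sum>j\<in>I - J. cnj (x i) * B i j * x j)" for J and x
  define N where "N = (2::real) ^ card I"
  have eq: "c * (4 * l)\<^sup>2 * K\<^sup>2 / 2 = 8 * c * l\<^sup>2 * K\<^sup>2" by (simp add: power_mult_distrib)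
  have Qm: "Q J \<in> borel_measurable (PiM I (\<lambda>_. \<nu>))" if "J \<in> Pow I" for J
  proof -
    have [measurable]: "(\<lambda>x. \<Sum>i\<in>J. \<Sum>j\<in>I - J. cnj (x i) * B i j * x j) \<in> borel_measurable (PiM I (\<lambda>_. \<nu>))"
      using that by (intro measurable_quadratic) auto
    show ?thesis unfolding Q_def[abs_def] by measurable
  qed
  have "ennreal (exp (l * Re (\<Sum>i\<in>I. \<Sum>j\<in>I - {i}. cnj (x i) * B i j * x j)))
    \<le> (\<Sum>J\<in>Pow I. ennreal (1 / N) * ennreal (exp (4 * l * Q J x)))" for x
  proof -
    have "l * Re (\<Sum>i\<in>I. \<Sum>j\<in>I - {i}. cnj (x i) * B i j * x j) = (\<Sum>J\<in>Pow I. (1 / 2 ^ card I) * (4 * l * Q J x))"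
      using decoupling_identity[OF I, of "\<lambda>i j. Re (cnj (x i) * B i j * x j)"]
      unfolding Q_def Re_sum by (simp add: sum_distrib_left mult_ac)
    then have "exp (l * Re (\<Sum>i\<in>I. \<Sum>j\<in>I - {i}. cnj (x i) * B i j * x j))
      \<le> (\<Sum>J\<in>Pow I. (1 / N) * exp (4 * l * Q J x))"
      using exp_average_le[OF I, of "\<lambda>J. 4 * l * Q J x"] by (simp add: N_def)
    then have "ennreal (exp (l * Re (\<Sum>i\<in>I. \<Sum>j\<in>I - {i}. cnj (x i) * B i j * x j)))
      \<le> ennreal (\<Sum>J\<in>Pow I. (1 / N) * exp (4 * l * Q J x))" by (rule ennreal_leI)
    also have "\<dots> = (\<Sum>J\<in>Pow I. ennreal (1 / N) * ennreal (exp (4 * l * Q J x)))"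
      unfolding N_def by (subst sum_ennreal[symmetric]) (auto simp: ennreal_mult[symmetric])
    finally show ?thesis .
  qed
  then have "(\<integral>\<^sup>+x. ennreal (exp (l * Re (\<Sum>i\<in>I. \<Sum>j\<in>I - {i}. cnj (x i) * B i j * x j))) \<partial>PiM I (\<lambda>_. \<nu>))
    \<le> (\<integral>\<^sup>+x. (\<Sum>J\<in>Pow I. ennreal (1 / N) * ennreal (exp (4 * l * Q J x))) \<partial>PiM I (\<lambda>_. \<nu>))"
    by (intro nn_integral_mono)
  also have "\<dots> = (\<Sum>J\<in>Pow I. ennreal (1 / N) * (\<integral>\<^sup>+x. ennreal (exp (4 * l * Q J x)) \<partial>PiM I (\<lambda>_. \<nu>)))"
  proof -
    have m: "(\<lambda>x. ennreal (exp (4 * l * Q J x))) \<in> borel_measurable (PiM I (\<lambda>_. \<nu>))" if "J \<in> Pow I" for J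
      using Qm[OF that] by measurable
    then show ?thesis by (subst nn_integral_sum) (auto intro!: sum.cong nn_integral_cmult)
  qed
  also have "\<dots> \<le> (\<Sum>J\<in>Pow I. ennreal (1 / N) * ennreal (exp (card I * (D * (8 * c * l\<^sup>2 * K\<^sup>2) / s))))"
    unfolding Q_def using bilinear_exp_bound[OF I _ op, of _ "4 * l", unfolded eq] small
    by (intro sum_mono mult_left_mono) auto
  also have "\<dots> = ennreal (exp (card I * (D * (8 * c * l\<^sup>2 * K\<^sup>2) / s)))"
  proof -
    have "(\<Sum>J\<in>Pow I. ennreal (1 / N)) = ennreal (\<Sum>J\<in>Pow I. 1 / N)"
      by (rule sum_ennreal) (simp add: N_def)
    also have "(\<Sum>J\<in>Pow I. 1 / N) = 1" using I by (simp add: N_def card_Pow)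
    finally show ?thesis by (simp only: sum_distrib_right[symmetric] ennreal_1 mult_1)
  qed
  finally show ?thesis .
qed

lemma diagonal_exp_bound:
  assumes I: "finite I" and \<beta>: "\<And>i. i \<in> I \<Longrightarrow> \<bar>\<beta> i\<bar> \<le> K" and K: "0 \<le> K" and l: "0 \<le> l" "l * K \<le> s / 2"
  shows "(\<integral>\<^sup>+x. ennreal (exp (l * (\<Sum>i\<in>I. \<beta> i * ((cmod (x i))\<^sup>2 - 1)))) \<partial>PiM I (\<lambda>_. \<nu>))
    \<le> ennreal (exp (card I * (8 * exp s * D / s\<^sup>2 * (l * K)\<^sup>2)))"
proof -
  have "(\<integral>\<^sup>+x. ennreal (exp (l * (\<Sum>i\<in>I. \<beta> i * ((cmod (x i))\<^sup>2 - 1)))) \<partial>PiM I (\<lambda>_. \<nu>))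
     = (\<integral>\<^sup>+x. (\<Prod>i\<in>I. ennreal (exp ((l * \<beta> i) * ((cmod (x i))\<^sup>2 - 1)))) \<partial>PiM I (\<lambda>_. \<nu>))"
    using I by (intro nn_integral_cong) (simp add: prod_ennreal exp_sum[symmetric] sum_distrib_left mult.assoc)
  also have "\<dots> = (\<Prod>i\<in>I. \<integral>\<^sup>+z. ennreal (exp ((l * \<beta> i) * ((cmod z)\<^sup>2 - 1))) \<partial>\<nu>)"
    using I by (intro product_nn_integral_prod) (unfold measurable_cong_sets[OF sets_borel refl], measurable)
  also have "\<dots> \<le> (\<Prod>i\<in>I. ennreal (exp (8 * exp s * D / s\<^sup>2 * (l * K)\<^sup>2)))"
  proof (rule prod_mono_ennreal)
    fix i assume i: "i \<in> I"
    have le: "\<bar>l * \<beta> i\<bar> \<le> l * K" unfolding abs_mult using \<beta>[OF i] l by (simp add: mult_left_mono)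
    then have "(\<integral>\<^sup>+z. ennreal (exp ((l * \<beta> i) * ((cmod z)\<^sup>2 - 1))) \<partial>\<nu>) \<le> ennreal (exp (8 * exp s * D / s\<^sup>2 * (l * \<beta> i)\<^sup>2))"
      using l by (intro exp_centred_sq) linarith
    also have "\<dots> \<le> ennreal (exp (8 * exp s * D / s\<^sup>2 * (l * K)\<^sup>2))"
    proof -
      have "(l * \<beta> i)\<^sup>2 \<le> (l * K)\<^sup>2" using le by (simp add: abs_le_square_iff[symmetric])
      then have "8 * exp s * D / s\<^sup>2 * (l * \<beta> i)\<^sup>2 \<le> 8 * exp s * D / s\<^sup>2 * (l * K)\<^sup>2"
        using D_nonneg s_pos by (intro mult_left_mono) auto
      then show ?thesis by (intro ennreal_leI) simp
    qed
    finally show "(\<integral>\<^sup>+z. ennreal (exp ((l * \<beta> i) * ((cmod z)\<^sup>2 - 1))) \<partial>\<nu>) \<le> \<dots>" .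
  qed
  also have "\<dots> = ennreal (exp (card I * (8 * exp s * D / s\<^sup>2 * (l * K)\<^sup>2)))"
    by (simp add: ennreal_power flip: exp_of_nat_mult)
  finally show ?thesis .
qed

end

lemma chernoff_bound:
  fixes M :: "'a measure"
  assumes "prob_space M" and Y: "Y \<in> borel_measurable M"
    and E: "(\<integral>\<^sup>+x. ennreal (exp (l * Y x)) \<partial>M) \<le> ennreal (exp A)" and l: "0 < l"
  shows "measure M {x \<in> space M. a \<le> Y x} \<le> exp (A - l * a)"
proof -
  interpret prob_space M by fact
  note Y [measurable]
  have "emeasure M {x \<in> space M. a \<le> Y x} \<le> emeasure M ({x \<in> space M. 1 \<le> ennreal (exp (- l * a)) * ennreal (exp (l * Y x))})"
  proof (intro emeasure_mono)
    show "{x \<in> space M. a \<le> Y x} \<subseteq> {x \<in> space M. 1 \<le> ennreal (exp (- l * a)) * ennreal (exp (l * Y x))}"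
      using l by (auto simp: ennreal_mult[symmetric] mult_exp_exp)
  qed measurable
  also have "\<dots> \<le> ennreal (exp (- l * a)) * (\<integral>\<^sup>+x. ennreal (exp (l * Y x)) * indicator (space M) x \<partial>M)"
    by (rule nn_integral_Markov_inequality) measurable
  also have "(\<integral>\<^sup>+x. ennreal (exp (l * Y x)) * indicator (space M) x \<partial>M) = (\<integral>\<^sup>+x. ennreal (exp (l * Y x)) \<partial>M)"
    by (intro nn_integral_cong) simp
  also have "ennreal (exp (- l * a)) * \<dots> \<le> ennreal (exp (- l * a)) * ennreal (exp A)" by (intro mult_left_mono E) simp
  also have "\<dots> = ennreal (exp (A - l * a))" by (simp add: ennreal_mult[symmetric] mult_exp_exp)
  finally show ?thesis by (simp add: emeasure_eq_measure)
qed

context subgaussian_law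
begin

text \<open>The Hanson--Wright inequality, with a non-explicit rate.\<close>
lemma quadratic_form_tail:
  fixes K \<delta> :: real
  assumes K: "0 \<le> K" and \<delta>: "0 < \<delta>"
  shows "\<exists>\<kappa>>0::real. \<forall>(I::'i set) B. finite I \<longrightarrow> op_bound I B K \<longrightarrow>
    measure (PiM I (\<lambda>_. \<nu>)) {x \<in> space (PiM I (\<lambda>_. \<nu>)).
      \<delta> * card I \<le> Re ((\<Sum>i\<in>I. \<Sum>j\<in>I. cnj (x i) * B i j * x j) - (\<Sum>i\<in>I. B i i))} \<le> 2 * exp (- \<kappa> * card I)"
proof -
  \<comment> \<open>Dominates the coefficients of l^2, per coordinate, in the logarithmic moments of
    both the off-diagonal and the diagonal part. With l A \<le> \<delta>/4, Chernoff's bound at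
    level \<delta>/2 leaves the exponent - l \<delta>/4 per coordinate.\<close>
  define A where "A = D * (8 * c * K\<^sup>2) / s + 8 * exp s * D / s\<^sup>2 * K\<^sup>2"
  have A1: "D * (8 * c * K\<^sup>2) / s \<le> A" "8 * exp s * D / s\<^sup>2 * K\<^sup>2 \<le> A" "0 \<le> A"
    using D_nonneg c_pos s_pos by (simp_all add: A_def)
  have t: "((\<lambda>l. 8 * c * l\<^sup>2 * K\<^sup>2) \<longlongrightarrow> 8 * c * 0\<^sup>2 * K\<^sup>2) (at_right 0)" "((\<lambda>l. l * K) \<longlongrightarrow> 0 * K) (at_right 0)"
    "((\<lambda>l. l * A) \<longlongrightarrow> 0 * A) (at_right (0::real))" by (intro tendsto_intros)+
  have "eventually (\<lambda>l. 8 * c * l\<^sup>2 * K\<^sup>2 < s) (at_right 0)"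
    by (rule order_tendstoD(2)[OF t(1)]) (use s_pos in simp)
  moreover have "eventually (\<lambda>l. l * K < s / 2) (at_right 0)"
    by (rule order_tendstoD(2)[OF t(2)]) (use s_pos in simp)
  moreover have "eventually (\<lambda>l. l * A < \<delta> / 4) (at_right 0)"
    by (rule order_tendstoD(2)[OF t(3)]) (use \<delta> in simp)
  moreover have "eventually (\<lambda>l::real. 0 < l) (at_right 0)" by (simp add: eventually_at_right_less)
  ultimately have "eventually (\<lambda>l. 0 < l \<and> 8 * c * l\<^sup>2 * K\<^sup>2 \<le> s \<and> l * K \<le> s / 2 \<and> l * A \<le> \<delta> / 4) (at_right 0)"
    by eventually_elim (simp add: less_imp_le)
  from eventually_happens'[OF trivial_limit_at_right_real this]
  obtain l where l: "0 < l" "8 * c * l\<^sup>2 * K\<^sup>2 \<le> s" "l * K \<le> s / 2" "l * A \<le> \<delta> / 4"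
    by (elim exE conjE)
  show ?thesis
  proof (intro exI[of _ "l * \<delta> / 4"] conjI allI impI)
    show "0 < l * \<delta> / 4" using l \<delta> by simp
    fix I :: "'i set" and B assume I: "finite I" and op: "op_bound I B K"
    let ?M = "PiM I (\<lambda>_. \<nu>)"
    interpret M: prob_space ?M by (rule prob_space_PiM_law)
    define Y where "Y x = Re (\<Sum>i\<in>I. \<Sum>j\<in>I - {i}. cnj (x i) * B i j * x j)" for x
    define Z where "Z x = (\<Sum>i\<in>I. Re (B i i) * ((cmod (x i))\<^sup>2 - 1))" for x
    have Ym: "Y \<in> borel_measurable ?M"
    proof -
      have [measurable]: "(\<lambda>x. \<Sum>i\<in>I. \<Sum>j\<in>I - {i}. cnj (x i) * B i j * x j) \<in> borel_measurable ?M"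
        by (intro measurable_quadratic) auto
      show ?thesis unfolding Y_def[abs_def] by measurable
    qed
    have Zm: "Z \<in> borel_measurable ?M"
    proof -
      have "(\<lambda>x. Re (B i i) * ((cmod (x i))\<^sup>2 - 1)) \<in> borel_measurable ?M" if "i \<in> I" for i
      proof -
        have [measurable]: "(\<lambda>x. x i) \<in> borel_measurable ?M" using that by (rule measurable_coord)
        show ?thesis by measurable
      qed
      then show ?thesis unfolding Z_def[abs_def] by (intro borel_measurable_sum)
    qed
    have split: "Re ((\<Sum>i\<in>I. \<Sum>j\<in>I. cnj (x i) * B i j * x j) - (\<Sum>i\<in>I. B i i)) = Y x + Z x" for x
    proof -
      have "(\<Sum>i\<in>I. \<Sum>j\<in>I. cnj (x i) * B i j * x j)
          = (\<Sum>i\<in>I. cnj (x i) * B i i * x i + (\<Sum>j\<in>I - {i}. cnj (x i) * B i j * x j))"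
        using I by (intro sum.cong refl sum.remove) auto
      moreover have "Re (cnj (x i) * B i i * x i) = Re (B i i) * (cmod (x i))\<^sup>2" for i
      proof -
        have "cnj (x i) * B i i * x i = B i i * of_real ((cmod (x i))\<^sup>2)"
          unfolding complex_norm_square by (simp add: mult_ac)
        then show ?thesis by (simp only: Re_complex_of_real times_complex.sel complex.sel Im_complex_of_real mult_zero_right diff_zero)
      qed
      ultimately show ?thesis
        by (simp add: Y_def Z_def sum.distrib right_diff_distrib sum_subtractf del: times_complex.sel complex_cnj_mult)
    qed
    have ent: "\<bar>Re (B i i)\<bar> \<le> K" if "i \<in> I" for i
      using op_bound_entry[OF op K I that that] abs_Re_le_cmod[of "B i i"] by linarith
    have fin: "exp (real (card I) * E - l * (\<delta> / 2 * real (card I))) \<le> exp (- (l * \<delta> / 4) * card I)"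
      if "E \<le> l\<^sup>2 * A" for E
    proof -
      have "l * (l * A) \<le> l * (\<delta> / 4)" using l by (intro mult_left_mono) auto
      then have "E \<le> l * \<delta> / 4" using that by (simp add: power2_eq_square mult.assoc)
      then have "real (card I) * E \<le> real (card I) * (l * \<delta> / 4)" by (intro mult_left_mono) auto
      then show ?thesis by (simp add: algebra_simps)
    qed
    have PY: "measure ?M {x \<in> space ?M. \<delta> / 2 * card I \<le> Y x} \<le> exp (- (l * \<delta> / 4) * card I)"
    proof -
      have "measure ?M {x \<in> space ?M. \<delta> / 2 * card I \<le> Y x} \<le> exp (card I * (D * (8 * c * l\<^sup>2 * K\<^sup>2) / s) - l * (\<delta> / 2 * card I))"
        using off_diagonal_exp_bound[OF I op l(2)] l(1) unfolding Y_def[symmetric]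
        by (intro chernoff_bound[OF prob_space_PiM_law Ym]) auto
      also have "\<dots> \<le> exp (- (l * \<delta> / 4) * card I)"
      proof (rule fin)
        have "l\<^sup>2 * (D * (8 * c * K\<^sup>2) / s) \<le> l\<^sup>2 * A" by (intro mult_left_mono A1) simp
        then show "D * (8 * c * l\<^sup>2 * K\<^sup>2) / s \<le> l\<^sup>2 * A" by (simp add: mult_ac)
      qed
      finally show ?thesis .
    qed
    have PZ: "measure ?M {x \<in> space ?M. \<delta> / 2 * card I \<le> Z x} \<le> exp (- (l * \<delta> / 4) * card I)"
    proof -
      have "measure ?M {x \<in> space ?M. \<delta> / 2 * card I \<le> Z x} \<le> exp (card I * (8 * exp s * D / s\<^sup>2 * (l * K)\<^sup>2) - l * (\<delta> / 2 * card I))"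
      proof (rule chernoff_bound[OF prob_space_PiM_law Zm _ l(1)])
        show "(\<integral>\<^sup>+x. ennreal (exp (l * Z x)) \<partial>?M) \<le> ennreal (exp (card I * (8 * exp s * D / s\<^sup>2 * (l * K)\<^sup>2)))"
          unfolding Z_def using l by (intro diagonal_exp_bound I ent K) auto
      qed
      also have "\<dots> \<le> exp (- (l * \<delta> / 4) * card I)"
      proof (rule fin)
        have "l\<^sup>2 * (8 * exp s * D / s\<^sup>2 * K\<^sup>2) \<le> l\<^sup>2 * A" by (intro mult_left_mono A1) simp
        then show "8 * exp s * D / s\<^sup>2 * (l * K)\<^sup>2 \<le> l\<^sup>2 * A" by (simp add: mult_ac power_mult_distrib)
      qed
      finally show ?thesis .
    qed
    have "measure ?M {x \<in> space ?M. \<delta> * card I \<le> Y x + Z x}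
       \<le> measure ?M ({x \<in> space ?M. \<delta> / 2 * card I \<le> Y x} \<union> {x \<in> space ?M. \<delta> / 2 * card I \<le> Z x})"
    proof (rule M.finite_measure_mono)
      show "{x \<in> space ?M. \<delta> * card I \<le> Y x + Z x} \<subseteq> {x \<in> space ?M. \<delta> / 2 * card I \<le> Y x} \<union> {x \<in> space ?M. \<delta> / 2 * card I \<le> Z x}"
      proof
        fix x assume "x \<in> {x \<in> space ?M. \<delta> * card I \<le> Y x + Z x}"
        moreover have "\<delta> / 2 * card I + \<delta> / 2 * card I = \<delta> * card I" by simp
        ultimately show "x \<in> {x \<in> space ?M. \<delta> / 2 * card I \<le> Y x} \<union> {x \<in> space ?M. \<delta> / 2 * card I \<le> Z x}"
          by (cases "\<delta> / 2 * card I \<le> Y x") auto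
      qed
      show "{x \<in> space ?M. \<delta> / 2 * card I \<le> Y x} \<union> {x \<in> space ?M. \<delta> / 2 * card I \<le> Z x} \<in> sets ?M"
        using Ym Zm by measurable
    qed
    also have "\<dots> \<le> measure ?M {x \<in> space ?M. \<delta> / 2 * card I \<le> Y x} + measure ?M {x \<in> space ?M. \<delta> / 2 * card I \<le> Z x}"
      using Ym Zm by (intro measure_subadditive) (auto simp: M.emeasure_eq_measure)
    finally show "measure ?M {x \<in> space ?M.
      \<delta> * card I \<le> Re ((\<Sum>i\<in>I. \<Sum>j\<in>I. cnj (x i) * B i j * x j) - (\<Sum>i\<in>I. B i i))} \<le> 2 * exp (- (l * \<delta> / 4) * card I)"
      unfolding split using PY PZ by linarith
  qed
qed

lemma op_bound_unit:
  assumes "op_bound I B K" "cmod u = 1"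
  shows "op_bound I (\<lambda>i j. u * B i j) K"
proof -
  have "cmod (\<Sum>j\<in>I. u * B i j * y j) = cmod (\<Sum>j\<in>I. B i j * y j)" for i y
    using assms(2) by (simp add: mult.assoc sum_distrib_left[symmetric] norm_mult)
  then show ?thesis using assms(1) by (simp add: op_bound_def)
qed

text \<open>A complex number of modulus a has real or imaginary part of size at least a/2, so the
  one-sided bound is used at level \<delta>/2 for the form rotated by 1, -1, i and -i; whence 8 = 4
  * 2.\<close>

lemma quadratic_form_concentration:
  fixes K \<delta> :: real
  assumes K: "0 \<le> K" and \<delta>: "0 < \<delta>"
  shows "\<exists>\<kappa>>0::real. \<forall>(I::'i set) B. finite I \<longrightarrow> op_bound I B K \<longrightarrow>
    measure (PiM I (\<lambda>_. \<nu>)) {x \<in> space (PiM I (\<lambda>_. \<nu>)).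
      \<delta> * card I \<le> cmod ((\<Sum>i\<in>I. \<Sum>j\<in>I. cnj (x i) * B i j * x j) - (\<Sum>i\<in>I. B i i))} \<le> 8 * exp (- \<kappa> * card I)"
proof -
  have "0 < \<delta> / 2" using \<delta> by simp
  from quadratic_form_tail[where 'i = 'i, OF K this]
  obtain \<kappa> :: real where \<kappa>: "\<kappa> > 0" "\<And>(I::'i set) B. finite I \<Longrightarrow> op_bound I B K \<Longrightarrow>
    measure (PiM I (\<lambda>_. \<nu>)) {x \<in> space (PiM I (\<lambda>_. \<nu>)).
      \<delta> / 2 * card I \<le> Re ((\<Sum>i\<in>I. \<Sum>j\<in>I. cnj (x i) * B i j * x j) - (\<Sum>i\<in>I. B i i))} \<le> 2 * exp (- \<kappa> * card I)"
    by meson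
  show ?thesis
  proof (intro exI[of _ \<kappa>] conjI allI impI)
    fix I :: "'i set" and B assume I: "finite I" and op: "op_bound I B K"
    let ?M = "PiM I (\<lambda>_. \<nu>)"
    interpret M: prob_space ?M by (rule prob_space_PiM_law)
    define w where "w x = (\<Sum>i\<in>I. \<Sum>j\<in>I. cnj (x i) * B i j * x j) - (\<Sum>i\<in>I. B i i)" for x
    define E where "E u = {x \<in> space ?M. \<delta> / 2 * card I \<le> Re (u * w x)}" for u
    have [measurable]: "w \<in> borel_measurable ?M"
    proof -
      have [measurable]: "(\<lambda>x. \<Sum>i\<in>I. \<Sum>j\<in>I. cnj (x i) * B i j * x j) \<in> borel_measurable ?M"
        by (intro measurable_quadratic) auto
      show ?thesis unfolding w_def[abs_def] by measurable
    qed
    have Em: "E u \<in> sets ?M" for u unfolding E_def by measurable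
    have PE: "measure ?M (E u) \<le> 2 * exp (- \<kappa> * card I)" if "cmod u = 1" for u
    proof -
      have "u * w x = (\<Sum>i\<in>I. \<Sum>j\<in>I. cnj (x i) * (u * B i j) * x j) - (\<Sum>i\<in>I. u * B i i)" for x
        unfolding w_def by (simp add: right_diff_distrib sum_distrib_left mult_ac)
      then show ?thesis unfolding E_def using \<kappa>(2)[OF I op_bound_unit[OF op that]] by simp
    qed
    have "measure ?M {x \<in> space ?M. \<delta> * card I \<le> cmod (w x)} \<le> measure ?M (\<Union>u\<in>{1, -1, \<i>, -\<i>}. E u)"
    proof (rule M.finite_measure_mono)
      show "{x \<in> space ?M. \<delta> * card I \<le> cmod (w x)} \<subseteq> (\<Union>u\<in>{1, -1, \<i>, -\<i>}. E u)"
      proof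
        fix x assume x: "x \<in> {x \<in> space ?M. \<delta> * card I \<le> cmod (w x)}"
        then have "\<delta> * card I \<le> \<bar>Re (w x)\<bar> + \<bar>Im (w x)\<bar>" using cmod_le[of "w x"] by auto
        then have "\<delta> / 2 * card I \<le> \<bar>Re (w x)\<bar> \<or> \<delta> / 2 * card I \<le> \<bar>Im (w x)\<bar>" by (auto simp: field_simps)
        then show "x \<in> (\<Union>u\<in>{1, -1, \<i>, -\<i>}. E u)" using x by (auto simp: E_def abs_if split: if_splits)
      qed
    qed (use Em in auto)
    also have "\<dots> \<le> (\<Sum>u\<in>{1, -1, \<i>, -\<i>}. measure ?M (E u))"
      using Em by (intro measure_subadditive_finite) (auto simp: M.emeasure_eq_measure)
    also have "\<dots> \<le> (\<Sum>u\<in>{1, -1, \<i>, -\<i>}. 2 * exp (- \<kappa> * card I))"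
      by (intro sum_mono PE) auto
    also have "\<dots> = 8 * exp (- \<kappa> * card I)" by (simp add: complex_eq_iff)
    finally show "measure ?M {x \<in> space ?M.
      \<delta> * card I \<le> cmod ((\<Sum>i\<in>I. \<Sum>j\<in>I. cnj (x i) * B i j * x j) - (\<Sum>i\<in>I. B i i))} \<le> 8 * exp (- \<kappa> * card I)"
      unfolding w_def .
  qed (rule \<kappa>(1))
qed

end

section \<open>Concentration of spectral forms\<close>

text \<open>Inner probabilities: no measurability of \<open>P n\<close> is needed for \<open>whp\<close> to be closed under
  conjunction and weakening.\<close>
definition whp :: "(nat \<Rightarrow> 'a measure) \<Rightarrow> (nat \<Rightarrow> 'a \<Rightarrow> bool) \<Rightarrow> bool" where
  "whp M P \<longleftrightarrow> (\<exists>C \<kappa>. 0 < C \<and> 0 < \<kappa> \<and>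
     (\<forall>n. \<exists>S\<in>sets (M n). (\<forall>x\<in>S. P n x) \<and> 1 - C * exp (- \<kappa> * real n) \<le> measure (M n) S))"

lemma whpI:
  assumes \<kappa>: "0 < \<kappa>" and ev: "eventually (\<lambda>n. \<exists>S\<in>sets (M n). (\<forall>x\<in>S. P n x) \<and> 1 - C * exp (- \<kappa> * real n) \<le> measure (M n) S) sequentially"
  shows "whp M P"
proof -
  obtain N where N: "\<And>n. N \<le> n \<Longrightarrow> \<exists>S\<in>sets (M n). (\<forall>x\<in>S. P n x) \<and> 1 - C * exp (- \<kappa> * real n) \<le> measure (M n) S"
    using ev by (auto simp: eventually_sequentially)
  \<comment> \<open>Below \<open>N\<close> this constant makes the required lower bound nonpositive,
    so the empty set is a valid witness there.\<close>
  define C' where "C' = max (max C 1) (exp (\<kappa> * real N))"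
  show ?thesis
    unfolding whp_def
  proof (rule exI[of _ C'], rule exI[of _ \<kappa>], intro conjI allI)
    show "0 < C'" by (simp add: C'_def)
    fix n
    show "\<exists>S\<in>sets (M n). (\<forall>x\<in>S. P n x) \<and> 1 - C' * exp (- \<kappa> * real n) \<le> measure (M n) S"
    proof (cases "N \<le> n")
      case True
      have "C * exp (- \<kappa> * real n) \<le> C' * exp (- \<kappa> * real n)" by (intro mult_right_mono) (auto simp: C'_def)
      then show ?thesis using N[OF True] by (meson diff_left_mono order_trans)
    next
      case False
      then have "\<kappa> * real n \<le> \<kappa> * real N" using \<kappa> by (intro mult_left_mono) auto
      then have "1 \<le> exp (\<kappa> * real N) * exp (- \<kappa> * real n)" by (simp add: mult_exp_exp)
      also have "\<dots> \<le> C' * exp (- \<kappa> * real n)" by (intro mult_right_mono) (auto simp: C'_def)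
      finally show ?thesis by (intro bexI[of _ "{}"]) auto
    qed
  qed (rule \<kappa>)
qed

lemma whp_mono:
  assumes "whp M P" and ev: "eventually (\<lambda>n. \<forall>x\<in>space (M n). P n x \<longrightarrow> Q n x) sequentially"
  shows "whp M Q"
proof -
  obtain C \<kappa> where *: "0 < \<kappa>" "\<And>n. \<exists>S\<in>sets (M n). (\<forall>x\<in>S. P n x) \<and> 1 - C * exp (- \<kappa> * real n) \<le> measure (M n) S"
    using assms(1) by (auto simp: whp_def)
  show ?thesis
  proof (rule whpI[OF *(1), where C = C])
    show "eventually (\<lambda>n. \<exists>S\<in>sets (M n). (\<forall>x\<in>S. Q n x) \<and> 1 - C * exp (- \<kappa> * real n) \<le> measure (M n) S) sequentially"
      using ev
    proof eventually_elim
      case (elim n)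
      obtain S where S: "S \<in> sets (M n)" "\<forall>x\<in>S. P n x" "1 - C * exp (- \<kappa> * real n) \<le> measure (M n) S"
        using *(2) by blast
      have "\<forall>x\<in>S. Q n x" using elim S sets.sets_into_space[OF S(1)] by blast
      then show ?case using S by blast
    qed
  qed
qed

lemma whp_conj:
  assumes M: "\<And>n. prob_space (M n)" and "whp M P" "whp M Q"
  shows "whp M (\<lambda>n x. P n x \<and> Q n x)"
proof -
  obtain C \<kappa> where P: "0 < C" "0 < \<kappa>" "\<And>n. \<exists>S\<in>sets (M n). (\<forall>x\<in>S. P n x) \<and> 1 - C * exp (- \<kappa> * real n) \<le> measure (M n) S"
    using assms(2) by (auto simp: whp_def)
  obtain C' \<kappa>' where Q: "0 < C'" "0 < \<kappa>'" "\<And>n. \<exists>S\<in>sets (M n). (\<forall>x\<in>S. Q n x) \<and> 1 - C' * exp (- \<kappa>' * real n) \<le> measure (M n) S"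
    using assms(3) by (auto simp: whp_def)
  show ?thesis
  proof (rule whpI[where \<kappa> = "min \<kappa> \<kappa>'" and C = "C + C'"])
    show "0 < min \<kappa> \<kappa>'" using P Q by simp
    show "eventually (\<lambda>n. \<exists>S\<in>sets (M n). (\<forall>x\<in>S. P n x \<and> Q n x) \<and> 1 - (C + C') * exp (- min \<kappa> \<kappa>' * real n) \<le> measure (M n) S) sequentially"
    proof (intro always_eventually allI)
      fix n
      interpret prob_space "M n" by (rule M)
      obtain S where S: "S \<in> sets (M n)" "\<forall>x\<in>S. P n x" "1 - C * exp (- \<kappa> * real n) \<le> measure (M n) S"
        using P(3) by blast
      obtain T where T: "T \<in> sets (M n)" "\<forall>x\<in>T. Q n x" "1 - C' * exp (- \<kappa>' * real n) \<le> measure (M n) T"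
        using Q(3) by blast
      have "measure (M n) (S \<union> T) = measure (M n) S + measure (M n) T - measure (M n) (S \<inter> T)"
        using S T by (intro measure_Un3) (auto simp: fmeasurable_eq_sets)
      moreover have "measure (M n) (S \<union> T) \<le> 1" by (rule prob_le_1)
      moreover have "min \<kappa> \<kappa>' * real n \<le> \<kappa> * real n" "min \<kappa> \<kappa>' * real n \<le> \<kappa>' * real n"
        by (intro mult_right_mono; simp)+
      then have "C * exp (- \<kappa> * real n) \<le> C * exp (- min \<kappa> \<kappa>' * real n)"
        "C' * exp (- \<kappa>' * real n) \<le> C' * exp (- min \<kappa> \<kappa>' * real n)"
        using P(1) Q(1) by simp_all
      ultimately have "1 - (C + C') * exp (- min \<kappa> \<kappa>' * real n) \<le> measure (M n) (S \<inter> T)"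
        using S(3) T(3) unfolding distrib_right by linarith
      then show "\<exists>S\<in>sets (M n). (\<forall>x\<in>S. P n x \<and> Q n x) \<and> 1 - (C + C') * exp (- min \<kappa> \<kappa>' * real n) \<le> measure (M n) S"
        using S T by (intro bexI[of _ "S \<inter> T"]) auto
    qed
  qed
qed

lemma whp_ball_finite:
  assumes M: "\<And>n. prob_space (M n)" and "finite A" and "\<And>a. a \<in> A \<Longrightarrow> whp M (P a)"
  shows "whp M (\<lambda>n x. \<forall>a\<in>A. P a n x)"
  using assms(2,3)
proof (induction A)
  case empty
  show ?case
  proof (rule whpI[of 1 _ _ 0])
    show "eventually (\<lambda>n. \<exists>S\<in>sets (M n). (\<forall>x\<in>S. \<forall>a\<in>{}. P a n x) \<and> 1 - 0 * exp (- 1 * real n) \<le> measure (M n) S) sequentially"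
      by (intro always_eventually allI bexI[of _ "space (M n)" for n]) (auto simp: prob_space.prob_space[OF M])
  qed simp
next
  case (insert a A)
  then have "whp M (\<lambda>n x. P a n x \<and> (\<forall>a\<in>A. P a n x))" by (intro whp_conj M) auto
  then show ?case by simp
qed

lemma whp_overwhelming:
  assumes M: "\<And>n. prob_space (M n)" and P: "whp M P" and meas: "\<And>n. {x \<in> space (M n). P n x} \<in> sets (M n)"
  shows "overwhelming (\<lambda>n. measure (M n) {x \<in> space (M n). P n x})"
proof -
  obtain C \<kappa> where C: "0 < C" "0 < \<kappa>" "\<And>n. \<exists>S\<in>sets (M n). (\<forall>x\<in>S. P n x) \<and> 1 - C * exp (- \<kappa> * real n) \<le> measure (M n) S"
    using P by (auto simp: whp_def)
  define C' where "C' = C * exp (1 / (4 * \<kappa>))"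
  show ?thesis
    unfolding overwhelming_def
  proof (rule exI[of _ C'], rule exI[of _ "1/2"], intro conjI allI)
    fix n
    interpret prob_space "M n" by (rule M)
    obtain S where S: "S \<in> sets (M n)" "\<forall>x\<in>S. P n x" "1 - C * exp (- \<kappa> * real n) \<le> measure (M n) S"
      using C(3) by blast
    have "measure (M n) S \<le> measure (M n) {x \<in> space (M n). P n x}"
      using S sets.sets_into_space[OF S(1)] by (intro finite_measure_mono meas) auto
    moreover have "C * exp (- \<kappa> * real n) \<le> C' * exp (- (real n powr (1/2)))"
    proof -
      define y where "y = sqrt (real n)"
      have y: "real n = y\<^sup>2" "real n powr (1/2) = y" unfolding y_def by (simp_all add: powr_half_sqrt)
      have "0 \<le> (2 * \<kappa> * y - 1)\<^sup>2 / (4 * \<kappa>)" using C by simp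
      also have "\<dots> = \<kappa> * y\<^sup>2 - y + 1 / (4 * \<kappa>)"
        using C by (simp add: power2_eq_square field_simps)
      finally have "- \<kappa> * real n \<le> 1 / (4 * \<kappa>) - real n powr (1/2)" unfolding y(2) unfolding y(1) by simp
      then have "exp (- \<kappa> * real n) \<le> exp (1 / (4 * \<kappa>) - real n powr (1/2))" by simp
      also have "\<dots> = exp (1 / (4 * \<kappa>)) * exp (- (real n powr (1/2)))" by (simp add: mult_exp_exp)
      finally show ?thesis using C unfolding C'_def by (simp add: mult.assoc)
    qed
    ultimately show "1 - C' * exp (- (real n powr (1/2))) \<le> measure (M n) {x \<in> space (M n). P n x}"
      using S(3) by linarith
  qed (use C in \<open>auto simp: C'_def\<close>)
qed

lemma nrm2_spectral:
  assumes e: "orthonormal n n e"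
  shows "nrm2 n (\<lambda>i. \<Sum>l<n. (of_real (h l) * ip n (e l) y) * e l i) = (\<Sum>l<n. (h l)\<^sup>2 * (cmod (ip n (e l) y))\<^sup>2)"
  unfolding parseval_nrm2[OF e]
proof (rule sum.cong[OF refl])
  fix k assume k: "k \<in> {..<n}"
  have "ip n (e k) (\<lambda>i. \<Sum>l<n. (of_real (h l) * ip n (e l) y) * e l i)
    = (\<Sum>l<n. (of_real (h l) * ip n (e l) y) * (if l = k then 1 else 0))"
    unfolding ip_sum_right using e k by (intro sum.cong) (auto simp: orthonormal_def)
  also have "\<dots> = of_real (h k) * ip n (e k) y" using k by (subst sum.remove[of _ k]) auto
  finally show "(cmod (ip n (e k) (\<lambda>i. \<Sum>l<n. (of_real (h l) * ip n (e l) y) * e l i)))\<^sup>2 = (h k)\<^sup>2 * (cmod (ip n (e k) y))\<^sup>2"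
    by (simp add: norm_mult power_mult_distrib)
qed

text \<open>The function \<open>h\<close> of a Hermitian matrix with eigenbasis \<open>e\<close>, in
  coordinates. It links \<open>sf\<close>, which lives in the eigenbasis, to quadratic forms in the
  independent coordinates.\<close>

definition spectral_mat :: "nat \<Rightarrow> (nat \<Rightarrow> nat \<Rightarrow> complex) \<Rightarrow> (nat \<Rightarrow> real) \<Rightarrow> nat \<Rightarrow> nat \<Rightarrow> complex" where
  "spectral_mat n e h i j = (\<Sum>l<n. of_real (h l) * e l i * cnj (e l j))"

lemma spectral_mat_mult: "(\<Sum>j<n. spectral_mat n e h i j * y j) = (\<Sum>l<n. (of_real (h l) * ip n (e l) y) * e l i)"
  unfolding spectral_mat_def ip_def sum_distrib_right sum_distrib_left
  by (subst sum.swap) (simp add: mult_ac)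

lemma spectral_mat_form: "(\<Sum>i<n. \<Sum>j<n. cnj (x i) * spectral_mat n e h i j * y j) = sf n e h x y"
proof -
  have "(\<Sum>i<n. \<Sum>j<n. cnj (x i) * spectral_mat n e h i j * y j) = ip n x (\<lambda>i. \<Sum>l<n. (of_real (h l) * ip n (e l) y) * e l i)"
    unfolding ip_def[of n x] spectral_mat_mult[symmetric] by (simp add: sum_distrib_left mult.assoc)
  also have "\<dots> = (\<Sum>l<n. (of_real (h l) * ip n (e l) y) * cnj (ip n (e l) x))"
    by (simp add: ip_sum_right ip_cnj)
  finally show ?thesis by (simp add: sf_def mult_ac)
qed

lemma spectral_mat_trace:
  assumes e: "orthonormal n n e"
  shows "(\<Sum>i<n. spectral_mat n e h i i) = of_real (\<Sum>l<n. h l)"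
proof -
  have "(\<Sum>i<n. spectral_mat n e h i i) = (\<Sum>l<n. of_real (h l) * ip n (e l) (e l))"
    unfolding spectral_mat_def ip_def sum_distrib_left by (subst sum.swap) (simp add: mult_ac)
  also have "\<dots> = (\<Sum>l<n. of_real (h l))" using e by (simp add: orthonormal_def)
  finally show ?thesis by simp
qed

text \<open>Placing an n by n matrix in block (j, k) of an rn by rn matrix turns a sesquilinear form
  in the vectors \<open>j\<close> and \<open>k\<close> into a quadratic form in the whole sample.
  One concentration bound then covers j = k and j \<noteq> k alike: the trace is that of
  \<open>A\<close> or 0.\<close>

definition block_mat :: "nat \<Rightarrow> nat \<Rightarrow> (nat \<Rightarrow> nat \<Rightarrow> complex) \<Rightarrow> nat \<times> nat \<Rightarrow> nat \<times> nat \<Rightarrow> complex" where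
  "block_mat j k A p q = (if fst p = j \<and> fst q = k then A (snd p) (snd q) else 0)"

lemma sum_block:
  fixes j r n :: nat
  assumes "j \<in> {1..r}"
  shows "(\<Sum>p\<in>{1..r} \<times> {..<n}. if fst p = j then f (snd p) else 0) = (\<Sum>i<n. f i)"
proof -
  have "(\<Sum>p\<in>{1..r} \<times> {..<n}. if fst p = j then f (snd p) else 0) = (\<Sum>a\<in>{1..r}. \<Sum>i<n. if a = j then f i else 0)"
    by (simp add: sum.cartesian_product case_prod_beta)
  also have "\<dots> = (\<Sum>a\<in>{1..r}. if a = j then \<Sum>i<n. f i else 0)" by (intro sum.cong) auto
  also have "\<dots> = (\<Sum>i<n. f i)" using assms by simp
  finally show ?thesis .
qed

lemma block_mult:
  assumes "k \<in> {1..r}"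
  shows "(\<Sum>q\<in>{1..r} \<times> {..<n}. block_mat j k A p q * y q) = (if fst p = j then \<Sum>i<n. A (snd p) i * y (k, i) else 0)"
proof -
  have "(\<Sum>q\<in>{1..r} \<times> {..<n}. block_mat j k A p q * y q)
    = (if fst p = j then (\<Sum>q\<in>{1..r} \<times> {..<n}. if fst q = k then A (snd p) (snd q) * y (k, snd q) else 0) else 0)"
    by (auto simp: block_mat_def intro!: sum.cong sum.neutral)
  then show ?thesis using sum_block[OF assms, of "\<lambda>i. A (snd p) i * y (k, i)" n] by simp
qed

lemma block_form:
  assumes "j \<in> {1..r}" "k \<in> {1..r}"
  shows "(\<Sum>p\<in>{1..r} \<times> {..<n}. \<Sum>q\<in>{1..r} \<times> {..<n}. cnj (x p) * block_mat j k A p q * x q)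
    = (\<Sum>i<n. \<Sum>i'<n. cnj (x (j, i)) * A i i' * x (k, i'))"
proof -
  have "(\<Sum>p\<in>{1..r} \<times> {..<n}. \<Sum>q\<in>{1..r} \<times> {..<n}. cnj (x p) * block_mat j k A p q * x q)
    = (\<Sum>p\<in>{1..r} \<times> {..<n}. if fst p = j then \<Sum>i'<n. cnj (x (j, snd p)) * A (snd p) i' * x (k, i') else 0)"
  proof (rule sum.cong[OF refl])
    fix p
    have "(\<Sum>q\<in>{1..r} \<times> {..<n}. cnj (x p) * block_mat j k A p q * x q)
        = cnj (x p) * (\<Sum>q\<in>{1..r} \<times> {..<n}. block_mat j k A p q * x q)"
      by (simp add: sum_distrib_left mult.assoc)
    also have "\<dots> = (if fst p = j then \<Sum>i'<n. cnj (x (j, snd p)) * A (snd p) i' * x (k, i') else 0)"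
      unfolding block_mult[OF assms(2)] by (cases p) (simp add: sum_distrib_left mult.assoc)
    finally show "(\<Sum>q\<in>{1..r} \<times> {..<n}. cnj (x p) * block_mat j k A p q * x q) = \<dots>" .
  qed
  then show ?thesis using sum_block[OF assms(1), of "\<lambda>i. \<Sum>i'<n. cnj (x (j, i)) * A i i' * x (k, i')" n] by simp
qed

lemma block_trace:
  assumes "j \<in> {1..r}"
  shows "(\<Sum>p\<in>{1..r} \<times> {..<n}. block_mat j k A p p) = (if j = k then \<Sum>i<n. A i i else 0)"
proof (cases "j = k")
  case True
  then show ?thesis using sum_block[OF assms, of "\<lambda>i. A i i" n] by (simp add: block_mat_def)
next
  case False
  then show ?thesis by (auto simp: block_mat_def intro!: sum.neutral)
qed

lemma block_op_bound:
  assumes e: "orthonormal n n e" and h: "\<And>l. l < n \<Longrightarrow> \<bar>h l\<bar> \<le> K" and jk: "j \<in> {1..r}" "k \<in> {1..r}"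
  shows "op_bound ({1..r} \<times> {..<n}) (block_mat j k (spectral_mat n e h)) K"
  unfolding op_bound_def
proof
  fix y :: "nat \<times> nat \<Rightarrow> complex"
  let ?y = "\<lambda>i. y (k, i)"
  have "(\<Sum>p\<in>{1..r} \<times> {..<n}. (cmod (\<Sum>q\<in>{1..r} \<times> {..<n}. block_mat j k (spectral_mat n e h) p q * y q))\<^sup>2)
    = (\<Sum>p\<in>{1..r} \<times> {..<n}. if fst p = j then (cmod (\<Sum>i<n. spectral_mat n e h (snd p) i * y (k, i)))\<^sup>2 else 0)"
    unfolding block_mult[OF jk(2)] by (intro sum.cong) auto
  also have "\<dots> = nrm2 n (\<lambda>i. \<Sum>l<n. (of_real (h l) * ip n (e l) ?y) * e l i)"
    unfolding nrm2_def spectral_mat_mult[symmetric]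
    by (rule sum_block[OF jk(1), of "\<lambda>i. (cmod (\<Sum>i'<n. spectral_mat n e h i i' * y (k, i')))\<^sup>2" n])
  also have "\<dots> = (\<Sum>l<n. (h l)\<^sup>2 * (cmod (ip n (e l) ?y))\<^sup>2)" by (rule nrm2_spectral[OF e])
  also have "\<dots> \<le> (\<Sum>l<n. K\<^sup>2 * (cmod (ip n (e l) ?y))\<^sup>2)"
  proof (intro sum_mono mult_right_mono)
    fix l assume "l \<in> {..<n}"
    then show "(h l)\<^sup>2 \<le> K\<^sup>2" using h[of l] by (simp add: abs_le_square_iff[symmetric])
  qed simp
  also have "\<dots> = K\<^sup>2 * nrm2 n ?y" by (simp add: parseval_nrm2[OF e] sum_distrib_left)
  also have "nrm2 n ?y \<le> (\<Sum>q\<in>{1..r} \<times> {..<n}. (cmod (y q))\<^sup>2)"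
    unfolding nrm2_def sum_block[OF jk(2), of "\<lambda>i. (cmod (y (k, i)))\<^sup>2" n, symmetric]
    by (intro sum_mono) auto
  finally show "(\<Sum>p\<in>{1..r} \<times> {..<n}. (cmod (\<Sum>q\<in>{1..r} \<times> {..<n}. block_mat j k (spectral_mat n e h) p q * y q))\<^sup>2)
    \<le> K\<^sup>2 * (\<Sum>q\<in>{1..r} \<times> {..<n}. (cmod (y q))\<^sup>2)" by (simp add: mult_left_mono)
qed

context subgaussian_law
begin

lemma prob_space_sample: "prob_space (sample_space \<nu> r n)"
  unfolding sample_space_def by (rule prob_space_PiM_law)

text \<open>The quadratic form in the raw sample is n times the form in the normalised vectors. It
  concentrates around the trace of the block, and the trace divided by n converges to
  \<open>g\<close> if j = k and is 0 otherwise.\<close>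

lemma sf_concentration:
  fixes K g \<epsilon> :: real
  assumes e: "\<And>n. 1 \<le> n \<Longrightarrow> orthonormal n n (e n)"
    and h: "eventually (\<lambda>n. \<forall>l<n. \<bar>h n l\<bar> \<le> K) sequentially" and K: "0 \<le> K"
    and g: "(\<lambda>n. (1 / real n) * (\<Sum>l<n. h n l)) \<longlonglongrightarrow> g" and \<epsilon>: "0 < \<epsilon>" and r: "1 \<le> r"
  shows "whp (sample_space \<nu> r) (\<lambda>n \<omega>. near_scalar r
    (\<lambda>j k. sf n (e n) (h n) (vec_index (vvec n \<omega> j)) (vec_index (vvec n \<omega> k))) g \<epsilon>)"
  unfolding near_scalar_def
proof (intro whp_ball_finite prob_space_sample)
  fix j k assume jk: "j \<in> {1..r}" "k \<in> {1..r}"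
  \<comment> \<open>The sample has r n coordinates while the forms are normalised by n, so
    deviations \<delta> r n amount to \<epsilon>/2; the other \<epsilon>/2 is left for the
    convergence of the normalised trace.\<close>
  define \<delta> where "\<delta> = \<epsilon> / (2 * real r)"
  have \<delta>: "0 < \<delta>" using \<epsilon> r by (simp add: \<delta>_def)
  from quadratic_form_concentration[where 'i = "nat \<times> nat", OF K \<delta>]
  obtain \<kappa> :: real where \<kappa>: "0 < \<kappa>" "\<And>(I::(nat \<times> nat) set) B. finite I \<Longrightarrow> op_bound I B K \<Longrightarrow>
    measure (PiM I (\<lambda>_. \<nu>)) {x \<in> space (PiM I (\<lambda>_. \<nu>)).
      \<delta> * card I \<le> cmod ((\<Sum>i\<in>I. \<Sum>j\<in>I. cnj (x i) * B i j * x j) - (\<Sum>i\<in>I. B i i))} \<le> 8 * exp (- \<kappa> * card I)"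
    by meson
  show "whp (sample_space \<nu> r) (\<lambda>n \<omega>. cmod (sf n (e n) (h n) (vec_index (vvec n \<omega> j)) (vec_index (vvec n \<omega> k)) - (if j = k then of_real g else 0)) \<le> \<epsilon>)"
  proof (rule whpI[OF \<kappa>(1), where C = 8])
    have "eventually (\<lambda>n. \<bar>(1 / real n) * (\<Sum>l<n. h n l) - g\<bar> < \<epsilon> / 2) sequentially"
      using tendstoD[OF g, of "\<epsilon> / 2"] \<epsilon> by (simp add: dist_real_def)
    moreover have "eventually (\<lambda>n::nat. 1 \<le> n) sequentially" by (rule eventually_ge_at_top)
    ultimately show "eventually (\<lambda>n. \<exists>S\<in>sets (sample_space \<nu> r n). (\<forall>\<omega>\<in>S.
      cmod (sf n (e n) (h n) (vec_index (vvec n \<omega> j)) (vec_index (vvec n \<omega> k)) - (if j = k then of_real g else 0)) \<le> \<epsilon>)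
      \<and> 1 - 8 * exp (- \<kappa> * real n) \<le> measure (sample_space \<nu> r n) S) sequentially"
      using h
    proof eventually_elim
      case (elim n)
      let ?I = "{1..r} \<times> {..<n}"
      let ?M = "PiM ?I (\<lambda>_. \<nu>)"
      interpret M: prob_space ?M by (rule prob_space_PiM_law)
      note en = e[OF elim(2)]
      define B where "B = block_mat j k (spectral_mat n (e n) (h n))"
      have op: "op_bound ?I B K" unfolding B_def using elim(3) by (intro block_op_bound[OF en _ jk]) auto
      define w where "w x = (\<Sum>p\<in>?I. \<Sum>q\<in>?I. cnj (x p) * B p q * x q) - (\<Sum>p\<in>?I. B p p)" for x
      define T where "T = {x \<in> space ?M. \<delta> * card ?I \<le> cmod (w x)}"
      have [measurable]: "w \<in> borel_measurable ?M"
      proof -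
        have [measurable]: "(\<lambda>x. \<Sum>p\<in>?I. \<Sum>q\<in>?I. cnj (x p) * B p q * x q) \<in> borel_measurable ?M"
          by (intro measurable_quadratic) auto
        show ?thesis unfolding w_def[abs_def] by measurable
      qed
      have T: "T \<in> sets ?M" unfolding T_def by measurable
      have card: "real (card ?I) = real r * real n" by (simp add: card_cartesian_product)
      have "measure ?M T \<le> 8 * exp (- \<kappa> * card ?I)" unfolding T_def w_def by (rule \<kappa>(2)[OF _ op]) simp
      also have "\<dots> \<le> 8 * exp (- \<kappa> * real n)"
      proof -
        have "1 * real n \<le> real r * real n" using r by (intro mult_right_mono) auto
        then have "\<kappa> * real n \<le> \<kappa> * (real r * real n)" using \<kappa>(1) by (intro mult_left_mono) auto
        then show ?thesis unfolding card by simp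
      qed
      finally have mT: "1 - 8 * exp (- \<kappa> * real n) \<le> measure ?M (space ?M - T)"
        using M.prob_compl[OF T] by simp
      have good: "cmod (sf n (e n) (h n) (vec_index (vvec n \<omega> j)) (vec_index (vvec n \<omega> k)) - (if j = k then of_real g else 0)) \<le> \<epsilon>"
        if \<omega>: "\<omega> \<in> space ?M - T" for \<omega>
      proof -
        have n0: "0 < real n" using elim(2) by simp
        have lt: "cmod (w \<omega>) < \<delta> * (real r * real n)" using \<omega> unfolding T_def card[symmetric] by auto
        define tr where "tr = (if j = k then \<Sum>l<n. h n l else 0)"
        have form: "(\<Sum>p\<in>?I. \<Sum>q\<in>?I. cnj (\<omega> p) * B p q * \<omega> q)
          = of_real (real n) * sf n (e n) (h n) (vec_index (vvec n \<omega> j)) (vec_index (vvec n \<omega> k))"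
        proof -
          have sq: "complex_of_real (sqrt (real n)) * complex_of_real (sqrt (real n)) = of_real (real n)"
            unfolding of_real_mult[symmetric] by simp
          have sq0: "complex_of_real (sqrt (real n)) \<noteq> 0" using n0 by simp
          have "sf n (e n) (h n) (vec_index (vvec n \<omega> j)) (vec_index (vvec n \<omega> k))
            = (\<Sum>i<n. \<Sum>i'<n. cnj (\<omega> (j, i)) * spectral_mat n (e n) (h n) i i' * \<omega> (k, i') / of_real (real n))"
            unfolding spectral_mat_form[symmetric] using sq0
            by (intro sum.cong refl) (simp add: vvec_def sq[symmetric] del: of_real_of_nat_eq)
          then show ?thesis unfolding B_def block_form[OF jk] using n0
            by (simp add: sum_divide_distrib[symmetric])
        qed
        have "(\<Sum>p\<in>?I. B p p) = of_real tr"
          unfolding B_def block_trace[OF jk(1)] tr_def using spectral_mat_trace[OF en, of "h n"] by simp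
        then have "w \<omega> = of_real (real n) * (sf n (e n) (h n) (vec_index (vvec n \<omega> j)) (vec_index (vvec n \<omega> k)) - of_real ((1 / real n) * tr))"
          unfolding w_def form using n0 by (simp add: right_diff_distrib)
        then have "cmod (w \<omega>) = real n * cmod (sf n (e n) (h n) (vec_index (vvec n \<omega> j)) (vec_index (vvec n \<omega> k)) - of_real ((1 / real n) * tr))"
          by (simp add: norm_mult del: of_real_mult of_real_divide)
        then have "real n * cmod (sf n (e n) (h n) (vec_index (vvec n \<omega> j)) (vec_index (vvec n \<omega> k)) - of_real ((1 / real n) * tr)) < real n * (\<epsilon> / 2)"
          using lt r unfolding \<delta>_def by (simp add: mult.commute)
        then have 1: "cmod (sf n (e n) (h n) (vec_index (vvec n \<omega> j)) (vec_index (vvec n \<omega> k)) - of_real ((1 / real n) * tr)) < \<epsilon> / 2"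
          using n0 by simp
        have 2: "cmod (of_real ((1 / real n) * tr) - (if j = k then of_real g else 0)) < \<epsilon> / 2"
        proof (cases "j = k")
          case True
          have "of_real ((1 / real n) * tr) - (if j = k then of_real g else 0) = complex_of_real ((1 / real n) * (\<Sum>l<n. h n l) - g)"
            using True by (simp add: tr_def)
          then show ?thesis using elim(1) by (simp only: norm_of_real)
        next
          case False
          then show ?thesis using \<epsilon> by (simp add: tr_def)
        qed
        show ?thesis using norm_triangle_lt[OF add_strict_mono[OF 1 2]] by simp
      qed
      show ?case
        unfolding sample_space_def using good mT T by (intro bexI[of _ "space ?M - T"]) auto
    qed
  qed
qed auto

end

section \<open>Gram--Schmidt orthonormalisation\<close>

definition nnorm :: "nat \<Rightarrow> (nat \<Rightarrow> complex) \<Rightarrow> real" where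
  "nnorm n x = L2_set (\<lambda>i. cmod (x i)) {..<n}"

lemma nnorm_nonneg [simp]: "0 \<le> nnorm n x"
  by (simp add: nnorm_def)

lemma nnorm_power2: "(nnorm n x)\<^sup>2 = nrm2 n x"
  unfolding nnorm_def L2_set_def nrm2_def by (rule real_sqrt_pow2) (simp add: sum_nonneg)

lemma nnorm_triangle: "nnorm n (\<lambda>i. x i + y i) \<le> nnorm n x + nnorm n y"
  unfolding nnorm_def
  by (rule order_trans[OF L2_set_mono L2_set_triangle_ineq]) (auto simp: norm_triangle_ineq)

lemma nnorm_scale: "nnorm n (\<lambda>i. c * x i) = cmod c * nnorm n x"
  unfolding nnorm_def norm_mult by (simp add: L2_set_right_distrib)

lemma nnorm_cong: "(\<And>i. i < n \<Longrightarrow> x i = y i) \<Longrightarrow> nnorm n x = nnorm n y"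
  by (simp add: nnorm_def L2_set_def)

lemma nnorm_diff_commute: "nnorm n (\<lambda>i. x i - y i) = nnorm n (\<lambda>i. y i - x i)"
  by (simp add: nnorm_def norm_minus_commute)

lemma nnorm_triangle_diff: "nnorm n x \<le> nnorm n y + nnorm n (\<lambda>i. x i - y i)"
  using nnorm_triangle[of n y "\<lambda>i. x i - y i"] by simp

lemma nnorm_zero [simp]: "nnorm n (\<lambda>_. 0) = 0"
  by (simp add: nnorm_def L2_set_def)

lemma nnorm_sum: "finite K \<Longrightarrow> nnorm n (\<lambda>i. \<Sum>k\<in>K. f k i) \<le> (\<Sum>k\<in>K. nnorm n (f k))"
proof (induction K rule: finite_induct)
  case (insert k K)
  then show ?case using nnorm_triangle[of n "f k" "\<lambda>i. \<Sum>k\<in>K. f k i"] by simp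
qed simp

lemma sum_mult_le_L2:
  "(\<Sum>i\<in>A. f i * g i) \<le> L2_set f A * L2_set g A"
proof -
  have "(\<Sum>i\<in>A. f i * g i) \<le> (\<Sum>i\<in>A. \<bar>f i\<bar> * \<bar>g i\<bar>)"
    by (intro sum_mono) (metis abs_ge_self abs_mult)
  then show ?thesis using L2_set_mult_ineq[of f g A] by linarith
qed

lemma ip_le_nnorm: "cmod (ip n x y) \<le> nnorm n x * nnorm n y"
proof -
  have "cmod (ip n x y) \<le> (\<Sum>i<n. cmod (x i) * cmod (y i))"
    unfolding ip_def by (rule sum_norm_le) (simp add: norm_mult)
  also have "\<dots> \<le> nnorm n x * nnorm n y" unfolding nnorm_def by (rule sum_mult_le_L2)
  finally show ?thesis .
qed

lemma sf_le_nnorm: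
  assumes e: "orthonormal n n e" and h: "\<And>l. l < n \<Longrightarrow> \<bar>h l\<bar> \<le> K" and K: "0 \<le> K"
  shows "cmod (sf n e h x y) \<le> K * nnorm n x * nnorm n y"
proof -
  have p: "L2_set (\<lambda>l. cmod (ip n (e l) x)) {..<n} = nnorm n x" for x
    unfolding L2_set_def nnorm_def parseval_nrm2[OF e, symmetric] by (simp add: nrm2_def)
  have "cmod (sf n e h x y) \<le> (\<Sum>l<n. K * (cmod (ip n (e l) x) * cmod (ip n (e l) y)))"
    unfolding sf_def
  proof (rule sum_norm_le)
    fix l assume "l \<in> {..<n}"
    then show "cmod (complex_of_real (h l) * cnj (ip n (e l) x) * ip n (e l) y) \<le> K * (cmod (ip n (e l) x) * cmod (ip n (e l) y))"
      using h[of l] by (simp add: norm_mult mult.assoc mult_right_mono)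
  qed
  also have "\<dots> = K * (\<Sum>l<n. cmod (ip n (e l) x) * cmod (ip n (e l) y))" by (simp add: sum_distrib_left)
  also have "\<dots> \<le> K * (nnorm n x * nnorm n y)"
    using sum_mult_le_L2[of "\<lambda>l. cmod (ip n (e l) x)" "\<lambda>l. cmod (ip n (e l) y)" "{..<n}"] K
    unfolding p by (rule mult_left_mono)
  finally show ?thesis by (simp add: mult.assoc)
qed

lemma sf_diff_right: "sf n e h x (\<lambda>i. y i - z i) = sf n e h x y - sf n e h x z"
proof -
  have "ip n (e l) (\<lambda>i. y i - z i) = ip n (e l) y - ip n (e l) z" for l
    by (simp add: ip_def right_diff_distrib sum_subtractf)
  then show ?thesis by (simp add: sf_def right_diff_distrib sum_subtractf)
qed

lemma sf_diff_left: "sf n e h (\<lambda>i. y i - z i) x = sf n e h y x - sf n e h z x"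
proof -
  have "ip n (e l) (\<lambda>i. y i - z i) = ip n (e l) y - ip n (e l) z" for l
    by (simp add: ip_def right_diff_distrib sum_subtractf)
  then show ?thesis by (simp add: sf_def right_diff_distrib left_diff_distrib sum_subtractf)
qed

text \<open>The norm bound 3 covers both the sample vectors, of norm at most 2, and vectors within
  distance 1 of them.\<close>

lemma sf_perturb:
  assumes e: "orthonormal n n e" and h: "\<And>l. l < n \<Longrightarrow> \<bar>h l\<bar> \<le> K" and K: "0 \<le> K"
    and b: "nnorm n x \<le> 3" "nnorm n x' \<le> 3" "nnorm n y \<le> 3" "nnorm n y' \<le> 3"
    and d: "nnorm n (\<lambda>i. x i - x' i) \<le> \<eta>" "nnorm n (\<lambda>i. y i - y' i) \<le> \<eta>"
  shows "cmod (sf n e h x y - sf n e h x' y') \<le> 6 * K * \<eta>"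
proof -
  have "sf n e h x y - sf n e h x' y' = sf n e h (\<lambda>i. x i - x' i) y + sf n e h x' (\<lambda>i. y i - y' i)"
    by (simp add: sf_diff_left sf_diff_right)
  also have "cmod \<dots> \<le> cmod (sf n e h (\<lambda>i. x i - x' i) y) + cmod (sf n e h x' (\<lambda>i. y i - y' i))"
    by (rule norm_triangle_ineq)
  also have "\<dots> \<le> K * nnorm n (\<lambda>i. x i - x' i) * nnorm n y + K * nnorm n x' * nnorm n (\<lambda>i. y i - y' i)"
    by (intro add_mono sf_le_nnorm[OF e h K])
  also have "\<dots> \<le> K * \<eta> * 3 + K * 3 * \<eta>"
    using b d K order_trans[OF nnorm_nonneg d(1)] by (intro add_mono mult_mono) auto
  finally show ?thesis by simp
qed

section \<open>Gram-Schmidt on nearly orthonormal vectors\<close>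

lemma vnorm_eq_nnorm: "vnorm a = nnorm (dim_vec a) (vec_index a)"
  by (simp add: vnorm_def nnorm_def L2_set_def)

lemma cinner_eq_ip: "cinner a b = ip (dim_vec a) (vec_index a) (vec_index b)"
  by (simp add: cinner_def ip_def)

lemma length_gsl [simp]: "length (gsl v k) = k"
  by (induction k) (simp_all add: Let_def)

lemma gsl_nth_stable: "j < k \<Longrightarrow> k \<le> m \<Longrightarrow> gsl v m ! j = gsl v k ! j"
proof (induction m)
  case (Suc m)
  then show ?case by (cases "k = Suc m") (auto simp: Let_def nth_append)
qed simp

lemma dim_gsl:
  assumes "\<And>k. dim_vec (v k) = n" "j < k"
  shows "dim_vec (gsl v k ! j) = n"
proof -
  have "gsl v k ! j = gsl v (Suc j) ! j" using assms(2) by (intro gsl_nth_stable) auto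
  then show ?thesis using assms(1) by (simp add: Let_def nth_append gs_res_def)
qed

lemma sum_list_conv_nth: "(\<Sum>e\<leftarrow>es. f e) = (\<Sum>j<length es. f (es ! j) :: 'b::comm_monoid_add)"
  by (simp add: sum_list_sum_nth atLeast0LessThan)

lemma gs_res_index:
  assumes "\<And>k. dim_vec (v k) = n" "i < n"
  shows "vec_index (gs_res (gsl v k) (v m)) i
    = vec_index (v m) i - (\<Sum>j<k. ip n (vec_index (gsl v k ! j)) (vec_index (v m)) * vec_index (gsl v k ! j) i)"
proof -
  have "(\<Sum>e\<leftarrow>gsl v k. cinner e (v m) * vec_index e i)
    = (\<Sum>j<k. ip n (vec_index (gsl v k ! j)) (vec_index (v m)) * vec_index (gsl v k ! j) i)"
    unfolding sum_list_conv_nth length_gsl cinner_eq_ip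
    by (intro sum.cong refl) (use dim_gsl[of v n, OF assms(1)] in auto)
  moreover have "i < dim_vec (v m)" using assms by simp
  ultimately show ?thesis unfolding gs_res_def by simp
qed

text \<open>Here \<delta> is the defect of the Gram matrix and \<eta> the error made on the first
  \<open>k\<close> vectors. Each earlier vector has norm at most 3 and inner product at most
  \<delta> + 2 \<eta> with the new one, so subtracting the projections moves it by at most 3 k
  (\<delta> + 2 \<eta>). The norm is then off 1 by that much plus \<delta>, and normalising costs
  this amount again.\<close>

lemma gram_schmidt_step:
  assumes dim: "\<And>k. dim_vec (v k) = n" and \<delta>: "0 \<le> \<delta>" "\<delta> \<le> 1" and \<eta>: "0 \<le> \<eta>" "\<eta> \<le> 1"
    and G: "\<And>j. j \<in> {1..Suc k} \<Longrightarrow> cmod (ip n (vec_index (v j)) (vec_index (v (Suc k))) - (if j = Suc k then 1 else 0)) \<le> \<delta>"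
    and N: "\<And>j. j < k \<Longrightarrow> nnorm n (vec_index (v (Suc j))) \<le> 2"
    and IH: "\<And>j. j < k \<Longrightarrow> nnorm n (\<lambda>i. vec_index (gsl v k ! j) i - vec_index (v (Suc j)) i) \<le> \<eta>"
    and small: "k * (3 * (\<delta> + 2 * \<eta>)) + \<delta> < 1"
  shows "vnorm (gs_res (gsl v k) (v (Suc k))) \<noteq> 0"
    "nnorm n (\<lambda>i. vec_index (gsl v (Suc k) ! k) i - vec_index (v (Suc k)) i) \<le> 2 * (k * (3 * (\<delta> + 2 * \<eta>)) + \<delta>)"
    "nnorm n (vec_index (v (Suc k))) \<le> 2"
proof -
  let ?x = "vec_index (v (Suc k))" and ?e = "\<lambda>j. vec_index (gsl v k ! j)"
  define w where "w = gs_res (gsl v k) (v (Suc k))"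
  define D where "D = k * (3 * (\<delta> + 2 * \<eta>))"
  have dw: "dim_vec w = n" using dim by (simp add: w_def gs_res_def)
  have D0: "0 \<le> D" using \<delta> \<eta> by (simp add: D_def)
  have x1: "\<bar>nnorm n ?x - 1\<bar> \<le> \<delta>"
  proof -
    have "cmod (complex_of_real (nrm2 n ?x - 1)) \<le> \<delta>" using G[of "Suc k"] by (simp add: ip_self)
    then have m1: "\<bar>(nnorm n ?x)\<^sup>2 - 1\<bar> \<le> \<delta>" unfolding norm_of_real nnorm_power2 .
    have "(nnorm n ?x)\<^sup>2 - 1 = (nnorm n ?x - 1) * (nnorm n ?x + 1)"
      by (simp add: power2_eq_square algebra_simps)
    then have m2: "\<bar>(nnorm n ?x)\<^sup>2 - 1\<bar> = \<bar>nnorm n ?x - 1\<bar> * (nnorm n ?x + 1)"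
      by (simp add: abs_mult)
    have "\<bar>nnorm n ?x - 1\<bar> * 1 \<le> \<bar>nnorm n ?x - 1\<bar> * (nnorm n ?x + 1)"
      by (intro mult_left_mono) auto
    then show ?thesis using m1 unfolding m2 by simp
  qed
  then show x2: "nnorm n ?x \<le> 2" using \<delta> by linarith
  have ej: "nnorm n (?e j) \<le> 3" if "j < k" for j
    using nnorm_triangle_diff[of n "?e j" "vec_index (v (Suc j))"] N[OF that] IH[OF that] \<eta> by linarith
  have ipj: "cmod (ip n (?e j) ?x) \<le> \<delta> + 2 * \<eta>" if j: "j < k" for j
  proof -
    have "ip n (?e j) ?x = ip n (vec_index (v (Suc j))) ?x + ip n (\<lambda>i. ?e j i - vec_index (v (Suc j)) i) ?x"
      by (simp add: ip_def left_diff_distrib sum_subtractf)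
    then have "cmod (ip n (?e j) ?x) \<le> cmod (ip n (vec_index (v (Suc j))) ?x) + cmod (ip n (\<lambda>i. ?e j i - vec_index (v (Suc j)) i) ?x)"
      using norm_triangle_ineq by metis
    moreover have "cmod (ip n (vec_index (v (Suc j))) ?x) \<le> \<delta>" using G[of "Suc j"] j by simp
    moreover have "cmod (ip n (\<lambda>i. ?e j i - vec_index (v (Suc j)) i) ?x) \<le> \<eta> * 2"
      using mult_mono[OF IH[OF j] x2 \<eta>(1) nnorm_nonneg] by (rule order_trans[OF ip_le_nnorm])
    ultimately show ?thesis by linarith
  qed
  have wx: "vec_index w i - ?x i = - (\<Sum>j<k. ip n (?e j) ?x * ?e j i)" if "i < n" for i
    using gs_res_index[of v n i k "Suc k", OF dim that] by (simp add: w_def)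
  have wd: "nnorm n (\<lambda>i. vec_index w i - ?x i) \<le> D"
  proof -
    have "nnorm n (\<lambda>i. vec_index w i - ?x i) = nnorm n (\<lambda>i. \<Sum>j<k. ip n (?e j) ?x * ?e j i)"
      unfolding nnorm_def L2_set_def by (simp add: wx)
    also have "\<dots> \<le> (\<Sum>j<k. nnorm n (\<lambda>i. ip n (?e j) ?x * ?e j i))" by (rule nnorm_sum) simp
    also have "\<dots> \<le> (\<Sum>j<k. 3 * (\<delta> + 2 * \<eta>))"
      unfolding nnorm_scale
    proof (rule sum_mono)
      fix j assume "j \<in> {..<k}"
      then have "cmod (ip n (?e j) ?x) * nnorm n (?e j) \<le> (\<delta> + 2 * \<eta>) * 3"
        using \<delta> \<eta> by (intro mult_mono ipj ej) auto
      then show "cmod (ip n (?e j) ?x) * nnorm n (?e j) \<le> 3 * (\<delta> + 2 * \<eta>)" by simp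
    qed
    finally show ?thesis by (simp add: D_def)
  qed
  define W where "W = nnorm n (vec_index w)"
  have W1: "\<bar>W - 1\<bar> \<le> D + \<delta>"
  proof -
    have "W \<le> nnorm n ?x + D" using nnorm_triangle_diff[of n "vec_index w" ?x] wd by (simp add: W_def)
    moreover have "nnorm n ?x \<le> W + D"
      using nnorm_triangle_diff[of n ?x "vec_index w"] wd nnorm_diff_commute[of n "vec_index w" ?x] by (simp add: W_def)
    ultimately show ?thesis using x1 by linarith
  qed
  have Wpos: "0 < W" using W1 small by (simp add: D_def)
  have vW: "vnorm w = W" by (simp add: vnorm_eq_nnorm dw W_def)
  then show "vnorm (gs_res (gsl v k) (v (Suc k))) \<noteq> 0" using Wpos by (simp add: w_def)
  have last: "vec_index (gsl v (Suc k) ! k) i = vec_index w i / complex_of_real W" if "i < n" for i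
    using that dw by (simp add: Let_def nth_append w_def[symmetric] vW)
  have "nnorm n (\<lambda>i. vec_index (gsl v (Suc k) ! k) i - ?x i)
    = nnorm n (\<lambda>i. (complex_of_real (1 / W - 1) * vec_index w i) + (vec_index w i - ?x i))"
    by (rule nnorm_cong) (simp only: last, simp add: left_diff_distrib)
  also have "\<dots> \<le> \<bar>1 / W - 1\<bar> * W + D"
    using nnorm_triangle[of n "\<lambda>i. complex_of_real (1 / W - 1) * vec_index w i" "\<lambda>i. vec_index w i - ?x i"] wd
    unfolding nnorm_scale norm_of_real W_def[symmetric] by linarith
  also have "\<bar>1 / W - 1\<bar> * W = \<bar>1 - W\<bar>"
  proof -
    have "\<bar>1 / W - 1\<bar> * W = \<bar>(1 / W - 1) * W\<bar>" using Wpos by (simp add: abs_mult)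
    also have "(1 / W - 1) * W = 1 - W" using Wpos by (simp add: left_diff_distrib)
    finally show ?thesis .
  qed
  finally have "nnorm n (\<lambda>i. vec_index (gsl v (Suc k) ! k) i - ?x i) \<le> \<bar>1 - W\<bar> + D" .
  moreover have "\<bar>1 - W\<bar> \<le> D + \<delta>" using W1 by (simp add: abs_minus_commute)
  moreover have "D + \<delta> + D \<le> 2 * (D + \<delta>)" using \<delta> by simp
  ultimately show "nnorm n (\<lambda>i. vec_index (gsl v (Suc k) ! k) i - ?x i) \<le> 2 * (k * (3 * (\<delta> + 2 * \<eta>)) + \<delta>)"
    unfolding D_def[symmetric] by linarith
qed

text \<open>The point is that \<delta> depends on \<open>r\<close> and \<epsilon> but not on
  \<open>n\<close>, so one accuracy of the Gram matrix serves all dimensions. The induction asks the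
  first \<open>r\<close> vectors for the smaller error \<eta>.\<close>

lemma gram_schmidt_perturbation:
  assumes "0 < \<epsilon>"
  shows "\<exists>\<delta>>0. \<delta> \<le> 1 \<and> (\<forall>n v. (\<forall>k. dim_vec (v k) = n) \<longrightarrow>
     near_scalar r (\<lambda>j k. ip n (vec_index (v j)) (vec_index (v k))) 1 \<delta> \<longrightarrow>
     gs_defined v r \<and> (\<forall>k<r. nnorm n (vec_index (v (Suc k))) \<le> 2) \<and>
     (\<forall>k<r. nnorm n (\<lambda>i. vec_index (gsl v r ! k) i - vec_index (v (Suc k)) i) \<le> \<epsilon>))"
  using assms
proof (induction r arbitrary: \<epsilon>)
  case 0
  then show ?case by (intro exI[of _ 1]) (auto simp: gs_defined_def)
next
  case (Suc r)
  \<comment> \<open>With b = (r + 1) \<eta>, the step produces an error of at most 2 * 10 b and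
    needs 10 b < 1; the constant 48 leaves room for both.\<close>
  define \<eta> where "\<eta> = min (min 1 \<epsilon>) (min (\<epsilon> / (48 * (real r + 1))) (1 / (48 * (real r + 1))))"
  have r1: "0 < 48 * (real r + 1)" by simp
  have "0 < \<epsilon> / (48 * (real r + 1))" "0 < 1 / (48 * (real r + 1))"
    using Suc.prems r1 by (simp_all only: divide_pos_pos zero_less_one)
  then have \<eta>: "0 < \<eta>" "\<eta> \<le> 1" "\<eta> \<le> \<epsilon>" "\<eta> \<le> \<epsilon> / (48 * (real r + 1))" "\<eta> \<le> 1 / (48 * (real r + 1))"
    using Suc.prems unfolding \<eta>_def by (simp_all only: min_less_iff_conj min_le_iff_disj order_refl simp_thms zero_less_one)
  obtain \<delta>0 where \<delta>0: "0 < \<delta>0" "\<delta>0 \<le> 1" and IH: "\<And>n v. (\<forall>k. dim_vec (v k) = n) \<Longrightarrow>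
     near_scalar r (\<lambda>j k. ip n (vec_index (v j)) (vec_index (v k))) 1 \<delta>0 \<Longrightarrow>
     gs_defined v r \<and> (\<forall>k<r. nnorm n (vec_index (v (Suc k))) \<le> 2) \<and>
     (\<forall>k<r. nnorm n (\<lambda>i. vec_index (gsl v r ! k) i - vec_index (v (Suc k)) i) \<le> \<eta>)"
    using Suc.IH[OF \<eta>(1)] by blast
  define \<delta> where "\<delta> = min \<delta>0 \<eta>"
  have \<delta>: "0 < \<delta>" "\<delta> \<le> \<delta>0" "\<delta> \<le> \<eta>" "\<delta> \<le> 1" using \<delta>0 \<eta> by (auto simp: \<delta>_def)
  define b where "b = (real r + 1) * \<eta>"
  have b: "0 < b" "48 * b \<le> \<epsilon>" "48 * b \<le> 1"
    using \<eta> unfolding b_def pos_le_divide_eq[OF r1] by (simp_all add: mult_ac)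
  have s: "r * (3 * (\<delta> + 2 * \<eta>)) + \<delta> \<le> 10 * b"
  proof -
    have "real r * \<delta> \<le> real r * \<eta>" "0 \<le> real r * \<eta>" using \<delta> \<eta> by (auto intro: mult_left_mono)
    moreover have "r * (3 * (\<delta> + 2 * \<eta>)) + \<delta> = 3 * (real r * \<delta>) + 6 * (real r * \<eta>) + \<delta>"
      "10 * b = 10 * (real r * \<eta>) + 10 * \<eta>" by (simp_all add: b_def algebra_simps)
    ultimately show ?thesis using \<delta>(3) \<eta>(1) by linarith
  qed
  have s1: "r * (3 * (\<delta> + 2 * \<eta>)) + \<delta> < 1" using s b by linarith
  have s2: "2 * (r * (3 * (\<delta> + 2 * \<eta>)) + \<delta>) \<le> \<epsilon>"
  proof -
    have "2 * (r * (3 * (\<delta> + 2 * \<eta>)) + \<delta>) \<le> 2 * (10 * b)" by (rule mult_left_mono[OF s]) simp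
    then show ?thesis using b by simp
  qed
  show ?case
  proof (intro exI[of _ \<delta>] conjI allI impI)
    fix n and v :: "nat \<Rightarrow> complex Matrix.vec"
    assume dim: "\<forall>k. dim_vec (v k) = n" and
      G: "near_scalar (Suc r) (\<lambda>j k. ip n (vec_index (v j)) (vec_index (v k))) 1 \<delta>"
    have "near_scalar r (\<lambda>j k. ip n (vec_index (v j)) (vec_index (v k))) 1 \<delta>0"
      unfolding near_scalar_def
    proof (intro ballI)
      fix j k assume "j \<in> {1..r}" "k \<in> {1..r}"
      then have "j \<in> {1..Suc r}" "k \<in> {1..Suc r}" by auto
      then show "cmod (ip n (vec_index (v j)) (vec_index (v k)) - (if j = k then of_real 1 else 0)) \<le> \<delta>0"
        using G \<delta>(2) order_trans unfolding near_scalar_def by blast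
    qed
    note I = IH[OF dim this]
    have G': "cmod (ip n (vec_index (v j)) (vec_index (v (Suc r))) - (if j = Suc r then 1 else 0)) \<le> \<delta>" if "j \<in> {1..Suc r}" for j
    proof -
      have "Suc r \<in> {1..Suc r}" by simp
      then show ?thesis using G that unfolding near_scalar_def of_real_1 by blast
    qed
    have I': "nnorm n (vec_index (v (Suc j))) \<le> 2" "nnorm n (\<lambda>i. vec_index (gsl v r ! j) i - vec_index (v (Suc j)) i) \<le> \<eta>" if "j < r" for j
      using I that by blast+
    note step = gram_schmidt_step[of v n \<delta> \<eta> r, OF dim[rule_format] less_imp_le[OF \<delta>(1)] \<delta>(4) less_imp_le[OF \<eta>(1)] \<eta>(2) G' I' s1]
    have st: "vnorm (gs_res (gsl v r) (v (Suc r))) \<noteq> 0"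
      "nnorm n (\<lambda>i. vec_index (gsl v (Suc r) ! r) i - vec_index (v (Suc r)) i) \<le> 2 * (r * (3 * (\<delta> + 2 * \<eta>)) + \<delta>)"
      "nnorm n (vec_index (v (Suc r))) \<le> 2"
      by (rule step; assumption)+
    show "gs_defined v (Suc r)" using I st(1) by (auto simp: gs_defined_def less_Suc_eq)
    show "nnorm n (vec_index (v (Suc k))) \<le> 2" if "k < Suc r" for k
      using I st(3) that by (auto simp: less_Suc_eq)
    show "nnorm n (\<lambda>i. vec_index (gsl v (Suc r) ! k) i - vec_index (v (Suc k)) i) \<le> \<epsilon>" if "k < Suc r" for k
    proof (cases "k = r")
      case True
      then show ?thesis using order_trans[OF st(2) s2] by simp
    next
      case False
      then have k: "k < r" using that by simp
      then have "gsl v (Suc r) ! k = gsl v r ! k" by (intro gsl_nth_stable) auto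
      then show ?thesis using I k \<eta>(3) by (metis order_trans)
    qed
  qed (use \<delta> in auto)
qed

section \<open>Measurability of eigenvalues\<close>

lemma spec_cong:
  assumes "spec n A e l" "\<And>i j. i < n \<Longrightarrow> j < n \<Longrightarrow> A i j = B i j"
  shows "spec n B e l"
proof -
  have "mv n A w i = mv n B w i" if "i < n" for w i
    unfolding mv_def using assms(2) that by (intro sum.cong) auto
  then show ?thesis using assms(1) by (simp add: spec_def)
qed

text \<open>On the span of the eigenvectors of \<open>A\<close> from \<open>idx\<close> on, the form
  of \<open>A\<close> is at least \<open>l idx\<close>, and the two forms differ by at most \<eta>
  (sum of |w i|)^2, which is at most n \<eta> times the squared norm.\<close>

lemma eig_perturbation:
  assumes s: "spec n A e l" and s': "spec n B e' l'" and idx: "idx < n"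
    and d: "\<And>i j. i < n \<Longrightarrow> j < n \<Longrightarrow> cmod (A i j - B i j) \<le> \<eta>"
  shows "l idx - real n * \<eta> \<le> l' idx"
proof (rule spec_ge[OF s' idx, where m = 0 and p = "n - idx" and g = "\<lambda>j. e (n - 1 - j)"])
  have e: "orthonormal n n e" using s by (simp add: spec_def)
  show "0 + (n - 1 - idx) < n - idx" using idx by simp
  fix d' :: "nat \<Rightarrow> complex"
  let ?w = "\<lambda>a. \<Sum>j<n - idx. d' j * e (n - 1 - j) a"
  assume d': "\<exists>j<n - idx. d' j \<noteq> 0"
  define w where "w = ?w"
  have ew: "ip n (e k) w = (if idx \<le> k then d' (n - 1 - k) else 0)" if "k < n" for k
  proof -
    have "ip n (e k) w = (\<Sum>j<n - idx. if j = n - 1 - k then d' j else 0)"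
      unfolding w_def ip_sum_right using e that idx
      by (intro sum.cong) (auto simp: orthonormal_def)
    also have "\<dots> = (if n - 1 - k \<in> {..<n - idx} then d' (n - 1 - k) else 0)" by (rule sum.delta) simp
    also have "\<dots> = (if idx \<le> k then d' (n - 1 - k) else 0)" using that idx by auto
    finally show ?thesis .
  qed
  obtain j where j: "j < n - idx" "d' j \<noteq> 0" using d' by auto
  then have "ip n (e (n - 1 - j)) w \<noteq> 0" by (subst ew) auto
  then have pos: "nrm2 n w > 0"
    unfolding parseval_nrm2[OF e] using j by (intro sum_pos2[of _ "n - 1 - j"]) auto
  have "l idx * nrm2 n w = (\<Sum>k<n. l idx * (cmod (ip n (e k) w))\<^sup>2)"
    by (simp add: parseval_nrm2[OF e] sum_distrib_left)
  also have "\<dots> \<le> (\<Sum>k<n. l k * (cmod (ip n (e k) w))\<^sup>2)"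
  proof (rule sum_mono)
    fix k assume k: "k \<in> {..<n}"
    show "l idx * (cmod (ip n (e k) w))\<^sup>2 \<le> l k * (cmod (ip n (e k) w))\<^sup>2"
    proof (cases "idx \<le> k")
      case True
      then have "l idx \<le> l k" using s k by (simp add: spec_def)
      then show ?thesis by (intro mult_right_mono) auto
    next
      case False
      then show ?thesis using ew k by simp
    qed
  qed
  also have "\<dots> = qf n A w" by (simp add: spec_qf[OF s])
  finally have 1: "l idx * nrm2 n w \<le> qf n A w" .
  have "(\<Sum>i<n. \<Sum>j<n. cnj (w i) * (A i j - B i j) * w j) = ip n w (mv n A w) - ip n w (mv n B w)"
    unfolding ip_def mv_def sum_distrib_left by (simp add: right_diff_distrib left_diff_distrib sum_subtractf mult.assoc)
  then have "qf n A w - qf n B w = Re (\<Sum>i<n. \<Sum>j<n. cnj (w i) * (A i j - B i j) * w j)"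
    by (simp only: qf_def minus_complex.sel)
  also have "\<dots> \<le> cmod (\<Sum>i<n. \<Sum>j<n. cnj (w i) * (A i j - B i j) * w j)" by (rule complex_Re_le_cmod)
  also have "\<dots> \<le> (\<Sum>i<n. \<Sum>j<n. cmod (w i) * \<eta> * cmod (w j))"
  proof (intro sum_norm_le)
    fix i j assume "i \<in> {..<n}" "j \<in> {..<n}"
    then have "cmod (w i) * cmod (A i j - B i j) * cmod (w j) \<le> cmod (w i) * \<eta> * cmod (w j)"
      using d by (intro mult_right_mono mult_left_mono) auto
    then show "cmod (cnj (w i) * (A i j - B i j) * w j) \<le> cmod (w i) * \<eta> * cmod (w j)" by (simp add: norm_mult)
  qed
  also have "\<dots> = \<eta> * (\<Sum>i<n. cmod (w i))\<^sup>2"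
    by (simp add: power2_eq_square sum_product sum_distrib_left mult_ac)
  also have "\<dots> \<le> \<eta> * (real n * nrm2 n w)"
  proof (rule mult_left_mono)
    show "(\<Sum>i<n. cmod (w i))\<^sup>2 \<le> real n * nrm2 n w"
      using sum_squared_le_sum_of_squares[of "\<lambda>i. cmod (w i)" "{..<n}"] by (simp add: nrm2_def mult.commute)
    show "0 \<le> \<eta>" using d[OF idx idx] norm_ge_zero order_trans by blast
  qed
  finally have "(l idx - real n * \<eta>) * nrm2 n w \<le> qf n B w" using 1 by (simp add: algebra_simps)
  then show "nrm2 n ?w > 0 \<and> (l idx - real n * \<eta>) * nrm2 n ?w \<le> qf n B ?w" using pos unfolding w_def by simp
qed

text \<open>A retraction onto Hermitian matrices. Composed with it, the eigenvalues become
  continuous functions on the whole space of arrays, where \<open>eigs\<close> alone would be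
  defined by an unfulfilled description.\<close>

definition hermitize :: "nat \<Rightarrow> (nat \<times> nat \<Rightarrow> complex) \<Rightarrow> complex mat" where
  "hermitize n m = Matrix.mat n n (\<lambda>(i,j). (m (i,j) + cnj (m (j,i))) / 2)"

lemma hermitian_hermitize: "hermitian_mat n (hermitize n m)"
  by (auto simp: hermitian_mat_def hermitize_def add.commute)

lemma hermitize_entries:
  assumes "hermitian_mat n A"
  shows "hermitize n (\<lambda>p. A $$ p) = A"
proof (rule eq_matI)
  fix i j assume "i < dim_row A" "j < dim_col A"
  then have ij: "i < n" "j < n" using assms by (auto simp: hermitian_mat_def)
  then have "cnj (A $$ (j,i)) = A $$ (i,j)" using assms unfolding hermitian_mat_def by metis
  then show "hermitize n (\<lambda>p. A $$ p) $$ (i,j) = A $$ (i,j)" using ij by (simp add: hermitize_def)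
qed (use assms in \<open>auto simp: hermitize_def hermitian_mat_def\<close>)

lemma continuous_eig_hermitize:
  assumes idx: "idx < n"
  shows "continuous_on UNIV (\<lambda>m. eigs (hermitize n m) ! idx)"
proof (rule continuous_at_imp_continuous_on, intro ballI)
  fix m :: "nat \<times> nat \<Rightarrow> complex"
  let ?F = "\<lambda>m. eigs (hermitize n m) ! idx"
  define \<eta> where "\<eta> m' = (\<Sum>p\<in>{..<n} \<times> {..<n}. cmod (hermitize n m' $$ p - hermitize n m $$ p))" for m'
  have bound: "\<bar>?F m' - ?F m\<bar> \<le> real n * \<eta> m'" for m'
  proof -
    obtain e where e: "spec n (\<lambda>i j. hermitize n m $$ (i,j)) e (\<lambda>k. eigs (hermitize n m) ! k)"
      using spec_eigs_exists[OF hermitian_hermitize] by blast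
    obtain e' where e': "spec n (\<lambda>i j. hermitize n m' $$ (i,j)) e' (\<lambda>k. eigs (hermitize n m') ! k)"
      using spec_eigs_exists[OF hermitian_hermitize] by blast
    have le: "cmod (hermitize n m' $$ (i,j) - hermitize n m $$ (i,j)) \<le> \<eta> m'" if "i < n" "j < n" for i j
      unfolding \<eta>_def
      by (rule member_le_sum[where f = "\<lambda>p. cmod (hermitize n m' $$ p - hermitize n m $$ p)"]) (use that in auto)
    have "?F m' - real n * \<eta> m' \<le> ?F m" by (rule eig_perturbation[OF e' e idx le])
    moreover have "?F m - real n * \<eta> m' \<le> ?F m'"
      by (rule eig_perturbation[OF e e' idx]) (use le norm_minus_commute in metis)
    ultimately show ?thesis by linarith
  qed
  have "\<eta> \<midarrow>m\<rightarrow> (\<Sum>p\<in>{..<n} \<times> {..<n}. cmod (hermitize n m $$ p - hermitize n m $$ p))"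
    unfolding \<eta>_def[abs_def]
  proof (intro tendsto_sum tendsto_norm tendsto_diff tendsto_const)
    fix p assume "p \<in> {..<n} \<times> {..<n}"
    then obtain i j where p: "p = (i,j)" "i < n" "j < n" by auto
    have c: "(\<lambda>m. m q) \<midarrow>m\<rightarrow> m q" for q :: "nat \<times> nat"
    proof -
      have "continuous_on UNIV (\<lambda>m::nat \<times> nat \<Rightarrow> complex. m q)" by (rule continuous_on_product_coordinates)
      then show ?thesis by (simp add: continuous_on_def)
    qed
    show "(\<lambda>m. hermitize n m $$ p) \<midarrow>m\<rightarrow> hermitize n m $$ p"
      using p by (auto simp: hermitize_def intro!: tendsto_intros c)
  qed
  then have "(\<lambda>m'. real n * \<eta> m') \<midarrow>m\<rightarrow> 0" by (auto intro!: tendsto_eq_intros)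
  then have "(\<lambda>m'. ?F m' - ?F m) \<midarrow>m\<rightarrow> 0"
    by (rule Lim_null_comparison[rotated]) (use bound in auto)
  then show "isCont ?F m" by (simp add: isCont_def LIM_zero_iff)
qed

text \<open>The eigenvalues are Lipschitz in the matrix entries, and \<open>nat \<times> nat \<Rightarrow> complex\<close> carries a
  second countable topology.\<close>
lemma measurable_eig:
  assumes A: "\<And>\<omega>. \<omega> \<in> space M \<Longrightarrow> hermitian_mat n (A \<omega>)"
    and m: "\<And>i j. i < n \<Longrightarrow> j < n \<Longrightarrow> (\<lambda>\<omega>. A \<omega> $$ (i,j)) \<in> borel_measurable M" and idx: "idx < n"
  shows "(\<lambda>\<omega>. eigs (A \<omega>) ! idx) \<in> borel_measurable M"
proof -
  \<comment> \<open>Entries outside the n by n square are set to 0, so that every coordinate of the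
    array is a measurable function; \<open>hermitize\<close> never reads them.\<close>
  define E where "E \<omega> p = (if fst p < n \<and> snd p < n then A \<omega> $$ p else 0)" for \<omega> and p :: "nat \<times> nat"
  have "(\<lambda>\<omega>. E \<omega> p) \<in> borel_measurable M" for p
    using m[of "fst p" "snd p"] by (cases "fst p < n \<and> snd p < n") (auto simp: E_def)
  then have "E \<in> borel_measurable M" by (rule measurable_coordinatewise_then_product)
  then have "(\<lambda>\<omega>. eigs (hermitize n (E \<omega>)) ! idx) \<in> borel_measurable M"
    by (rule measurable_compose) (intro borel_measurable_continuous_onI continuous_eig_hermitize idx)
  moreover have "hermitize n (E \<omega>) = A \<omega>" if "\<omega> \<in> space M" for \<omega>
  proof -
    have "hermitize n (E \<omega>) = hermitize n (\<lambda>p. A \<omega> $$ p)"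
      by (rule eq_matI) (auto simp: hermitize_def E_def)
    then show ?thesis using hermitize_entries[OF A[OF that]] by simp
  qed
  ultimately show ?thesis by (subst measurable_cong[where g = "\<lambda>\<omega>. eigs (hermitize n (E \<omega>)) ! idx"]) auto
qed

lemma borel_measurable_cnj [measurable (raw)]:
  assumes "f \<in> borel_measurable M"
  shows "(\<lambda>x. cnj (f x)) \<in> borel_measurable M"
proof -
  have "cnj \<in> borel_measurable borel" by (intro borel_measurable_continuous_onI continuous_intros)
  then show ?thesis by (rule measurable_compose[OF assms])
qed

section \<open>Measurability and concentration for the sample vectors of both models\<close>

lemma dim_vvec [simp]: "dim_vec (vvec n \<omega> k) = n"
  by (simp add: vvec_def)

context subgaussian_law
begin

lemma measurable_vvec:
  assumes "k \<in> {1..r}" "i < n"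
  shows "(\<lambda>\<omega>. vec_index (vvec n \<omega> k) i) \<in> borel_measurable (sample_space \<nu> r n)"
proof -
  have [measurable]: "(\<lambda>\<omega>. \<omega> (k, i)) \<in> borel_measurable (sample_space \<nu> r n)"
    unfolding sample_space_def using assms by (intro measurable_coord) auto
  show ?thesis using assms by (simp add: vvec_def)
qed

text \<open>The two claims need each other: vector k + 1 is divided by the norm of its residual,
  which is built from the first \<open>k\<close> vectors. A vanishing norm makes the quotient 0, so
  measurability holds on the whole sample space.\<close>

lemma measurable_gsl:
  assumes "k \<le> r"
  shows "(\<forall>j<k. \<forall>i<n. (\<lambda>\<omega>. vec_index (gsl (vvec n \<omega>) k ! j) i) \<in> borel_measurable (sample_space \<nu> r n)) \<and>
     (k < r \<longrightarrow> (\<lambda>\<omega>. vnorm (gs_res (gsl (vvec n \<omega>) k) (vvec n \<omega> (Suc k)))) \<in> borel_measurable (sample_space \<nu> r n))"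
  using assms
proof (induction k)
  have res: "(\<lambda>\<omega>. vec_index (gs_res (gsl (vvec n \<omega>) k) (vvec n \<omega> (Suc k))) i) \<in> borel_measurable (sample_space \<nu> r n)"
    if IH: "\<forall>j<k. \<forall>i<n. (\<lambda>\<omega>. vec_index (gsl (vvec n \<omega>) k ! j) i) \<in> borel_measurable (sample_space \<nu> r n)"
      and k: "k < r" and i: "i < n" for k i
  proof -
    have v: "(\<lambda>\<omega>. vec_index (vvec n \<omega> (Suc k)) i) \<in> borel_measurable (sample_space \<nu> r n)" if "i < n" for i
      using k that by (intro measurable_vvec) auto
    have "(\<lambda>\<omega>. vec_index (vvec n \<omega> (Suc k)) i - (\<Sum>j<k. ip n (vec_index (gsl (vvec n \<omega>) k ! j)) (vec_index (vvec n \<omega> (Suc k))) * vec_index (gsl (vvec n \<omega>) k ! j) i)) \<in> borel_measurable (sample_space \<nu> r n)"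
      unfolding ip_def using IH v i
      by (intro borel_measurable_diff borel_measurable_sum borel_measurable_times borel_measurable_cnj) auto
    then show ?thesis using gs_res_index[of "vvec n \<omega>" n i k "Suc k" for \<omega>] i by simp
  qed
  have vn: "(\<lambda>\<omega>. vnorm (gs_res (gsl (vvec n \<omega>) k) (vvec n \<omega> (Suc k)))) \<in> borel_measurable (sample_space \<nu> r n)"
    if IH: "\<forall>j<k. \<forall>i<n. (\<lambda>\<omega>. vec_index (gsl (vvec n \<omega>) k ! j) i) \<in> borel_measurable (sample_space \<nu> r n)"
      and k: "k < r" for k
  proof -
    have "(\<lambda>\<omega>. sqrt (\<Sum>i<n. (cmod (vec_index (gs_res (gsl (vvec n \<omega>) k) (vvec n \<omega> (Suc k))) i))\<^sup>2)) \<in> borel_measurable (sample_space \<nu> r n)"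
      using res[OF that]
      by (intro borel_measurable_sqrt[THEN measurable_compose[rotated]] borel_measurable_sum borel_measurable_power borel_measurable_norm[THEN measurable_compose[rotated]]) auto
    moreover have "dim_vec (gs_res (gsl (vvec n \<omega>) k) (vvec n \<omega> (Suc k))) = n" for \<omega> by (simp add: gs_res_def)
    ultimately show ?thesis by (simp add: vnorm_def)
  qed
  {
    case 0
    then show ?case using vn[of 0] by simp
  next
    case (Suc k)
    then have IH: "\<forall>j<k. \<forall>i<n. (\<lambda>\<omega>. vec_index (gsl (vvec n \<omega>) k ! j) i) \<in> borel_measurable (sample_space \<nu> r n)" by simp
    have k: "k < r" using Suc by simp
    have dw: "dim_vec (gs_res (gsl (vvec n \<omega>) k) (vvec n \<omega> (Suc k))) = n" for \<omega> by (simp add: gs_res_def)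
    have "\<forall>j<Suc k. \<forall>i<n. (\<lambda>\<omega>. vec_index (gsl (vvec n \<omega>) (Suc k) ! j) i) \<in> borel_measurable (sample_space \<nu> r n)"
    proof (intro allI impI)
      fix j i assume ji: "j < Suc k" "i < n"
      show "(\<lambda>\<omega>. vec_index (gsl (vvec n \<omega>) (Suc k) ! j) i) \<in> borel_measurable (sample_space \<nu> r n)"
      proof (cases "j = k")
        case True
        have "(\<lambda>\<omega>. vec_index (gs_res (gsl (vvec n \<omega>) k) (vvec n \<omega> (Suc k))) i
           / complex_of_real (vnorm (gs_res (gsl (vvec n \<omega>) k) (vvec n \<omega> (Suc k))))) \<in> borel_measurable (sample_space \<nu> r n)"
          using res[OF IH k ji(2)] vn[OF IH k] by measurable
        then show ?thesis using True ji dw by (simp add: Let_def nth_append)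
      next
        case False
        then show ?thesis using IH ji by (simp add: Let_def nth_append)
      qed
    qed
    then show ?case using vn[of "Suc k"] by blast
  }
qed

lemma measurable_uvec:
  assumes "k \<in> {1..r}" "i < n"
  shows "(\<lambda>\<omega>. vec_index (uvec orth r n \<omega> k) i) \<in> borel_measurable (sample_space \<nu> r n)"
proof (cases orth)
  case True
  have "k - 1 < r" using assms by auto
  then show ?thesis using True measurable_gsl[of r r n] assms by (simp add: uvec_def)
next
  case False
  then show ?thesis using measurable_vvec[OF assms] by (simp add: uvec_def)
qed

lemma measurable_model_ok:
  "{\<omega> \<in> space (sample_space \<nu> r n). model_ok orth r n \<omega>} \<in> sets (sample_space \<nu> r n)"
proof (cases orth)
  case True
  have "{\<omega> \<in> space (sample_space \<nu> r n). model_ok orth r n \<omega>}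
    = {\<omega> \<in> space (sample_space \<nu> r n). \<forall>k\<in>{..<r}. vnorm (gs_res (gsl (vvec n \<omega>) k) (vvec n \<omega> (Suc k))) \<noteq> 0}"
    using True by (auto simp: model_ok_def gs_defined_def)
  also have "\<dots> \<in> sets (sample_space \<nu> r n)"
  proof (rule sets.sets_Collect_finite_All)
    show "{\<omega> \<in> space (sample_space \<nu> r n). vnorm (gs_res (gsl (vvec n \<omega>) k) (vvec n \<omega> (Suc k))) \<noteq> 0} \<in> sets (sample_space \<nu> r n)"
      if "k \<in> {..<r}" for k
    proof -
      have [measurable]: "(\<lambda>\<omega>. vnorm (gs_res (gsl (vvec n \<omega>) k) (vvec n \<omega> (Suc k)))) \<in> borel_measurable (sample_space \<nu> r n)"
        using measurable_gsl[of k r n] that by simp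
      show ?thesis by measurable
    qed
  qed auto
  finally show ?thesis .
qed (simp add: model_ok_def)

text \<open>The i.i.d. bound is used twice: with h = 1 it says that the Gram matrix is close to the
  identity, which makes Gram-Schmidt well defined and a small perturbation; with the given
  \<open>h\<close> it locates the forms of the unorthonormalised vectors.\<close>

lemma sf_concentration_uvec:
  fixes K g \<epsilon> :: real
  assumes e: "\<And>n. 1 \<le> n \<Longrightarrow> orthonormal n n (e n)"
    and h: "eventually (\<lambda>n. \<forall>l<n. \<bar>h n l\<bar> \<le> K) sequentially" and K: "0 \<le> K"
    and g: "(\<lambda>n. (1 / real n) * (\<Sum>l<n. h n l)) \<longlonglongrightarrow> g" and \<epsilon>: "0 < \<epsilon>" and r: "1 \<le> r"
  shows "whp (sample_space \<nu> r) (\<lambda>n \<omega>. model_ok orth r n \<omega> \<and> near_scalar r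
    (\<lambda>j k. sf n (e n) (h n) (vec_index (uvec orth r n \<omega> j)) (vec_index (uvec orth r n \<omega> k))) g \<epsilon>)"
proof (cases orth)
  case False
  then show ?thesis using sf_concentration[OF e h K g \<epsilon> r] by (simp add: model_ok_def uvec_def)
next
  case True
  \<comment> \<open>Chosen so that the loss 6 K \<eta> in \<open>sf_perturb\<close> is at most
    \<epsilon>/2; K + 1 keeps the denominator positive when K = 0.\<close>
  define \<eta> where "\<eta> = min 1 (\<epsilon> / (12 * (K + 1)))"
  have "0 < \<epsilon> / (12 * (K + 1))" using \<epsilon> K by simp
  then have \<eta>: "0 < \<eta>" "\<eta> \<le> 1" "\<eta> \<le> \<epsilon> / (12 * (K + 1))" by (auto simp: \<eta>_def)
  have K\<eta>: "6 * K * \<eta> \<le> \<epsilon> / 2"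
  proof -
    have "\<eta> * (12 * (K + 1)) \<le> \<epsilon>" using \<eta>(3) K by (simp add: pos_le_divide_eq)
    moreover have "0 \<le> \<eta> * K" using \<eta> K by simp
    ultimately show ?thesis using \<eta>(1) by (simp add: algebra_simps)
  qed
  obtain \<delta> where \<delta>: "0 < \<delta>" and GS: "\<And>n v. (\<forall>k. dim_vec (v k) = n) \<Longrightarrow>
     near_scalar r (\<lambda>j k. ip n (vec_index (v j)) (vec_index (v k))) 1 \<delta> \<Longrightarrow>
     gs_defined v r \<and> (\<forall>k<r. nnorm n (vec_index (v (Suc k))) \<le> 2) \<and>
     (\<forall>k<r. nnorm n (\<lambda>i. vec_index (gsl v r ! k) i - vec_index (v (Suc k)) i) \<le> \<eta>)"
    using gram_schmidt_perturbation[OF \<eta>(1), of r] by blast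
  have one: "(\<lambda>n. (1 / real n) * (\<Sum>l<n. 1)) \<longlonglongrightarrow> 1"
    by (rule Lim_transform_eventually[OF tendsto_const])
       (use eventually_gt_at_top[of "0::nat"] in \<open>auto elim!: eventually_mono\<close>)
  have W1: "whp (sample_space \<nu> r) (\<lambda>n \<omega>. near_scalar r (\<lambda>j k. sf n (e n) (\<lambda>_. 1) (vec_index (vvec n \<omega> j)) (vec_index (vvec n \<omega> k))) 1 \<delta>)"
    by (rule sf_concentration[OF e _ _ one \<delta> r, where K = 1]) auto
  have W2: "whp (sample_space \<nu> r) (\<lambda>n \<omega>. near_scalar r (\<lambda>j k. sf n (e n) (h n) (vec_index (vvec n \<omega> j)) (vec_index (vvec n \<omega> k))) g (\<epsilon> / 2))"
    by (rule sf_concentration[OF e h K g half_gt_zero[OF \<epsilon>] r])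
  show ?thesis
  proof (rule whp_mono[OF whp_conj[OF prob_space_sample W1 W2]])
    show "eventually (\<lambda>n. \<forall>\<omega>\<in>space (sample_space \<nu> r n).
      near_scalar r (\<lambda>j k. sf n (e n) (\<lambda>_. 1) (vec_index (vvec n \<omega> j)) (vec_index (vvec n \<omega> k))) 1 \<delta> \<and>
      near_scalar r (\<lambda>j k. sf n (e n) (h n) (vec_index (vvec n \<omega> j)) (vec_index (vvec n \<omega> k))) g (\<epsilon> / 2) \<longrightarrow>
      model_ok orth r n \<omega> \<and>
      near_scalar r (\<lambda>j k. sf n (e n) (h n) (vec_index (uvec orth r n \<omega> j)) (vec_index (uvec orth r n \<omega> k))) g \<epsilon>) sequentially"
      using h eventually_ge_at_top[of "1::nat"]
    proof eventually_elim
      case (elim n)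
      note en = e[OF elim(2)]
      have sf1: "sf n (e n) (\<lambda>_. 1) x y = ip n x y" for x y
        unfolding parseval_ip[OF en, of x y] sf_def by simp
      show ?case
      proof (intro ballI impI, elim conjE)
        fix \<omega>
        assume a1: "near_scalar r (\<lambda>j k. sf n (e n) (\<lambda>_. 1) (vec_index (vvec n \<omega> j)) (vec_index (vvec n \<omega> k))) 1 \<delta>"
          and a2: "near_scalar r (\<lambda>j k. sf n (e n) (h n) (vec_index (vvec n \<omega> j)) (vec_index (vvec n \<omega> k))) g (\<epsilon> / 2)"
        have G: "gs_defined (vvec n \<omega>) r \<and> (\<forall>k<r. nnorm n (vec_index (vvec n \<omega> (Suc k))) \<le> 2) \<and>
          (\<forall>k<r. nnorm n (\<lambda>i. vec_index (gsl (vvec n \<omega>) r ! k) i - vec_index (vvec n \<omega> (Suc k)) i) \<le> \<eta>)"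
          using a1 unfolding sf1 by (intro GS) simp_all
        define U where "U j = vec_index (uvec orth r n \<omega> j)" for j
        define v where "v j = vec_index (vvec n \<omega> j)" for j
        have close: "nnorm n (\<lambda>i. U j i - v j i) \<le> \<eta>" "nnorm n (v j) \<le> 2" if "j \<in> {1..r}" for j
        proof -
          have j: "j - 1 < r" "Suc (j - 1) = j" using that by auto
          have "nnorm n (\<lambda>i. vec_index (gsl (vvec n \<omega>) r ! (j - 1)) i - vec_index (vvec n \<omega> (Suc (j - 1))) i) \<le> \<eta>"
            "nnorm n (vec_index (vvec n \<omega> (Suc (j - 1)))) \<le> 2"
            using G j(1) by blast+
          then show "nnorm n (\<lambda>i. U j i - v j i) \<le> \<eta>" "nnorm n (v j) \<le> 2"
            unfolding j(2) U_def v_def uvec_def if_P[OF True] .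
        qed
        have U3: "nnorm n (U j) \<le> 3" if "j \<in> {1..r}" for j
          using nnorm_triangle_diff[of n "U j" "v j"] close[OF that] \<eta>(2) by linarith
        have "cmod (sf n (e n) (h n) (U j) (U k) - (if j = k then of_real g else 0)) \<le> \<epsilon>"
          if jk: "j \<in> {1..r}" "k \<in> {1..r}" for j k
        proof -
          have hK: "\<bar>h n l\<bar> \<le> K" if "l < n" for l using elim(1) that by simp
          have b3: "nnorm n (v i) \<le> 3" if "i \<in> {1..r}" for i using close(2)[OF that] by simp
          have p: "cmod (sf n (e n) (h n) (U j) (U k) - sf n (e n) (h n) (v j) (v k)) \<le> 6 * K * \<eta>"
            by (rule sf_perturb[OF en hK K U3 b3 U3 b3 close(1) close(1)]) (use jk in auto)
          have q: "cmod (sf n (e n) (h n) (v j) (v k) - (if j = k then of_real g else 0)) \<le> \<epsilon> / 2"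
            using a2 jk unfolding v_def near_scalar_def by blast
          have "sf n (e n) (h n) (U j) (U k) - (if j = k then of_real g else 0)
            = (sf n (e n) (h n) (U j) (U k) - sf n (e n) (h n) (v j) (v k)) + (sf n (e n) (h n) (v j) (v k) - (if j = k then of_real g else 0))"
            by simp
          moreover have "6 * K * \<eta> + \<epsilon> / 2 \<le> \<epsilon>" using K\<eta> by simp
          ultimately show ?thesis using norm_triangle_le[OF order_trans[OF add_mono[OF p q]]] by metis
        qed
        then show "model_ok orth r n \<omega> \<and>
          near_scalar r (\<lambda>j k. sf n (e n) (h n) (vec_index (uvec orth r n \<omega> j)) (vec_index (uvec orth r n \<omega> k))) g \<epsilon>"
          using G unfolding U_def model_ok_def near_scalar_def by blast
      qed
    qed
  qed
qed

end

section \<open>Location of the extreme eigenvalues\<close>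

text \<open>Adding 1/(2 G) to the values keeps \<open>t\<close> positive when all of them are
  nonpositive and makes the maximum meaningful when there are none.\<close>

lemma threshold_exists:
  assumes G: "0 < G" and \<theta>: "\<And>k. k \<in> S \<Longrightarrow> f k * G < 1" and S: "finite S"
  shows "\<exists>t>0. (\<forall>k\<in>S. f k \<le> t) \<and> t * G < (1::real)"
proof -
  define t where "t = Max (insert (1 / (2 * G)) (f ` S))"
  have "t \<in> insert (1 / (2 * G)) (f ` S)" unfolding t_def using S by (intro Max_in) auto
  then have "t * G < 1" using \<theta> G by auto
  moreover have le: "1 / (2 * G) \<le> t" "\<forall>k\<in>S. f k \<le> t" unfolding t_def using S by auto
  moreover have "0 < t"
  proof -
    have "0 < 1 / (2 * G)" using G by simp
    then show ?thesis using le(1) by linarith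
  qed
  ultimately show ?thesis by blast
qed

text \<open>The vectors \<open>U n \<omega> j\<close> enter only through the concentration of all bounded spectral forms, which
  makes the hypotheses symmetric under the reflection \<open>X \<mapsto> - X\<close>.\<close>
locale spiked_model = spectral_convergence \<mu> b L for \<mu> b L +
  fixes M :: "nat \<Rightarrow> 'w measure" and ok :: "nat \<Rightarrow> 'w \<Rightarrow> bool" and U :: "nat \<Rightarrow> 'w \<Rightarrow> nat \<Rightarrow> nat \<Rightarrow> complex"
    and r :: nat and \<theta> :: "nat \<Rightarrow> real" and A :: "nat \<Rightarrow> nat \<Rightarrow> nat \<Rightarrow> complex"
    and e :: "nat \<Rightarrow> nat \<Rightarrow> nat \<Rightarrow> complex" and E :: "nat \<Rightarrow> 'w \<Rightarrow> nat \<Rightarrow> real"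
  assumes prob_M: "\<And>n. prob_space (M n)" and r_pos: "1 \<le> r"
    and sorted: "\<And>k l. 1 \<le> k \<Longrightarrow> k \<le> l \<Longrightarrow> l \<le> r \<Longrightarrow> \<theta> k \<le> \<theta> l"
    and spec_A: "\<And>n. 1 \<le> n \<Longrightarrow> spec n (A n) (e n) (L n)"
    and spec_E: "\<And>n \<omega>. 1 \<le> n \<Longrightarrow> \<exists>e'. spec n (low_rank_pert r \<theta> (U n \<omega>) (A n)) e' (E n \<omega>)"
    and concentration: "\<And>(e' :: nat \<Rightarrow> nat \<Rightarrow> nat \<Rightarrow> complex) h K g \<epsilon>.
      (\<And>n. 1 \<le> n \<Longrightarrow> orthonormal n n (e' n)) \<Longrightarrow>
      eventually (\<lambda>n. \<forall>l<n. \<bar>h n l\<bar> \<le> K) sequentially \<Longrightarrow> 0 \<le> K \<Longrightarrow>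
      (\<lambda>n. (1 / real n) * (\<Sum>l<n. h n l)) \<longlonglongrightarrow> g \<Longrightarrow> 0 < \<epsilon> \<Longrightarrow>
      whp M (\<lambda>n \<omega>. ok n \<omega> \<and> near_scalar r (\<lambda>j k. sf n (e' n) (h n) (U n \<omega> j) (U n \<omega> k)) g \<epsilon>)"
begin

lemma orthonormal_e: "1 \<le> n \<Longrightarrow> orthonormal n n (e n)"
  using spec_A by (simp add: spec_def)

lemma resolvent_concentration:
  assumes z: "b < z" and \<epsilon>: "0 < \<epsilon>"
  shows "whp M (\<lambda>n \<omega>. ok n \<omega> \<and>
    near_scalar r (\<lambda>j k. sf n (e n) (\<lambda>k. 1 / (z - L n k)) (U n \<omega> j) (U n \<omega> k)) (cauchy_transform \<mu> z) \<epsilon>)"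
proof (rule concentration[OF orthonormal_e _ _ trace_limit[OF z] \<epsilon>])
  define c where "c = (b + z) / 2"
  have c: "b < c" "c < z" using z by (auto simp: c_def)
  show "0 \<le> 1 / (z - c)" using c by simp
  show "eventually (\<lambda>n. \<forall>l<n. \<bar>1 / (z - L n l)\<bar> \<le> 1 / (z - c)) sequentially"
    using eventually_less[OF c(1)]
  proof eventually_elim
    case (elim n)
    show ?case
    proof (intro allI impI)
      fix l assume "l < n"
      then have "z - c \<le> z - L n l" "0 < z - c" using elim c by (auto simp: less_imp_le)
      then show "\<bar>1 / (z - L n l)\<bar> \<le> 1 / (z - c)" by (simp add: divide_left_mono)
    qed
  qed
qed

lemma whp_ok: "whp M ok"
  by (rule whp_mono[OF resolvent_concentration[of "b + 1" 1]]) auto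

lemma accuracy_upper:
  fixes t G :: real
  assumes "0 < t" "t * G < 1"
  shows "\<exists>\<epsilon>::real. 0 < \<epsilon> \<and> t * (G + r * \<epsilon>) \<le> 1"
proof (intro exI conjI)
  have rp: "0 < real r" using r_pos by simp
  show "0 < (1 - t * G) / (t * r)" using assms rp by simp
  have "t * (real r * ((1 - t * G) / (t * r))) = 1 - t * G" using assms rp by simp
  then show "t * (G + r * ((1 - t * G) / (t * r))) \<le> 1" by (simp add: distrib_left)
qed

text \<open>At \<epsilon> = 0 the last inequality is strict, G < \<tau> G^2, so by continuity it
  survives for small positive \<epsilon>.\<close>

lemma accuracy_lower:
  fixes \<tau> G \<Theta> :: real
  assumes "0 < G" "1 < \<tau> * G"
  shows "\<exists>\<epsilon>::real. 0 < \<epsilon> \<and> r * \<epsilon> < G \<and> G + r * \<epsilon> + 2 * \<tau> * G * \<epsilon> * r + \<Theta> * \<epsilon>\<^sup>2 * r\<^sup>2 \<le> \<tau> * G\<^sup>2"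
proof -
  have t1: "((\<lambda>\<epsilon>. real r * \<epsilon>) \<longlongrightarrow> real r * 0) (at_right (0::real))" by (intro tendsto_intros)
  have t2: "((\<lambda>\<epsilon>. G + r * \<epsilon> + 2 * \<tau> * G * \<epsilon> * r + \<Theta> * \<epsilon>\<^sup>2 * r\<^sup>2) \<longlongrightarrow> G + real r * 0 + 2 * \<tau> * G * 0 * real r + \<Theta> * 0\<^sup>2 * real (r\<^sup>2)) (at_right (0::real))"
    by (intro tendsto_intros)
  have lt: "G < \<tau> * G\<^sup>2" using assms by (simp add: power2_eq_square)
  have "eventually (\<lambda>\<epsilon>. r * \<epsilon> < G) (at_right (0::real))"
    by (rule order_tendstoD(2)[OF t1]) (use assms in simp)
  moreover have "eventually (\<lambda>\<epsilon>. G + r * \<epsilon> + 2 * \<tau> * G * \<epsilon> * r + \<Theta> * \<epsilon>\<^sup>2 * r\<^sup>2 < \<tau> * G\<^sup>2) (at_right (0::real))"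
    by (rule order_tendstoD(2)[OF t2]) (use lt in simp)
  moreover have "eventually (\<lambda>\<epsilon>::real. 0 < \<epsilon>) (at_right 0)" by (simp add: eventually_at_right_less)
  ultimately have "eventually (\<lambda>\<epsilon>. 0 < \<epsilon> \<and> r * \<epsilon> < G \<and> G + r * \<epsilon> + 2 * \<tau> * G * \<epsilon> * r + \<Theta> * \<epsilon>\<^sup>2 * r\<^sup>2 \<le> \<tau> * G\<^sup>2) (at_right (0::real))"
    by eventually_elim auto
  from eventually_happens'[OF trivial_limit_at_right_real this] show ?thesis by blast
qed

lemma edge_le:
  assumes z: "b < z" and \<theta>: "\<And>k. 1 \<le> k \<Longrightarrow> k + i \<le> r \<Longrightarrow> \<theta> k * cauchy_transform \<mu> z < 1"
  shows "whp M (\<lambda>n \<omega>. E n \<omega> (n - i - 1) \<le> z)"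
proof -
  let ?G = "cauchy_transform \<mu> z"
  obtain t where t: "0 < t" "\<forall>k\<in>{k. 1 \<le> k \<and> k + i \<le> r}. \<theta> k \<le> t" "t * ?G < 1"
  proof -
    have "finite {k. 1 \<le> k \<and> k + i \<le> r}" by (rule finite_subset[of _ "{..r}"]) auto
    then show ?thesis
      using threshold_exists[OF cauchy_transform_pos[OF z], of "{k. 1 \<le> k \<and> k + i \<le> r}" \<theta>] \<theta> that by blast
  qed
  obtain \<epsilon> :: real where \<epsilon>: "0 < \<epsilon>" "t * (?G + r * \<epsilon>) \<le> 1" using accuracy_upper[OF t(1,3)] by blast
  show ?thesis
  proof (rule whp_mono[OF resolvent_concentration[OF z \<epsilon>(1)]])
    show "eventually (\<lambda>n. \<forall>\<omega>\<in>space (M n). ok n \<omega> \<and>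
      near_scalar r (\<lambda>j k. sf n (e n) (\<lambda>k. 1 / (z - L n k)) (U n \<omega> j) (U n \<omega> k)) ?G \<epsilon>
      \<longrightarrow> E n \<omega> (n - i - 1) \<le> z) sequentially"
      using eventually_less[OF z] eventually_gt_at_top[of i]
    proof eventually_elim
      case (elim n)
      then have n1: "1 \<le> n" by simp
      show ?case
      proof (intro ballI impI, elim conjE)
        fix \<omega> assume N: "near_scalar r (\<lambda>j k. sf n (e n) (\<lambda>k. 1 / (z - L n k)) (U n \<omega> j) (U n \<omega> k)) ?G \<epsilon>"
        obtain e' where e': "spec n (low_rank_pert r \<theta> (U n \<omega>) (A n)) e' (E n \<omega>)" using spec_E[OF n1] by blast
        show "E n \<omega> (n - i - 1) \<le> z"
          by (rule low_rank_eig_upper[OF spec_A[OF n1] e' _ elim(2) t(1) _ N less_imp_le[OF \<epsilon>(1)] \<epsilon>(2)])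
            (use elim(1) t(2) in auto)
      qed
    qed
  qed
qed

text \<open>Only the smallest of the top \<open>i + 1\<close> spikes, \<theta>(r - i), has to be
  supercritical at \<open>z\<close>; by monotonicity the larger ones are too, while the remaining
  spikes enter only through the bound \<Theta>.\<close>

lemma edge_ge:
  assumes z: "b < z" and i: "i < r" and \<theta>: "1 < \<theta> (r - i) * cauchy_transform \<mu> z"
  shows "whp M (\<lambda>n \<omega>. z \<le> E n \<omega> (n - i - 1))"
proof -
  let ?G = "cauchy_transform \<mu> z"
  have G: "0 < ?G" by (rule cauchy_transform_pos[OF z])
  have \<tau>: "0 \<le> \<theta> (r - i)" using \<theta> G by (smt (verit) mult_nonpos_nonneg)
  define \<Theta> where "\<Theta> = (\<Sum>k\<in>{1..r}. \<bar>\<theta> k\<bar>)"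
  have \<Theta>: "\<bar>\<theta> k\<bar> \<le> \<Theta>" if "k \<in> {1..r}" for k
    unfolding \<Theta>_def using that by (intro member_le_sum) auto
  obtain \<epsilon> :: real where \<epsilon>: "0 < \<epsilon>" "r * \<epsilon> < ?G"
    "?G + r * \<epsilon> + 2 * \<theta> (r - i) * ?G * \<epsilon> * r + \<Theta> * \<epsilon>\<^sup>2 * r\<^sup>2 \<le> \<theta> (r - i) * ?G\<^sup>2"
    using accuracy_lower[OF G \<theta>, of \<Theta>] by blast
  show ?thesis
  proof (rule whp_mono[OF resolvent_concentration[OF z \<epsilon>(1)]])
    show "eventually (\<lambda>n. \<forall>\<omega>\<in>space (M n). ok n \<omega> \<and>
      near_scalar r (\<lambda>j k. sf n (e n) (\<lambda>k. 1 / (z - L n k)) (U n \<omega> j) (U n \<omega> k)) ?G \<epsilon>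
      \<longrightarrow> z \<le> E n \<omega> (n - i - 1)) sequentially"
      using eventually_less[OF z] eventually_gt_at_top[of i]
    proof eventually_elim
      case (elim n)
      then have n1: "1 \<le> n" by simp
      show ?case
      proof (intro ballI impI, elim conjE)
        fix \<omega> assume N: "near_scalar r (\<lambda>j k. sf n (e n) (\<lambda>k. 1 / (z - L n k)) (U n \<omega> j) (U n \<omega> k)) ?G \<epsilon>"
        obtain e' where e': "spec n (low_rank_pert r \<theta> (U n \<omega>) (A n)) e' (E n \<omega>)" using spec_E[OF n1] by blast
        show "z \<le> E n \<omega> (n - i - 1)"
          by (rule low_rank_eig_lower[OF spec_A[OF n1] e' _ elim(2) i \<tau> _ \<Theta> N less_imp_le[OF \<epsilon>(1)] \<epsilon>(2,3)])
            (use elim(1) i in \<open>auto intro: sorted\<close>)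
      qed
    qed
  qed
qed

text \<open>Deterministic for large \<open>n\<close>: interlacing loses \<open>r\<close> positions,
  so the bound for the eigenvalue of \<open>A\<close> at depth \<open>i + r\<close> from the top is
  the one used.\<close>

lemma edge_ge_bulk:
  assumes z: "z < b"
  shows "whp M (\<lambda>n \<omega>. z \<le> E n \<omega> (n - i - 1))"
proof (rule whp_mono[OF whp_ok])
  show "eventually (\<lambda>n. \<forall>\<omega>\<in>space (M n). ok n \<omega> \<longrightarrow> z \<le> E n \<omega> (n - i - 1)) sequentially"
    using eventually_edge_ge[OF z, of "i + r"] eventually_gt_at_top[of "i + r"]
  proof eventually_elim
    case (elim n)
    then have n1: "1 \<le> n" by simp
    show ?case
    proof (intro ballI impI)
      fix \<omega>
      obtain e' where e': "spec n (low_rank_pert r \<theta> (U n \<omega>) (A n)) e' (E n \<omega>)" using spec_E[OF n1] by blast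
      show "z \<le> E n \<omega> (n - i - 1)"
        by (rule low_rank_interlacing[OF spec_A[OF n1] e' elim(2)]) (use elim(1) in \<open>simp add: add.assoc\<close>)
    qed
  qed
qed

text \<open>The upper bound tests the resolvent at \<rho> + \<epsilon>, always above the edge; for i
  \<ge> r its condition on the spikes is void. For the lower bound the test point must also lie
  above the edge, which is possible only for an outlier; when \<rho> is the edge itself, interlacing
  takes over.\<close>

lemma eigenvalue_location:
  assumes \<rho>: "\<rho> = (if i < r \<and> 0 < \<theta> (r - i) then location (\<theta> (r - i)) else b)" and \<epsilon>: "0 < \<epsilon>"
  shows "whp M (\<lambda>n \<omega>. ok n \<omega> \<and> \<bar>E n \<omega> (n - i - 1) - \<rho>\<bar> \<le> \<epsilon>)"
proof -
  have \<rho>b: "b \<le> \<rho>" unfolding \<rho> using location(1) by simp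
  have z: "b < \<rho> + \<epsilon>" using \<rho>b \<epsilon> by simp
  have upper: "whp M (\<lambda>n \<omega>. E n \<omega> (n - i - 1) \<le> \<rho> + \<epsilon>)"
  proof (rule edge_le[OF z])
    fix k assume k: "1 \<le> k" "k + i \<le> r"
    have G: "0 \<le> cauchy_transform \<mu> (\<rho> + \<epsilon>)" using cauchy_transform_pos[OF z] by simp
    have "\<theta> k * cauchy_transform \<mu> (\<rho> + \<epsilon>) \<le> \<theta> (r - i) * cauchy_transform \<mu> (\<rho> + \<epsilon>)"
      using k by (intro mult_right_mono sorted G) auto
    also have "\<dots> < 1"
    proof (cases "0 < \<theta> (r - i)")
      case True
      then have "\<rho> = location (\<theta> (r - i))" using k by (simp add: \<rho>)
      then show ?thesis using location(2)[OF True z] \<epsilon> by simp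
    next
      case False
      then have "\<theta> (r - i) * cauchy_transform \<mu> (\<rho> + \<epsilon>) \<le> 0" using G by (intro mult_nonpos_nonneg) auto
      then show ?thesis by simp
    qed
    finally show "\<theta> k * cauchy_transform \<mu> (\<rho> + \<epsilon>) < 1" .
  qed
  have lower: "whp M (\<lambda>n \<omega>. \<rho> - \<epsilon> \<le> E n \<omega> (n - i - 1))"
  proof (cases "b < \<rho>")
    case True
    then have i: "i < r" "0 < \<theta> (r - i)" and loc: "\<rho> = location (\<theta> (r - i))" by (auto simp: \<rho> split: if_splits)
    \<comment> \<open>\<rho> - \<epsilon> may fall below the edge, where the resolvent is not
      controlled; the midpoint of the edge and \<rho> then serves as test point.\<close>
    define y where "y = max (\<rho> - \<epsilon>) ((b + \<rho>) / 2)"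
    have y: "b < y" "y < \<rho>" "\<rho> - \<epsilon> \<le> y" using True \<epsilon> unfolding y_def by (auto simp: less_max_iff_disj)
    have "whp M (\<lambda>n \<omega>. y \<le> E n \<omega> (n - i - 1))"
      using location(3)[OF i(2) y(1)] y(2) loc by (intro edge_ge y(1) i(1)) simp
    then show ?thesis by (rule whp_mono) (use y(3) in auto)
  next
    case False
    then show ?thesis using \<epsilon> by (intro edge_ge_bulk) simp
  qed
  show ?thesis
    by (rule whp_mono[OF whp_conj[OF prob_M whp_ok whp_conj[OF prob_M upper lower]]])
      (intro always_eventually, auto simp: abs_le_iff)
qed

text \<open>Concentration is assumed for every orthonormal family and every bounded
  \<open>h\<close>, hence also for the reflected eigenbasis; renumbering the vectors permutes the
  entries of the matrix of forms and so preserves \<open>near_scalar\<close>.\<close>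

lemma reflected:
  assumes "spectral_convergence \<mu>' b' (\<lambda>n k. - L n (n - 1 - k))"
  shows "spiked_model \<mu>' b' (\<lambda>n k. - L n (n - 1 - k)) M ok (\<lambda>n \<omega> j. U n \<omega> (r + 1 - j)) r
    (\<lambda>k. - \<theta> (r + 1 - k)) (\<lambda>n i j. - A n i j) (\<lambda>n k. e n (n - 1 - k)) (\<lambda>n \<omega> k. - E n \<omega> (n - 1 - k))"
proof (intro spiked_model.intro spiked_model_axioms.intro assms prob_M r_pos)
  show "- \<theta> (r + 1 - k) \<le> - \<theta> (r + 1 - l)" if "1 \<le> k" "k \<le> l" "l \<le> r" for k l
    using sorted[of "r + 1 - l" "r + 1 - k"] that by simp
  show "spec n (\<lambda>i j. - A n i j) (\<lambda>k. e n (n - 1 - k)) (\<lambda>k. - L n (n - 1 - k))" if "1 \<le> n" for n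
    by (rule spec_uminus[OF spec_A[OF that]])
  show "\<exists>e'. spec n (low_rank_pert r (\<lambda>k. - \<theta> (r + 1 - k)) (\<lambda>j. U n \<omega> (r + 1 - j)) (\<lambda>i j. - A n i j)) e'
      (\<lambda>k. - E n \<omega> (n - 1 - k))" if "1 \<le> n" for n \<omega>
    using spec_E[OF that, of \<omega>] spec_low_rank_uminus by blast
  fix e' :: "nat \<Rightarrow> nat \<Rightarrow> nat \<Rightarrow> complex" and h K g and \<epsilon> :: real
  assume *: "\<And>n. 1 \<le> n \<Longrightarrow> orthonormal n n (e' n)" "eventually (\<lambda>n. \<forall>l<n. \<bar>h n l\<bar> \<le> K) sequentially" "0 \<le> K"
    "(\<lambda>n. (1 / real n) * (\<Sum>l<n. h n l)) \<longlonglongrightarrow> g" "0 < \<epsilon>"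
  show "whp M (\<lambda>n \<omega>. ok n \<omega> \<and> near_scalar r (\<lambda>j k. sf n (e' n) (h n) (U n \<omega> (r + 1 - j)) (U n \<omega> (r + 1 - k))) g \<epsilon>)"
    by (rule whp_mono[OF concentration[OF *]]) (assumption, intro always_eventually, blast dest: near_scalar_reverse)
qed

end

section \<open>The models of the theorem as instances of the spiked model\<close>

lemma A1_subgaussian_law:
  assumes "assumption_A1 \<nu>"
  shows "\<exists>c s D. subgaussian_law \<nu> c s D"
proof -
  have A: "prob_space \<nu>" "sets \<nu> = sets borel" "log_sobolev \<nu>" "integrable \<nu> (\<lambda>z. z)" "(\<integral>z. z \<partial>\<nu>) = 0"
    "integrable \<nu> (\<lambda>z. (cmod z)\<^sup>2)" "(\<integral>z. (cmod z)\<^sup>2 \<partial>\<nu>) = 1"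
    using assms by (auto simp: assumption_A1_def)
  obtain c where c: "0 < c" "\<And>t::complex. (\<integral>\<^sup>+z. ennreal (exp (Re (cnj t * z))) \<partial>\<nu>) \<le> ennreal (exp (c * (cmod t)\<^sup>2 / 2))"
    using log_sobolev_subgaussian[OF A(1-5)] by blast
  obtain s D where "0 < s" "0 \<le> D" "(\<integral>\<^sup>+z. ennreal (exp (s * (cmod z)\<^sup>2)) \<partial>\<nu>) \<le> ennreal D"
    using exp_square_integrable[OF A(2) c] by blast
  then have "subgaussian_law \<nu> c s D"
    using A c by (intro subgaussian_law.intro) auto
  then show ?thesis by blast
qed

context subgaussian_law
begin

lemma hermitian_perturbed:
  assumes X: "hermitian_mat n X"
  shows "hermitian_mat n (perturbed orth r \<theta> X n \<omega>)"
proof -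
  have "perturbed orth r \<theta> X n \<omega> $$ (i,j) = cnj (perturbed orth r \<theta> X n \<omega> $$ (j,i))" if "i < n" "j < n" for i j
  proof -
    have "X $$ (i,j) = cnj (X $$ (j,i))" using X that unfolding hermitian_mat_def by blast
    then show ?thesis using that by (simp add: perturbed_def mult_ac)
  qed
  then show ?thesis by (simp add: hermitian_mat_def perturbed_def)
qed

lemma measurable_eig_event:
  assumes X: "hermitian_mat n X" and V: "open V" and j: "j < n"
  shows "{\<omega> \<in> space (sample_space \<nu> r n). model_ok orth r n \<omega> \<and> eigs (perturbed orth r \<theta> X n \<omega>) ! j \<in> V}
    \<in> sets (sample_space \<nu> r n)"
proof -
  let ?E = "\<lambda>\<omega>. eigs (perturbed orth r \<theta> X n \<omega>) ! j"
  have m: "?E \<in> borel_measurable (sample_space \<nu> r n)"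
  proof (rule measurable_eig[OF hermitian_perturbed[OF X] _ j])
    fix i j assume ij: "i < n" "j < n"
    then have "(\<lambda>\<omega>. X $$ (i,j) + (\<Sum>k\<in>{1..r}. complex_of_real (\<theta> k) * vec_index (uvec orth r n \<omega> k) i
        * cnj (vec_index (uvec orth r n \<omega> k) j))) \<in> borel_measurable (sample_space \<nu> r n)"
      by (intro borel_measurable_add borel_measurable_const borel_measurable_sum borel_measurable_times
          borel_measurable_cnj measurable_uvec)
    then show "(\<lambda>\<omega>. perturbed orth r \<theta> X n \<omega> $$ (i,j)) \<in> borel_measurable (sample_space \<nu> r n)"
      using ij by (simp add: perturbed_def)
  qed
  have "{\<omega> \<in> space (sample_space \<nu> r n). model_ok orth r n \<omega> \<and> ?E \<omega> \<in> V}
    = {\<omega> \<in> space (sample_space \<nu> r n). model_ok orth r n \<omega>} \<inter> (?E -` V \<inter> space (sample_space \<nu> r n))"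
    by auto
  also have "\<dots> \<in> sets (sample_space \<nu> r n)"
    using V measurable_model_ok m by (intro sets.Int measurable_sets[of _ _ borel]) auto
  finally show ?thesis .
qed

text \<open>The predicate \<open>i\<close> says that the position \<open>j n\<close> lies within the
  list of eigenvalues. It stands for \<open>i \<le> n\<close> or \<open>i < n\<close> in the two
  halves of the theorem, and the finitely many \<open>n\<close> where it fails are absorbed in the
  constants.\<close>

lemma overwhelming_eig_event:
  assumes X: "\<And>n. 1 \<le> n \<Longrightarrow> hermitian_mat n (X n)"
    and V: "open V" and \<rho>: "\<rho> \<in> V" and j: "\<And>n. i n \<Longrightarrow> j n < n" and i: "eventually i sequentially"
    and near: "\<And>\<epsilon>. 0 < \<epsilon> \<Longrightarrow> whp (sample_space \<nu> r)
      (\<lambda>n \<omega>. model_ok orth r n \<omega> \<and> \<bar>eigs (perturbed orth r \<theta> (X n) n \<omega>) ! j n - \<rho>\<bar> \<le> \<epsilon>)"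
  shows "overwhelming (\<lambda>n. measure (sample_space \<nu> r n) {\<omega> \<in> space (sample_space \<nu> r n).
     model_ok orth r n \<omega> \<and> i n \<and> eigs (perturbed orth r \<theta> (X n) n \<omega>) ! j n \<in> V})"
proof (rule whp_overwhelming[OF prob_space_sample])
  obtain \<epsilon> where \<epsilon>: "0 < \<epsilon>" "cball \<rho> \<epsilon> \<subseteq> V" using V \<rho> open_contains_cball by blast
  show "whp (sample_space \<nu> r) (\<lambda>n \<omega>. model_ok orth r n \<omega> \<and> i n \<and> eigs (perturbed orth r \<theta> (X n) n \<omega>) ! j n \<in> V)"
  proof (rule whp_mono[OF near[OF \<epsilon>(1)]])
    show "eventually (\<lambda>n. \<forall>\<omega>\<in>space (sample_space \<nu> r n).
      model_ok orth r n \<omega> \<and> \<bar>eigs (perturbed orth r \<theta> (X n) n \<omega>) ! j n - \<rho>\<bar> \<le> \<epsilon> \<longrightarrow>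
      model_ok orth r n \<omega> \<and> i n \<and> eigs (perturbed orth r \<theta> (X n) n \<omega>) ! j n \<in> V) sequentially"
      using i
    proof eventually_elim
      case (elim n)
      have "x \<in> V" if "\<bar>x - \<rho>\<bar> \<le> \<epsilon>" for x
        using that \<epsilon>(2) by (auto simp: dist_real_def abs_minus_commute)
      then show ?case using elim by blast
    qed
  qed
  show "{\<omega> \<in> space (sample_space \<nu> r n). model_ok orth r n \<omega> \<and> i n \<and> eigs (perturbed orth r \<theta> (X n) n \<omega>) ! j n \<in> V}
    \<in> sets (sample_space \<nu> r n)" for n
    using measurable_eig_event[OF X V, of n "j n"] j[of n] by (cases "i n") auto
qed

end

theorem theorem2p1:
  fixes X :: "nat \<Rightarrow> complex mat" and \<mu> :: "real measure" and \<nu> :: "complex measure"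
    and r r0 :: nat and \<theta> :: "nat \<Rightarrow> real" and orth :: bool
  assumes H1: "hypothesis_H1 X \<mu>"
    and A1: "assumption_A1 \<nu>"
    and r_pos: "r \<ge> 1"
    and theta_sorted: "\<And>k l. 1 \<le> k \<Longrightarrow> k \<le> l \<Longrightarrow> l \<le> r \<Longrightarrow> \<theta> k \<le> \<theta> l"
    and r0_le: "r0 \<le> r"
    and theta_neg: "\<And>k. 1 \<le> k \<Longrightarrow> k \<le> r0 \<Longrightarrow> \<theta> k < 0"
    and theta_pos: "\<And>k. r0 < k \<Longrightarrow> k \<le> r \<Longrightarrow> \<theta> k > 0"
  shows
    "(\<forall>(i::nat) V. 1 \<le> i \<and> open V \<and>
        (if i \<le> r0 then rho \<mu> (\<theta> i) else supp_lo \<mu>) \<in> V \<longrightarrow>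
        overwhelming (\<lambda>n. measure (sample_space \<nu> r n)
          {\<omega> \<in> space (sample_space \<nu> r n). model_ok orth r n \<omega> \<and> i \<le> n \<and>
             eigs (perturbed orth r \<theta> (X n) n \<omega>) ! (i - 1) \<in> V}))
   \<and> (\<forall>(i::nat) V. open V \<and>
        (if i < r - r0 then rho \<mu> (\<theta> (r - i)) else supp_hi \<mu>) \<in> V \<longrightarrow>
        overwhelming (\<lambda>n. measure (sample_space \<nu> r n)
          {\<omega> \<in> space (sample_space \<nu> r n). model_ok orth r n \<omega> \<and> i < n \<and>
             eigs (perturbed orth r \<theta> (X n) n \<omega>) ! (n - i - 1) \<in> V}))"
proof -
  obtain c s D where law: "subgaussian_law \<nu> c s D" using A1_subgaussian_law[OF A1] by blast
  interpret subgaussian_law \<nu> c s D by (rule law)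
  have \<mu>: "prob_space \<mu>" "sets \<mu> = sets borel" "compact (meas_support \<mu>)"
    and X: "\<And>n. 1 \<le> n \<Longrightarrow> hermitian_mat n (X n)" using H1 by (auto simp: hypothesis_H1_def)
  let ?L = "\<lambda>n k. eigs (X n) ! k" and ?A = "\<lambda>n i j. X n $$ (i,j)"
    and ?U = "\<lambda>n \<omega> j. vec_index (uvec orth r n \<omega> j)" and ?E = "\<lambda>n \<omega> k. eigs (perturbed orth r \<theta> (X n) n \<omega>) ! k"
  have "\<exists>e. spec n (?A n) e (?L n)" if "1 \<le> n" for n
    by (rule spec_eigs_exists[OF X[OF that]])
  then obtain e where e: "\<And>n. 1 \<le> n \<Longrightarrow> spec n (?A n) (e n) (?L n)" by metis
  have spec_E: "\<exists>e'. spec n (low_rank_pert r \<theta> (?U n \<omega>) (?A n)) e' (?E n \<omega>)" if n: "1 \<le> n" for n \<omega>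
  proof -
    obtain e' where "spec n (\<lambda>i j. perturbed orth r \<theta> (X n) n \<omega> $$ (i,j)) e' (?E n \<omega>)"
      using spec_eigs_exists[OF hermitian_perturbed[OF X[OF n]]] by blast
    then have "spec n (low_rank_pert r \<theta> (?U n \<omega>) (?A n)) e' (?E n \<omega>)"
      by (rule spec_cong) (simp add: perturbed_def low_rank_pert_def)
    then show ?thesis by blast
  qed
  interpret top: spiked_model \<mu> "supp_hi \<mu>" ?L "sample_space \<nu> r" "model_ok orth r" ?U r \<theta> ?A e ?E
    by (intro spiked_model.intro spiked_model_axioms.intro H1_spectral_convergence_hi[OF H1] prob_space_sample
        r_pos theta_sorted e spec_E sf_concentration_uvec)
  interpret bot: spiked_model "reflect \<mu>" "- supp_lo \<mu>" "\<lambda>n k. - ?L n (n - 1 - k)" "sample_space \<nu> r" "model_ok orth r"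
      "\<lambda>n \<omega> j. ?U n \<omega> (r + 1 - j)" r "\<lambda>k. - \<theta> (r + 1 - k)" "\<lambda>n i j. - ?A n i j" "\<lambda>n k. e n (n - 1 - k)"
      "\<lambda>n \<omega> k. - ?E n \<omega> (n - 1 - k)"
    by (rule top.reflected[OF H1_spectral_convergence_lo[OF H1]])
  show ?thesis
  proof (intro conjI allI impI; elim conjE)
    fix i :: nat and V assume i: "1 \<le> i" and V: "open V" "(if i \<le> r0 then rho \<mu> (\<theta> i) else supp_lo \<mu>) \<in> V"
    \<comment> \<open>The i-th smallest eigenvalue is number i - 1 from the top in the reflected
      model, where the relevant spike has index r - (i - 1); undoing the reversal, r + 1 - (r - (i -
      1)) = i. For i > r both sides are minus the lower edge.\<close>
    have \<rho>: "- (if i \<le> r0 then rho \<mu> (\<theta> i) else supp_lo \<mu>)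
      = (if i - 1 < r \<and> 0 < - \<theta> (r + 1 - (r - (i - 1))) then bot.location (- \<theta> (r + 1 - (r - (i - 1)))) else - supp_lo \<mu>)"
    proof (cases "i \<le> r")
      case True
      then have "r + 1 - (r - (i - 1)) = i" "i - 1 < r" using i by auto
      moreover have "i \<le> r0 \<longleftrightarrow> \<theta> i < 0" using theta_neg[of i] theta_pos[of i] True i by force
      ultimately show ?thesis using rho_neg[OF \<mu>, of "\<theta> i"] by simp
    qed (use r0_le in auto)
    show "overwhelming (\<lambda>n. measure (sample_space \<nu> r n)
          {\<omega> \<in> space (sample_space \<nu> r n). model_ok orth r n \<omega> \<and> i \<le> n \<and> ?E n \<omega> (i - 1) \<in> V})"
    proof (rule overwhelming_eig_event[OF X V])
      show "eventually (\<lambda>n. i \<le> n) sequentially" by (rule eventually_ge_at_top)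
      show "i - 1 < n" if "i \<le> n" for n using that i by simp
      fix \<epsilon> :: real assume "0 < \<epsilon>"
      from bot.eigenvalue_location[OF \<rho> this]
      show "whp (sample_space \<nu> r) (\<lambda>n \<omega>. model_ok orth r n \<omega> \<and>
        \<bar>?E n \<omega> (i - 1) - (if i \<le> r0 then rho \<mu> (\<theta> i) else supp_lo \<mu>)\<bar> \<le> \<epsilon>)"
      proof (rule whp_mono)
        show "eventually (\<lambda>n. \<forall>\<omega>\<in>space (sample_space \<nu> r n). model_ok orth r n \<omega> \<and>
          \<bar>- ?E n \<omega> (n - 1 - (n - (i - 1) - 1)) - - (if i \<le> r0 then rho \<mu> (\<theta> i) else supp_lo \<mu>)\<bar> \<le> \<epsilon> \<longrightarrow>
          model_ok orth r n \<omega> \<and> \<bar>?E n \<omega> (i - 1) - (if i \<le> r0 then rho \<mu> (\<theta> i) else supp_lo \<mu>)\<bar> \<le> \<epsilon>) sequentially"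
          using eventually_ge_at_top[of i]
        proof eventually_elim
          case (elim n)
          \<comment> \<open>Two reversals of the list cancel; with truncated subtraction this needs
            i \<le> n, hence the restriction to large \<open>n\<close>.\<close>
          then have "n - 1 - (n - (i - 1) - 1) = i - 1" using i by simp
          then show ?case by (auto simp: abs_minus_commute)
        qed
      qed
    qed
  next
    fix i :: nat and V assume V: "open V" "(if i < r - r0 then rho \<mu> (\<theta> (r - i)) else supp_hi \<mu>) \<in> V"
    have \<rho>: "(if i < r - r0 then rho \<mu> (\<theta> (r - i)) else supp_hi \<mu>)
      = (if i < r \<and> 0 < \<theta> (r - i) then top.location (\<theta> (r - i)) else supp_hi \<mu>)"
    proof (cases "i < r")
      case True
      \<comment> \<open>The case distinction of the theorem counts positive spikes, that of
        \<open>eigenvalue_location\<close> looks at the sign of the spike r - i; by the choice of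
        \<open>r0\<close> they agree.\<close>
      have "i < r - r0 \<longleftrightarrow> r0 < r - i" by auto
      also have "\<dots> \<longleftrightarrow> 0 < \<theta> (r - i)" using theta_neg[of "r - i"] theta_pos[of "r - i"] True by force
      finally show ?thesis using rho_pos[OF \<mu>, of "\<theta> (r - i)"] True by simp
    qed auto
    show "overwhelming (\<lambda>n. measure (sample_space \<nu> r n)
          {\<omega> \<in> space (sample_space \<nu> r n). model_ok orth r n \<omega> \<and> i < n \<and> ?E n \<omega> (n - i - 1) \<in> V})"
      by (rule overwhelming_eig_event[OF X V _ eventually_gt_at_top top.eigenvalue_location[OF \<rho>]]) auto
  qed
qed

end
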